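(* Let $(\mathbb{E},\|\cdot\|_{\mathbb{E}})$ be a complex Banach space, let $m_e=(m_e(p))_{p\ge0}$ be a sequence of moments, let $\tilde{\mathbb{M}}=(\tilde M_p)_{p\ge0}$ be a strongly regular sequence admitting a nonzero proximate order, and let $d\in\mathbb{R}$. Let $\hat u\in\mathbb{E}[[z]]$ be $\tilde{\mathbb{M}}$-summable in direction $d$, and write $u=\mathcal{S}_{\tilde{\mathbb{M}},d}(\hat u)\in\mathcal{O}(G,\mathbb{E})$ for its $\tilde{\mathbb{M}}$-sum, for some sectorial region $G=G_d(\theta)$ with $\theta>\pi\omega(\tilde{\mathbb{M}})$. Then for every sectorial region $G'\prec G$ there exist $C_4,C_5>0$ such that $$\left\|\partial_{m_e,z}^{n}u(z)\right\|_{\mathbb{E}}\le C_4C_5^n\,m_e(n)\,\tilde M_n$$ for all $n\in\mathbb{N}_0$ and $z\in G'$.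
   Context: Sectors. $S_d(\theta)=\{z\in\mathcal{R}:|\arg(z)-d|<\theta/2\}$, where $\mathcal{R}$ is the Riemann surface of the logarithm; $\hat S_d(\theta;r)=S_d(\theta)\cup D(0,r)$. A sectorial region $G_d(\theta)$ is a subset of $\mathcal R$ with $G_d(\theta)\subseteq S_d(\theta)\cap D(0,r)$ for some $r>0$, such that for all $0<\theta'<\theta$ there is $0<r'<r$ with $S_d(\theta')\cap D(0,r')\subseteq G_d(\theta)$. For an infinite sector $S$ with vertex at the origin, $S\prec S_d(\theta)$ means $\overline{S}\subseteq S_d(\theta)$; for sectorial regions, $G_{d'}(\theta')\prec G_d(\theta)$ means that this relation holds for the sectors involved in their definition, i.e. $S_{d'}(\theta')\prec S_d(\theta)$. $\mathbb{N}_0=\{0,1,2,\dots\}$; $\mathcal{O}(G,\mathbb{E})$ is the set of holomorphic $\mathbb{E}$-valued functions on $G$. Strongly regular sequences. A sequence $\mathbb{M}=(M_p)_{p\ge0}$ of positive reals with $M_0=1$ is strongly regular if: (lc) $M_p^2\le M_{p-1}M_{p+1}$ for $p\ge1$; (mg) there is $A_1>0$ with $M_{p+q}\le A_1^{p+q}M_pM_q$ for all $p,q\ge0$; (snq) there is $A_2>0$ with $\sum_{q\ge p}\frac{M_q}{(q+1)M_{q+1}}\le A_2\frac{M_p}{M_{p+1}}$ for all $p\ge0$. Its associated function is $M(t)=\sup_{p\ge0}\log(t^p/M_p)$ for $t>0$, $M(0)=0$. Put $\rho(M)=\limsup_{t\to\infty}\max\{0,\log M(t)/\log t\}\in(0,\infty)$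 and $\omega(\mathbb{M})=1/\rho(M)$. $\mathbb{M}$ admits a nonzero proximate order if there are a nonnegative, continuous, piecewise continuously differentiable function $\varrho(t)$ on some $(c,\infty)$ with $\lim_{t\to\infty}\varrho(t)\in(0,\infty)$ and $\lim_{t\to\infty}t\varrho'(t)\log t=0$, and constants $A,B\in\mathbb{R}$ with $A\le\log(t)\left(\varrho(t)-\frac{\log M(t)}{\log t}\right)\le B$ for $t$ large. Kernel functions and moments. Let $\mathbb{M}$ be strongly regular with $\omega(\mathbb{M})<2$ (the case $\omega(\mathbb{M})\ge2$ is handled by ramification of the kernels). Functions $e,E$ are kernel functions for $\mathbb{M}$-summability if: (1) $e$ is holomorphic on $S_0(\omega(\mathbb{M})\pi)$; there is $t_0>0$ such that every $z_0\in S_0(\omega(\mathbb{M})\pi)$ has a neighborhood $U\subseteq S_0(\omega(\mathbb{M})\pi)$ with $\int_0^{t_0}\sup_{z\in U}|e(t/z)|\frac{dt}{t}<\infty$; for every $\epsilon>0$ there are $c,k>0$ with $|e(z)|\le c\exp(-M(|z|/k))$ on $S_0(\omega(\mathbb{M})\pi-\epsilon)$; $e(x)\in\mathbb{R}$ for $x>0$. (2) $E$ is entire, $|E(z)|\le\tilde c\exp(M(|z|/\tilde k))$ on $\mathbb{C}$ for some $\tilde c,\tilde k>0$; and there is $\beta>0$ such that for all $0<\tilde\theta<2\pi-\omega(\mathbb{M})\pi$ and $M_E>0$ there is $\tilde c_2>0$ with $|E(z)|\le\tilde c_2|z|^{-\beta}$ on $S_\pi(\tilde\theta)\setminus D(0,M_E)$.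 (3) $m_e(z)=\int_0^\infty t^{z-1}e(t)\,dt$ is continuous on $\{\mathrm{Re}(z)\ge0\}$, holomorphic on $\{\mathrm{Re}(z)>0\}$, and $E(z)=\sum_{p\ge0}z^p/m_e(p)$. A sequence of moments is a sequence $m_e=(m_e(p))_{p\ge0}$ arising from such a pair of kernels for some strongly regular $\mathbb{M}$; it is a known fact that it is strongly regular and equivalent to $\mathbb{M}$ (i.e. $B_1^pM_p\le m_e(p)\le B_2^pM_p$ for some $B_1,B_2>0$). Moment differentiation. $\partial_{m_e,z}:\mathbb{E}[[z]]\to\mathbb{E}[[z]]$ is the linear operator $\partial_{m_e,z}\left(\sum_{p\ge0}\frac{u_p}{m_e(p)}z^p\right)=\sum_{p\ge0}\frac{u_{p+1}}{m_e(p)}z^p$. Summability. Let $\mathbb{M}$ be strongly regular admitting a nonzero proximate order. $\hat u=\sum_pu_pz^p\in\mathbb{E}[[z]]$ is $\mathbb{M}$-summable in direction $d$ if $\sum_p\frac{u_p}{M_p}z^p$ converges near $0$ and extends to a holomorphic function on some $\hat S_d(\theta;r)$ such that for all $0<\theta'<\theta$, $0<r'<r$ there are $\tilde c,\tilde k>0$ with norm bounded by $\tilde c\exp(M(|z|/\tilde k))$ on $\hat S_d(\theta';r')$. Equivalently (known theorem), there are a sectorial region $G_d(\theta)$ with $\theta>\omega(\mathbb{M})\pi$ and $u\in\mathcal{O}(G_d(\theta),\mathbb{E})$ such that for all $0<\theta'<\theta$ and $r'$ with $S_d(\theta')\cap D(0,r')\subseteq G_d(\theta)$ there are $C,A>0$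 with $\|u(z)-\sum_{p=0}^{N-1}u_pz^p\|_{\mathbb{E}}\le CA^NM_N|z|^N$ there, for all $N\ge1$. This $u$ is unique and is called the $\mathbb{M}$-sum $\mathcal{S}_{\mathbb{M},d}(\hat u)$. The set of $\mathbb{M}$-summable series in direction $d$ is closed under $\partial_{m_e,z}$, and moment derivatives of sums are defined by $\partial_{m_e,z}(\mathcal{S}_{\mathbb{M},d}(\hat u)):=\mathcal{S}_{\mathbb{M},d}(\partial_{m_e,z}\hat u)$, and iterates accordingly.
   Formalization: G' ≺ G additionally requires tz ∈ G for all z in the closure of G' (vertex excluded) and 0<t≤1; with only the sector condition G' may leave G or touch its outer boundary, where the bound fails. Sectorial regions are taken to be open and connected. *)

theory Defs
  imports "HOL-Analysis.Analysis" "HOL-Computational_Algebra.Formal_Power_Series"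
begin

section \<open>Complex Banach spaces and holomorphic vector-valued functions\<close>

class complex_banach = banach +
  fixes scaleC :: "complex \<Rightarrow> 'a \<Rightarrow> 'a"  (infixr "*\<^sub>C" 75)
  assumes scaleC_add_right: "a *\<^sub>C (x + y) = a *\<^sub>C x + a *\<^sub>C y"
    and scaleC_add_left: "(a + b) *\<^sub>C x = a *\<^sub>C x + b *\<^sub>C x"
    and scaleC_scaleC: "a *\<^sub>C (b *\<^sub>C x) = (a * b) *\<^sub>C x"
    and scaleC_of_real: "complex_of_real r *\<^sub>C x = r *\<^sub>R x"
    and norm_scaleC: "norm (a *\<^sub>C x) = cmod a * norm x"

instantiation complex :: complex_banach
begin

definition scaleC_complex_def: "scaleC (a :: complex) (x :: complex) = a * x"

instance
  by standard (simp_all add: scaleC_complex_def algebra_simps norm_mult scaleR_conv_of_real)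

end

definition holo_on :: "(complex \<Rightarrow> 'e::complex_banach) \<Rightarrow> complex set \<Rightarrow> bool" where
  "holo_on f S \<longleftrightarrow> (\<forall>w\<in>S. \<exists>D. (f has_derivative (\<lambda>h. h *\<^sub>C D)) (at w within S))"


section \<open>Sectors and sectorial regions\<close>

text \<open>
  The Riemann surface of the logarithm is represented by its global chart \<open>w = log z\<close>:
  a complex number \<open>w\<close> stands for the point \<open>z\<close> of the surface with \<open>|z| = exp (Re w)\<close> and
  \<open>arg z = Im w\<close>, which lies over the complex number \<open>exp w\<close>.  The chart is biholomorphic, so
  openness, closures (which do not contain the vertex), connectedness and holomorphy on the
  surface are those of the \<open>w\<close>-plane.
\<close>

definition sector :: "real \<Rightarrow> real \<Rightarrow> complex set" where
  "sector d \<theta> = {w. \<bar>Im w - d\<bar> < \<theta> / 2}"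

definition rdisc :: "real \<Rightarrow> complex set" where
  "rdisc r = {w. exp (Re w) < r}"

text \<open>Projection of a sector to the complex plane.\<close>

definition csector :: "real \<Rightarrow> real \<Rightarrow> complex set" where
  "csector d \<theta> = exp ` sector d \<theta>"

definition sectorial_region :: "real \<Rightarrow> real \<Rightarrow> complex set \<Rightarrow> bool" where
  "sectorial_region d \<theta> G \<longleftrightarrow>
     0 < \<theta> \<and> open G \<and> connected G \<and>
     (\<exists>r>0. G \<subseteq> sector d \<theta> \<inter> rdisc r \<and>
        (\<forall>\<theta>'. 0 < \<theta>' \<and> \<theta>' < \<theta> \<longrightarrow>
           (\<exists>r'. 0 < r' \<and> r' < r \<and> sector d \<theta>' \<inter> rdisc r' \<subseteq> G)))"

text \<open>
  \<open>G' \<prec> G\<close>: the sector of \<open>G'\<close> is a proper subsector of that of \<open>G\<close>, and \<open>G'\<close> also stays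
  inside \<open>G\<close> away from the vertex.  Moment differentiation is a non-local operator: its value
  at \<open>z\<close> depends on the function along the radial segment from \<open>0\<close> to \<open>z\<close>.  So the second
  condition asks that \<open>t z \<in> G\<close> for all \<open>z\<close> in the closure of \<open>G'\<close> and \<open>0 < t \<le> 1\<close>
  (\<open>t = exp (- s)\<close> in the chart).  If \<open>G\<close> is radially star-shaped, it says \<open>closure G' \<subseteq> G\<close>.
\<close>

definition sectorial_prec ::
    "real \<Rightarrow> real \<Rightarrow> complex set \<Rightarrow> real \<Rightarrow> real \<Rightarrow> complex set \<Rightarrow> bool" where
  "sectorial_prec d' \<theta>' G' d \<theta> G \<longleftrightarrow>
     closure (sector d' \<theta>') \<subseteq> sector d \<theta> \<and>
     (\<forall>w\<in>closure G'. \<forall>s\<ge>0. w - complex_of_real s \<in> G)"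


section \<open>Strongly regular sequences\<close>

definition strongly_regular :: "(nat \<Rightarrow> real) \<Rightarrow> bool" where
  "strongly_regular M \<longleftrightarrow>
     (\<forall>p. 0 < M p) \<and> M 0 = 1 \<and>
     (\<forall>p\<ge>1. (M p)\<^sup>2 \<le> M (p - 1) * M (p + 1)) \<and>
     (\<exists>A>0. \<forall>p q. M (p + q) \<le> A ^ (p + q) * M p * M q) \<and>
     (\<exists>A>0. \<forall>p.
        summable (\<lambda>j. M (p + j) / (real (p + j + 1) * M (p + j + 1))) \<and>
        (\<Sum>j. M (p + j) / (real (p + j + 1) * M (p + j + 1))) \<le> A * (M p / M (p + 1)))"

text \<open>For strongly regular \<open>M\<close> the supremum is over a set that is bounded above.\<close>

definition assoc_fun :: "(nat \<Rightarrow> real) \<Rightarrow> real \<Rightarrow> real" where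
  "assoc_fun M t = (if t = 0 then 0 else (SUP p. ln (t ^ p / M p)))"

definition rho :: "(nat \<Rightarrow> real) \<Rightarrow> ereal" where
  "rho M = Limsup at_top (\<lambda>t. ereal (max 0 (ln (assoc_fun M t) / ln t)))"

definition omega :: "(nat \<Rightarrow> real) \<Rightarrow> real" where
  "omega M = 1 / real_of_ereal (rho M)"

definition admits_nonzero_proximate_order :: "(nat \<Rightarrow> real) \<Rightarrow> bool" where
  "admits_nonzero_proximate_order M \<longleftrightarrow>
     (\<exists>c (\<sigma> :: real \<Rightarrow> real).
        (\<forall>t>c. 0 \<le> \<sigma> t) \<and> continuous_on {c<..} \<sigma> \<and>
        (\<forall>a b. c < a \<and> a < b \<longrightarrow> \<sigma> piecewise_C1_differentiable_on {a..b}) \<and>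
        (\<exists>l>0. (\<sigma> \<longlongrightarrow> l) at_top) \<and>
        ((\<lambda>t. t * deriv \<sigma> t * ln t) \<longlongrightarrow> 0)
           (inf at_top (principal {t. \<sigma> differentiable (at t)})) \<and>
        (\<exists>A B. \<forall>\<^sub>F t in at_top.
           A \<le> ln t * (\<sigma> t - ln (assoc_fun M t) / ln t) \<and>
           ln t * (\<sigma> t - ln (assoc_fun M t) / ln t) \<le> B))"


section \<open>Kernel functions and moments\<close>

definition kernel_moment :: "(complex \<Rightarrow> complex) \<Rightarrow> complex \<Rightarrow> complex" where
  "kernel_moment e z =
     (LINT t:{0<..}|lborel. complex_of_real t powr (z - 1) * e (complex_of_real t))"

definition kernel_pair ::
    "(nat \<Rightarrow> real) \<Rightarrow> (complex \<Rightarrow> complex) \<Rightarrow> (complex \<Rightarrow> complex) \<Rightarrow> bool" where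
  "kernel_pair M e E \<longleftrightarrow>
     e holomorphic_on csector 0 (omega M * pi) \<and>
     (\<exists>t0>0. \<forall>z0\<in>csector 0 (omega M * pi).
        \<exists>U. open U \<and> z0 \<in> U \<and> U \<subseteq> csector 0 (omega M * pi) \<and>
          (\<integral>\<^sup>+t\<in>{0<..<t0}. (SUP z\<in>U. ennreal (cmod (e (complex_of_real t / z)))) *
             ennreal (1 / t) \<partial>lborel) < \<infinity>) \<and>
     (\<forall>\<epsilon>>0. \<exists>c>0. \<exists>k>0. \<forall>z\<in>csector 0 (omega M * pi - \<epsilon>).
        cmod (e z) \<le> c * exp (- assoc_fun M (cmod z / k))) \<and>
     (\<forall>x>0. e (complex_of_real x) \<in> \<real>) \<and>
     E holomorphic_on UNIV \<and>
     (\<exists>c>0. \<exists>k>0. \<forall>z. cmod (E z) \<le> c * exp (assoc_fun M (cmod z / k))) \<and>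
     (\<exists>\<beta>>0. \<forall>\<theta> R. 0 < \<theta> \<and> \<theta> < 2 * pi - omega M * pi \<and> 0 < R \<longrightarrow>
        (\<exists>c>0. \<forall>z\<in>csector pi \<theta> - ball 0 R. cmod (E z) \<le> c * cmod z powr (- \<beta>))) \<and>
     continuous_on {z. 0 \<le> Re z} (kernel_moment e) \<and>
     kernel_moment e holomorphic_on {z. 0 < Re z} \<and>
     (\<forall>p::nat. kernel_moment e (of_nat p) \<noteq> 0) \<and>
     (\<forall>z. (\<lambda>p. z ^ p / kernel_moment e (of_nat p)) sums E z)"

text \<open>
  The case \<open>s = 1\<close> is that of kernels for a sequence \<open>N\<close> with \<open>omega N < 2\<close>.  A sequence \<open>M\<close>
  with \<open>omega M \<ge> 2\<close> is reached by ramification: for \<open>N p = M p powr (1 / s)\<close> and a kernel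
  \<open>e\<close> for \<open>N\<close>, the kernel for \<open>M\<close> is \<open>e (z powr (1 / s)) / s\<close>, and its moments are those of
  \<open>e\<close> at \<open>s * p\<close>.  Strong regularity of \<open>m\<close> fixes the sign and the normalisation \<open>m 0 = 1\<close>,
  which \<open>kernel_pair\<close> leaves open (\<open>(e, E)\<close> may be replaced by \<open>(- e, - E)\<close>).
\<close>

definition moment_sequence :: "(nat \<Rightarrow> real) \<Rightarrow> bool" where
  "moment_sequence m \<longleftrightarrow>
     strongly_regular m \<and>
     (\<exists>N e E (s::nat). 1 \<le> s \<and> strongly_regular N \<and> omega N < 2 \<and> kernel_pair N e E \<and>
        (\<forall>p. complex_of_real (m p) = kernel_moment e (of_nat (s * p))))"

text \<open>With \<open>f\<close> having coefficients \<open>u p / m p\<close>, the result has coefficients \<open>u (p + 1) / m p\<close>.\<close>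

definition moment_diff :: "(nat \<Rightarrow> real) \<Rightarrow> 'e::complex_banach fps \<Rightarrow> 'e fps" where
  "moment_diff m f = Abs_fps (\<lambda>p. (1 / m p) *\<^sub>R (m (p + 1) *\<^sub>R fps_nth f (p + 1)))"


section \<open>Summability\<close>

text \<open>
  A function on \<open>S_d(\<theta>) \<union> D(0,r)\<close> is given by its restrictions \<open>F\<close> to the sector (in the
  chart) and \<open>g\<close> to the disc, which agree on the overlap.
\<close>

definition msummable :: "(nat \<Rightarrow> real) \<Rightarrow> real \<Rightarrow> 'e::complex_banach fps \<Rightarrow> bool" where
  "msummable M d f \<longleftrightarrow>
     (\<exists>\<theta>>0. \<exists>r>0. \<exists>g F.
        (\<forall>z. cmod z < r \<longrightarrow> (\<lambda>p. z ^ p *\<^sub>C ((1 / M p) *\<^sub>R fps_nth f p)) sums g z) \<and>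
        holo_on F (sector d \<theta>) \<and>
        (\<forall>w\<in>sector d \<theta> \<inter> rdisc r. F w = g (exp w)) \<and>
        (\<forall>\<theta>' r'. 0 < \<theta>' \<and> \<theta>' < \<theta> \<and> 0 < r' \<and> r' < r \<longrightarrow>
           (\<exists>c>0. \<exists>k>0.
              (\<forall>w\<in>sector d \<theta>'. norm (F w) \<le> c * exp (assoc_fun M (exp (Re w) / k))) \<and>
              (\<forall>z. cmod z < r' \<longrightarrow> norm (g z) \<le> c * exp (assoc_fun M (cmod z / k))))))"

text \<open>\<open>u\<close> is the \<open>M\<close>-sum of \<open>f\<close> in direction \<open>d\<close> on the sectorial region \<open>G = G_d(\<theta>)\<close>.\<close>

definition is_msum :: "(nat \<Rightarrow> real) \<Rightarrow> real \<Rightarrow> 'e::complex_banach fps \<Rightarrow>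
    real \<Rightarrow> complex set \<Rightarrow> (complex \<Rightarrow> 'e) \<Rightarrow> bool" where
  "is_msum M d f \<theta> G u \<longleftrightarrow>
     sectorial_region d \<theta> G \<and> omega M * pi < \<theta> \<and> holo_on u G \<and>
     (\<forall>\<theta>' r'. 0 < \<theta>' \<and> \<theta>' < \<theta> \<and> 0 < r' \<and> sector d \<theta>' \<inter> rdisc r' \<subseteq> G \<longrightarrow>
        (\<exists>C>0. \<exists>A>0. \<forall>N\<ge>1. \<forall>w\<in>sector d \<theta>' \<inter> rdisc r'.
           norm (u w - (\<Sum>p<N. (exp w) ^ p *\<^sub>C fps_nth f p))
             \<le> C * A ^ N * M N * exp (Re w) ^ N))"

text \<open>
  Sums are germs at the vertex that live on several sectorial regions; \<open>v\<close> represents the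
  \<open>M\<close>-sum of \<open>f\<close> on the set \<open>G'\<close>.
\<close>

definition is_msum_over :: "(nat \<Rightarrow> real) \<Rightarrow> real \<Rightarrow> 'e::complex_banach fps \<Rightarrow>
    complex set \<Rightarrow> (complex \<Rightarrow> 'e) \<Rightarrow> bool" where
  "is_msum_over M d f G' v \<longleftrightarrow> (\<exists>\<theta> G. is_msum M d f \<theta> G v \<and> G' \<subseteq> G)"

end

theory Submission
  imports Defs "HOL-Complex_Analysis.Complex_Analysis"
begin

text \<open>
  In the chart \<open>w = log z\<close> let \<open>U n\<close> be the normalised remainder
  \<open>U n w = exp (- n * w) * (u w - (\<Sum>p<n. exp w ^ p * u_p))\<close>, which is bounded by
  \<open>C * A ^ n * Mt n\<close>.  The \<open>n\<close>-th moment derivative multiplies the coefficient \<open>u_(p + n)\<close> by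
  \<open>m (p + n) / m p\<close>, so it is the convolution
  \<open>(1 / (2 * pi * \<i>)) * \<integral> U n (z + w) * \<kappa> n w dw\<close> with
  \<open>\<kappa> n w = (\<Sum>p. exp (- p * w) * m (p + n) / m p)\<close>, taken along the boundary of a thin half strip
  around the negative real axis, i.e. along a thin loop around the segment from the vertex to \<open>z\<close>.
  The kernels \<open>e\<close> and \<open>E\<close> continue \<open>\<kappa> n\<close> analytically off the cut
  \<open>Re w \<le> 0, Im w \<in> 2 * pi * \<int>\<close>, through \<open>\<integral> e (exp \<xi>) * E (exp (\<xi> - w)) * exp (n * \<xi>) d\<xi>\<close>,
  and show that \<open>\<kappa> n w\<close> is bounded by \<open>C * B ^ n * m n * exp (\<gamma> * Re w)\<close>.  The product of the two bounds
  is the claim.  Sums are unique by Watson's lemma; identities between functions with values in the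
  Banach space are reduced to scalar ones by norming functionals.
\<close>

section \<open>Norming functionals\<close>

text \<open>Every estimate that enters the bound may lose only factors geometric in
  \<open>n\<close>, which shapes the proof. A Cauchy integral over a circle around \<open>z\<close>
  does not suffice, because moment differentiation is not local and depends on \<open>u\<close>
  along the whole segment to the vertex. Replacing \<open>u\<close> by \<open>U n\<close> brings in
  exactly \<open>Mt n\<close>: the derivative discards the first \<open>n\<close> coefficients
  anyway, and division by \<open>z ^ n\<close> is the normalisation of the asymptotic bound. The
  loop must hug the segment, as \<open>U n\<close> is controlled only inside \<open>G\<close>; this
  is why \<kappa> has to be continued up to the cut. For \<open>Re w > 0\<close> its series
  converges, since \<open>m (p + n) / m p\<close> is subexponential in \<open>p\<close>; towards the
  vertex the factor \<open>exp (\<gamma> * Re w)\<close> makes the integral converge. The loop comes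
  from extracting coefficients over a vertical segment of length \<open>2 * pi\<close>, most of
  which is moved by Cauchy's theorem onto the two rays. The construction yields one sum of the
  derived series, while the claim concerns every representative; hence the need for
  uniqueness.\<close>

lemma scaleR_scaleC_left: "(r *\<^sub>R a) *\<^sub>C (x::'e::complex_banach) = r *\<^sub>R (a *\<^sub>C x)"
  by (metis scaleC_of_real scaleC_scaleC scaleR_conv_of_real)

lemma scaleR_scaleC_right: "a *\<^sub>C (r *\<^sub>R (x::'e::complex_banach)) = r *\<^sub>R (a *\<^sub>C x)"
  by (metis mult.commute scaleC_of_real scaleC_scaleC)

lemma bounded_bilinear_scaleC:
  "bounded_bilinear (scaleC :: complex \<Rightarrow> 'e::complex_banach \<Rightarrow> 'e)"
proof
  show "\<exists>K. \<forall>a (b::'e). norm (a *\<^sub>C b) \<le> norm a * norm b * K"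
    by (rule exI[of _ 1]) (simp add: norm_scaleC)
qed (simp_all add: scaleC_add_right scaleC_add_left scaleR_scaleC_left scaleR_scaleC_right)

interpretation scaleC: bounded_bilinear "scaleC :: complex \<Rightarrow> 'e::complex_banach \<Rightarrow> 'e"
  by (rule bounded_bilinear_scaleC)

lemma scaleC_one [simp]: "1 *\<^sub>C (x::'e::complex_banach) = x"
  using scaleC_of_real[of 1 x] by simp

definition sublinear_le_norm :: "('e::real_normed_vector \<Rightarrow> real) \<Rightarrow> bool" where
  "sublinear_le_norm p \<longleftrightarrow> (\<forall>x y. p (x + y) \<le> p x + p y) \<and>
     (\<forall>c x. 0 \<le> c \<longrightarrow> p (c *\<^sub>R x) = c * p x) \<and> (\<forall>x. p x \<le> norm x)"

lemma sublinear_le_normD: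
  assumes "sublinear_le_norm p"
  shows "p (x + y) \<le> p x + p y" "0 \<le> c \<Longrightarrow> p (c *\<^sub>R x) = c * p x" "p x \<le> norm x"
    "p 0 = 0" "- p (- x) \<le> p x" "- norm x \<le> p x"
proof -
  have a: "p (x + y) \<le> p x + p y" "0 \<le> c \<Longrightarrow> p (c *\<^sub>R x) = c * p x" "p x \<le> norm x" for x y c
    using assms by (auto simp: sublinear_le_norm_def)
  show "p (x + y) \<le> p x + p y" "0 \<le> c \<Longrightarrow> p (c *\<^sub>R x) = c * p x" "p x \<le> norm x"
    by (fact a)+
  show z: "p 0 = 0" using a(2)[of 0 0] by simp
  show b: "- p (- x) \<le> p x" using a(1)[of x "-x"] z by simp
  show "- norm x \<le> p x" using b a(3)[of "-x"] by simp
qed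

text \<open>A Hahn-Banach device: if \<open>p\<close> cannot be lowered, then \<open>q = p\<close>,
  and the third bound with \<open>t = 1\<close> reads \<open>p x + p y \<le> p (x + y)\<close>, the
  half of additivity that sublinearity lacks. Sublinearity of \<open>p\<close> keeps the infimum
  above \<open>- p (- x)\<close>.\<close>

lemma sublinear_le_norm_shift:
  fixes p :: "'e::real_normed_vector \<Rightarrow> real" and y :: 'e
  assumes p: "sublinear_le_norm p"
  defines "q \<equiv> \<lambda>x. INF t\<in>{0..}. p (x + t *\<^sub>R y) - t * p y"
  shows "sublinear_le_norm q" "q x \<le> p x" "t \<ge> 0 \<Longrightarrow> q x \<le> p (x + t *\<^sub>R y) - t * p y"
proof -
  note P = sublinear_le_normD[OF p]
  have low: "- p (- x) \<le> p (x + t *\<^sub>R y) - t * p y" if "t \<ge> 0" for x t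
    using P(1)[of "x + t *\<^sub>R y" "- x"] P(2)[OF that, of y] by (simp add: algebra_simps)
  have bdd: "bdd_below ((\<lambda>t. p (x + t *\<^sub>R y) - t * p y) ` {0..})" for x
    by (rule bdd_belowI2[where m="- p (-x)"]) (use low in auto)
  show up: "t \<ge> 0 \<Longrightarrow> q x \<le> p (x + t *\<^sub>R y) - t * p y" for t x
    unfolding q_def by (rule cINF_lower[OF bdd]) auto
  show qp: "q x \<le> p x" for x
    using up[of 0 x] by simp
  have great: "m \<le> q x" if "\<And>t. t \<ge> 0 \<Longrightarrow> m \<le> p (x + t *\<^sub>R y) - t * p y" for m x
    unfolding q_def by (rule cINF_greatest) (use that in auto)
  have add: "q (x + z) \<le> q x + q z" for x z
  proof -
    have "q (x + z) - (p (z + t *\<^sub>R y) - t * p y) \<le> q x" if t: "t \<ge> 0" for t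
    proof (rule great)
      fix s :: real assume s: "s \<ge> 0"
      have "q (x + z) \<le> p (x + z + (s + t) *\<^sub>R y) - (s + t) * p y"
        by (rule up) (use s t in auto)
      also have "x + z + (s + t) *\<^sub>R y = (x + s *\<^sub>R y) + (z + t *\<^sub>R y)" by (simp add: algebra_simps)
      also have "p \<dots> \<le> p (x + s *\<^sub>R y) + p (z + t *\<^sub>R y)" by (rule P)
      finally show "q (x + z) - (p (z + t *\<^sub>R y) - t * p y) \<le> p (x + s *\<^sub>R y) - s * p y"
        by (simp add: algebra_simps)
    qed
    hence "q (x + z) - q x \<le> q z" by (intro great) (smt (verit))
    thus ?thesis by simp
  qed
  have hom_le: "q (c *\<^sub>R x) \<le> c * q x" if c: "c > 0" for c x
  proof -
    have "q (c *\<^sub>R x) / c \<le> q x"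
    proof (rule great)
      fix t :: real assume t: "t \<ge> 0"
      have "q (c *\<^sub>R x) \<le> p (c *\<^sub>R x + (c * t) *\<^sub>R y) - (c * t) * p y"
        by (rule up) (use c t in auto)
      also have "c *\<^sub>R x + (c * t) *\<^sub>R y = c *\<^sub>R (x + t *\<^sub>R y)" by (simp add: algebra_simps)
      also have "p \<dots> = c * p (x + t *\<^sub>R y)" using P(2) c by simp
      finally show "q (c *\<^sub>R x) / c \<le> p (x + t *\<^sub>R y) - t * p y"
        using c by (simp add: field_simps)
    qed
    thus ?thesis using c by (simp add: field_simps)
  qed
  have q0: "q 0 = 0"
    using great[of 0 0] P(2) qp[of 0] P(4) by (auto intro!: antisym)
  have hom: "q (c *\<^sub>R x) = c * q x" if c: "c \<ge> 0" for c x
  proof (cases "c = 0")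
    case False
    hence c: "c > 0" using c by simp
    have "q ((1/c) *\<^sub>R (c *\<^sub>R x)) \<le> (1/c) * q (c *\<^sub>R x)" using hom_le[of "1/c" "c *\<^sub>R x"] c by simp
    hence "c * q x \<le> q (c *\<^sub>R x)" using c by (simp add: field_simps)
    with hom_le[OF c, of x] show ?thesis by simp
  qed (simp add: q0)
  show "sublinear_le_norm q"
    unfolding sublinear_le_norm_def
    using add hom qp P(3) by (meson order_trans)
qed

text \<open>A minimal sublinear functional is additive, because it coincides with all of its shifts.\<close>

lemma real_norming_functional:
  fixes x0 :: "'e::real_normed_vector"
  shows "\<exists>f. (\<forall>x y. f (x + y) = f x + f y) \<and> (\<forall>c x. f (c *\<^sub>R x) = c * f x) \<and>
     (\<forall>x. f x \<le> norm x) \<and> f x0 = norm x0"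
proof -
  have n: "sublinear_le_norm (norm :: 'e \<Rightarrow> real)"
    by (auto simp: sublinear_le_norm_def norm_triangle_ineq)
  \<comment> \<open>Zorn's lemma is started below \<open>p0\<close> and not below the norm:
    \<open>p0 (- x0) \<le> - norm x0\<close> forces the minimal functional to attain
    \<open>norm x0\<close> at \<open>x0\<close>.\<close>
  define p0 where "p0 = (\<lambda>x. INF t\<in>{0..}. norm (x + t *\<^sub>R x0) - t * norm x0)"
  have p0: "sublinear_le_norm p0" "p0 (- x0) \<le> - norm x0"
    using sublinear_le_norm_shift(1)[OF n, of x0] sublinear_le_norm_shift(3)[OF n, of 1 "-x0" x0]
    by (auto simp: p0_def)
  define A where "A = {p::'e \<Rightarrow> real. sublinear_le_norm p \<and> (\<forall>x. p x \<le> p0 x)}"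
  \<comment> \<open>The order is reversed, so that a maximal element in Zorn's lemma is a minimal
    functional and chains need pointwise infima.\<close>
  define P where "P = (\<lambda>p q :: 'e \<Rightarrow> real. \<forall>x. q x \<le> p x)"
  have po: "partial_order_on A (relation_of P A)"
    unfolding P_def relation_of_def partial_order_on_def preorder_on_def refl_on_def trans_def antisym_def
    by (auto intro: order_trans) (meson antisym ext)
  have "\<exists>u \<in> A. \<forall>a \<in> C. P a u" if C: "C \<in> Chains (relation_of P A)" for C
  proof (cases "C = {}")
    case True
    thus ?thesis using p0 by (auto simp: A_def)
  next
    case False
    have CA: "p \<in> A" if "p \<in> C" for p
      using C that by (auto simp: Chains_def relation_of_def)
    have tot: "(\<forall>x. q x \<le> p x) \<or> (\<forall>x. p x \<le> q x)" if "p \<in> C" "q \<in> C" for p q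
      using C that by (auto simp: Chains_def relation_of_def P_def)
    have S: "sublinear_le_norm p" if "p \<in> C" for p using CA[OF that] by (simp add: A_def)
    define q where "q = (\<lambda>x. INF p\<in>C. p x)"
    have bdd: "bdd_below ((\<lambda>p. p x) ` C)" for x
      by (rule bdd_belowI2[where m="- norm x"]) (use S sublinear_le_normD(6) in blast)
    have lo: "q x \<le> p x" if "p \<in> C" for p x
      unfolding q_def by (rule cINF_lower[OF bdd that])
    have gr: "m \<le> q x" if "\<And>p. p \<in> C \<Longrightarrow> m \<le> p x" for m x
      unfolding q_def by (rule cINF_greatest[OF False that])
    \<comment> \<open>Members of a chain are comparable, so the smaller of two functionals can serve
      for both summands.\<close>
    have add: "q (x + z) \<le> q x + q z" for x z
    proof -
      have "q (x + z) - p z \<le> q x" if p: "p \<in> C" for p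
      proof (rule gr)
        fix r assume r: "r \<in> C"
        show "q (x + z) - p z \<le> r x"
          using tot[OF p r] lo[OF p, of "x+z"] lo[OF r, of "x+z"]
            sublinear_le_normD(1)[OF S[OF p], of x z] sublinear_le_normD(1)[OF S[OF r], of x z]
          by (smt (verit))
      qed
      hence "q (x + z) - q x \<le> q z" by (intro gr) (smt (verit))
      thus ?thesis by simp
    qed
    have hom: "q (c *\<^sub>R x) = c * q x" if c: "c \<ge> 0" for c x
    proof (cases "c = 0")
      case True
      obtain p where p: "p \<in> C" using False by blast
      have "q 0 = 0"
        using lo[OF p, of 0] sublinear_le_normD(4)[OF S] p gr[of 0 0] by (smt (verit))
      thus ?thesis using True by simp
    next
      case False
      hence c: "c > 0" using c by simp
      have "c * q x \<le> q (c *\<^sub>R x)"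
      proof (rule gr)
        fix p assume p: "p \<in> C"
        show "c * q x \<le> p (c *\<^sub>R x)"
          using lo[OF p, of x] sublinear_le_normD(2)[OF S[OF p], of c x] c by simp
      qed
      moreover have "q (c *\<^sub>R x) / c \<le> q x"
      proof (rule gr)
        fix p assume p: "p \<in> C"
        show "q (c *\<^sub>R x) / c \<le> p x"
          using lo[OF p, of "c *\<^sub>R x"] sublinear_le_normD(2)[OF S[OF p], of c x] c by (simp add: field_simps)
      qed
      ultimately show ?thesis using c by (simp add: field_simps)
    qed
    obtain p where p: "p \<in> C" using False by blast
    have "q x \<le> p0 x" "q x \<le> norm x" for x
      using lo[OF p, of x] CA[OF p] sublinear_le_normD(3)[OF S[OF p], of x]
      by (auto simp: A_def intro: order_trans)
    hence "q \<in> A" using add hom by (auto simp: A_def sublinear_le_norm_def)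
    thus ?thesis using lo by (auto simp: P_def)
  qed
  from predicate_Zorn[OF po this] obtain f where
    f: "f \<in> A" and min: "\<And>a. a \<in> A \<Longrightarrow> P f a \<Longrightarrow> a = f" by blast
  have sf: "sublinear_le_norm f" and f0: "\<And>x. f x \<le> p0 x" using f by (auto simp: A_def)
  note F = sublinear_le_normD[OF sf]
  have add: "f (x + y) = f x + f y" for x y
  proof -
    define q where "q = (\<lambda>x. INF t\<in>{0..}. f (x + t *\<^sub>R y) - t * f y)"
    have "sublinear_le_norm q" "\<And>x. q x \<le> f x" "q x \<le> f (x + 1 *\<^sub>R y) - 1 * f y"
      unfolding q_def using sublinear_le_norm_shift(1,2)[OF sf] sublinear_le_norm_shift(3)[OF sf, of 1 x y]
      by auto
    moreover from this have "q = f" using f0 min[of q] by (auto simp: A_def P_def intro: order_trans)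
    ultimately show ?thesis using F(1)[of x y] by simp
  qed
  have neg: "f (- x) = - f x" for x using add[of x "-x"] F(4) by simp
  have hom: "f (c *\<^sub>R x) = c * f x" for c x
  proof (cases "c \<ge> 0")
    case False
    hence "f ((- c) *\<^sub>R x) = (- c) * f x" by (intro F(2)) auto
    thus ?thesis using neg[of "c *\<^sub>R x"] by simp
  qed (use F(2) in auto)
  have "f x0 = norm x0"
    using f0[of "- x0"] p0(2) neg[of x0] F(3)[of x0] by simp
  thus ?thesis using add hom F(3) by blast
qed

definition cfunctional :: "('e::complex_banach \<Rightarrow> complex) \<Rightarrow> bool" where
  "cfunctional \<phi> \<longleftrightarrow> (\<forall>x y. \<phi> (x + y) = \<phi> x + \<phi> y) \<and> (\<forall>a x. \<phi> (a *\<^sub>C x) = a * \<phi> x) \<and>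
     (\<forall>x. cmod (\<phi> x) \<le> norm x)"

lemma norming_functional:
  fixes x0 :: "'e::complex_banach"
  obtains \<phi> where "cfunctional \<phi>" "cmod (\<phi> x0) = norm x0"
proof -
  obtain f where add: "\<And>x y. f (x + y) = f x + f y" and hom: "\<And>c x. f (c *\<^sub>R x) = c * f x"
    and le: "\<And>x::'e. f x \<le> norm x" and x0: "f x0 = norm x0"
    using real_norming_functional[of x0] by blast
  \<comment> \<open>Complex linearity determines the imaginary part from the real part
    \<open>f\<close>.\<close>
  define \<phi> where "\<phi> x = Complex (f x) (- f (\<i> *\<^sub>C x))" for x
  have a: "\<phi> (x + y) = \<phi> x + \<phi> y" for x y
    by (simp add: \<phi>_def add scaleC_add_right complex_eq_iff)
  have s: "\<phi> (a *\<^sub>C x) = a * \<phi> x" for a x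
  proof -
    have 1: "a *\<^sub>C x = Re a *\<^sub>R x + Im a *\<^sub>R (\<i> *\<^sub>C x)"
      by (metis (no_types) complex_eq scaleC_add_left scaleC_of_real scaleC_scaleC mult.commute)
    have ii: "\<i> *\<^sub>C \<i> *\<^sub>C x = - x"
      using scaleC_scaleC[of \<i> \<i> x] scaleC_of_real[of "-1" x] by simp
    have 2: "\<i> *\<^sub>C a *\<^sub>C x = Re a *\<^sub>R (\<i> *\<^sub>C x) + Im a *\<^sub>R (- x)"
      unfolding 1 scaleC_add_right scaleR_scaleC_right ii ..
    have nf: "f (- x) = - f x" for x using hom[of "-1" x] by simp
    show ?thesis
      unfolding \<phi>_def 2 unfolding 1
      by (simp add: add hom nf complex_eq_iff algebra_simps del: scaleR_minus_right)
  qed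
  have n: "cmod (\<phi> x) \<le> norm x" for x
  proof (cases "\<phi> x = 0")
    case False
    \<comment> \<open>Rotating \<open>x\<close> by the unit \<open>c\<close> makes the value of
      \<phi> real, where it coincides with \<open>f\<close>.\<close>
    define c where "c = of_real (cmod (\<phi> x)) / \<phi> x"
    have c: "cmod c = 1" "c * \<phi> x = cmod (\<phi> x)"
      using False by (auto simp: c_def norm_divide)
    have "cmod (\<phi> x) = f (c *\<^sub>C x)"
      using s[of c x] c(2) by (simp add: \<phi>_def complex_eq_iff)
    also have "\<dots> \<le> norm x" using le[of "c *\<^sub>C x"] c by (simp add: norm_scaleC)
    finally show ?thesis .
  qed simp
  have "norm x0 \<le> cmod (\<phi> x0)" using complex_Re_le_cmod[of "\<phi> x0"] x0 by (simp add: \<phi>_def)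
  thus ?thesis using that[of \<phi>] a s n[of x0] n by (auto simp: cfunctional_def)
qed

lemma cfunctional_bounded_linear:
  assumes "cfunctional \<phi>"
  shows "bounded_linear \<phi>"
proof
  show "\<phi> (r *\<^sub>R x) = r *\<^sub>R \<phi> x" for r x
    using assms by (metis cfunctional_def scaleC_of_real scaleR_conv_of_real)
  show "\<exists>K. \<forall>x. norm (\<phi> x) \<le> norm x * K"
    by (rule exI[of _ 1]) (use assms in \<open>simp add: cfunctional_def\<close>)
qed (use assms in \<open>simp_all add: cfunctional_def\<close>)

text \<open>Through this rule scalar theorems (Taylor's formula, Cauchy's inequality, the identity
  theorem) reach functions with values in the Banach space, provided that their bounds are uniform
  over all functionals of norm at most 1.\<close>

lemma norm_le_functionalI:
  fixes x :: "'e::complex_banach"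
  assumes "\<And>\<phi>. cfunctional \<phi> \<Longrightarrow> cmod (\<phi> x) \<le> B"
  shows "norm x \<le> B"
  by (metis assms norming_functional)

lemma holo_on_complex_iff:
  assumes "open S"
  shows "holo_on f S \<longleftrightarrow> f holomorphic_on S"
  unfolding holo_on_def holomorphic_on_def field_differentiable_def has_field_derivative_def
  by (simp add: scaleC_complex_def mult.commute[of _ "_::complex"])

lemma holo_on_functional:
  assumes "holo_on f S" "cfunctional \<phi>" "open S"
  shows "(\<lambda>w. \<phi> (f w)) holomorphic_on S"
proof (subst holo_on_complex_iff[OF \<open>open S\<close>, symmetric], unfold holo_on_def, intro ballI)
  fix w assume "w \<in> S"
  then obtain D where "(f has_derivative (\<lambda>h. h *\<^sub>C D)) (at w within S)"
    using assms(1) by (auto simp: holo_on_def)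
  from bounded_linear.has_derivative[OF cfunctional_bounded_linear[OF assms(2)] this]
  show "\<exists>D. ((\<lambda>w. \<phi> (f w)) has_derivative (\<lambda>h. h *\<^sub>C D)) (at w within S)"
    using assms(2) by (auto simp: cfunctional_def scaleC_complex_def)
qed

lemma holo_on_continuous_on: "holo_on f S \<Longrightarrow> continuous_on S f"
  unfolding holo_on_def continuous_on_eq_continuous_within
  by (blast intro: has_derivative_continuous)

section \<open>Integrals depending on a parameter\<close>

text \<open>Cauchy criterion: over nested intervals the integrals of \<open>f\<close> differ by no
  more than those of \<open>g\<close>. The argument works for values in a Banach space and asks of
  \<open>f\<close> only integrability on compact intervals.\<close>

lemma integrable_on_UNIV_dominated:
  fixes f :: "real \<Rightarrow> 'a::banach"
  assumes f: "\<And>a b. f integrable_on {a..b}" and g: "g integrable_on UNIV"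
    and le: "\<And>x. norm (f x) \<le> g x"
  shows "f integrable_on UNIV"
proof -
  have gi: "g integrable_on {a..b}" for a b using g integrable_on_subinterval by blast
  have cau: "norm (integral {c..d} f - integral {a..b} f) \<le> norm (integral {c..d} g - integral {a..b} g)"
    if "c \<le> a" "a \<le> b" "b \<le> d" for a b c d
  proof -
    have s: "integral {c..d} f = integral {c..a} f + integral {a..b} f + integral {b..d} f"
      using Henstock_Kurzweil_Integration.integral_combine[of c a d f]
        Henstock_Kurzweil_Integration.integral_combine[of a b d f] f that
      by (simp add: add.assoc)
    have sg: "integral {c..d} g = integral {c..a} g + integral {a..b} g + integral {b..d} g"
      using Henstock_Kurzweil_Integration.integral_combine[of c a d g]
        Henstock_Kurzweil_Integration.integral_combine[of a b d g] gi that
      by (simp add: add.assoc)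
    have n: "norm (integral {u..v} f) \<le> integral {u..v} g" for u v
      by (rule integral_norm_bound_integral[OF f gi le])
    have "norm (integral {c..d} f - integral {a..b} f) \<le> norm (integral {c..a} f) + norm (integral {b..d} f)"
      by (simp add: s norm_triangle_ineq)
    also have "\<dots> \<le> integral {c..a} g + integral {b..d} g" using n by (intro add_mono)
    also have "\<dots> = integral {c..d} g - integral {a..b} g" by (simp add: sg)
    finally show ?thesis by simp
  qed
  show ?thesis
    unfolding integrable_alt_subset[of f]
  proof (intro conjI allI impI)
    show "(\<lambda>x. if x \<in> UNIV then f x else 0) integrable_on cbox a b" for a b using f by simp
    fix e :: real assume "e > 0"
    then obtain B where B: "B > 0" "\<And>a b c d. ball 0 B \<subseteq> cbox a b \<Longrightarrow> cbox a b \<subseteq> cbox c d \<Longrightarrow>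
        norm (integral (cbox a b) g - integral (cbox c d) g) < e"
      using g unfolding integrable_alt_subset[of g] by simp meson
    show "\<exists>B>0. \<forall>a b c d. ball 0 B \<subseteq> cbox a b \<and> cbox a b \<subseteq> cbox c d \<longrightarrow>
        norm (integral (cbox a b) (\<lambda>x. if x \<in> UNIV then f x else 0) -
              integral (cbox c d) (\<lambda>x. if x \<in> UNIV then f x else 0)) < e"
    proof (intro exI[of _ B] conjI allI impI)
      fix a b c d :: real
      assume h: "ball 0 B \<subseteq> cbox a b \<and> cbox a b \<subseteq> cbox c d"
      hence "0 \<in> {a..b}" using \<open>B > 0\<close> centre_in_ball[of 0 B] by (metis cbox_interval subsetD)
      hence "a \<le> b" "c \<le> a" "b \<le> d" using h by auto
      thus "norm (integral (cbox a b) (\<lambda>x. if x \<in> UNIV then f x else 0) -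
              integral (cbox c d) (\<lambda>x. if x \<in> UNIV then f x else 0)) < e"
        using cau[of c a b d] B(2)[of a b c d] h by (simp add: norm_minus_commute)
    qed (use \<open>B > 0\<close> in auto)
  qed
qed

lemma integrable_dominated_continuous:
  fixes f :: "real \<Rightarrow> 'a::banach"
  assumes f: "continuous_on S f" and S: "closed S" "is_interval S" and g: "g integrable_on S"
    and le: "\<And>x. x \<in> S \<Longrightarrow> norm (f x) \<le> g x"
  shows "f integrable_on S"
proof -
  have "(\<lambda>x. if x \<in> S then f x else 0) integrable_on UNIV"
  proof (rule integrable_on_UNIV_dominated)
    fix a b :: real
    have "compact (S \<inter> {a..b})" "is_interval (S \<inter> {a..b})"
      using S by (auto simp: closed_Int_compact is_interval_Int is_interval_cc)
    then obtain u v where uv: "S \<inter> {a..b} = {u..v}"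
      using is_interval_compact[of "S \<inter> {a..b}"] by auto
    have "f integrable_on {u..v}"
      by (rule integrable_continuous_interval, rule continuous_on_subset[OF f]) (use uv in auto)
    thus "(\<lambda>x. if x \<in> S then f x else 0) integrable_on {a..b}"
      unfolding integrable_restrict_Int uv .
  next
    show "(\<lambda>x. if x \<in> S then g x else 0) integrable_on UNIV" using g by (simp add: integrable_restrict_UNIV)
  qed (use le in auto)
  thus ?thesis by (simp add: integrable_restrict_UNIV)
qed

text \<open>Taylor's formula for the composition with a functional, with the error controlled by
  Cauchy's inequality on discs of radius \<open>r / 4\<close>: the second derivative is at most
  \<open>2 * B / (r / 4)\<^sup>2 = 32 * B / r\<^sup>2\<close>. This does not depend on the
  functional, so it passes to the norm.\<close>

lemma holo_on_quadratic_remainder: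
  fixes f :: "complex \<Rightarrow> 'e::complex_banach"
  assumes f: "holo_on f (ball z r)" and B: "\<And>w. w \<in> ball z r \<Longrightarrow> norm (f w) \<le> B"
    and D: "(f has_derivative (\<lambda>h. h *\<^sub>C D)) (at z)" and r: "r > 0" and h: "cmod h \<le> r / 4"
  shows "norm (f (z + h) - f z - h *\<^sub>C D) \<le> 32 * B / r\<^sup>2 * (cmod h)\<^sup>2"
proof (rule norm_le_functionalI)
  fix \<phi> :: "'e \<Rightarrow> complex" assume phi: "cfunctional \<phi>"
  define g where "g = (\<lambda>w. \<phi> (f w))"
  have g: "g holomorphic_on ball z r"
    unfolding g_def by (rule holo_on_functional[OF f phi]) simp
  have gB: "cmod (g w) \<le> B" if "w \<in> ball z r" for w
    using B[OF that] phi unfolding g_def cfunctional_def by (meson order_trans)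
  have gD: "(g has_field_derivative \<phi> D) (at z)"
    using bounded_linear.has_derivative[OF cfunctional_bounded_linear[OF phi] D] phi
    by (simp add: g_def cfunctional_def has_field_derivative_def mult.commute[of _ "\<phi> D"])
  have B0: "B \<ge> 0" using gB[of z] r by (smt (verit) centre_in_ball norm_ge_zero)
  have d2: "cmod ((deriv ^^ 2) g w) \<le> 32 * B / r\<^sup>2" if w: "w \<in> cball z (r/4)" for w
  proof -
    have sub: "cball w (r/4) \<subseteq> ball z r"
    proof
      fix x assume "x \<in> cball w (r/4)"
      hence "dist w x \<le> r/4" "dist z w \<le> r/4" using w by auto
      thus "x \<in> ball z r" using dist_triangle[of z x w] r by simp
    qed
    have "norm ((deriv ^^ 2) g w) \<le> fact 2 * B / (r/4) ^ 2"
    proof (rule Cauchy_inequality)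
      show "g holomorphic_on ball w (r/4)"
        by (rule holomorphic_on_subset[OF g]) (use sub ball_subset_cball in blast)
      show "continuous_on (cball w (r/4)) g"
        by (rule holomorphic_on_imp_continuous_on, rule holomorphic_on_subset[OF g sub])
      show "0 < r/4" using r by simp
      fix x assume "norm (w - x) = r/4"
      hence "x \<in> cball w (r/4)" by (simp add: dist_norm)
      thus "norm (g x) \<le> B" using gB sub by blast
    qed
    thus ?thesis by (simp add: fact_2 power2_eq_square field_simps)
  qed
  have "cmod ((deriv ^^ 0) g (z + h) - (\<Sum>i\<le>1. (deriv ^^ i) g z * (z + h - z) ^ i / fact i))
      \<le> 32 * B / r\<^sup>2 * cmod (z + h - z) ^ (Suc 1) / fact 1"
  proof (rule complex_Taylor[where S="cball z (r/4)" and n=1 and f="\<lambda>i. (deriv ^^ i) g"])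
    show "convex (cball z (r/4))" by simp
    show "z \<in> cball z (r/4)" "z + h \<in> cball z (r/4)" using r h by (auto simp: dist_norm)
    fix i w assume "w \<in> cball z (r/4)"
    hence w: "w \<in> ball z r" using r by auto
    have "((deriv ^^ i) g has_field_derivative deriv ((deriv ^^ i) g) w) (at w)"
      by (rule holomorphic_derivI[OF holomorphic_higher_deriv[OF g open_ball] open_ball w])
    thus "((deriv ^^ i) g has_field_derivative (deriv ^^ Suc i) g w) (at w within cball z (r/4))"
      by (auto intro: has_field_derivative_at_within)
  next
    fix w assume "w \<in> cball z (r/4)"
    thus "cmod ((deriv ^^ Suc 1) g w) \<le> 32 * B / r\<^sup>2" using d2 by (simp add: numeral_2_eq_2)
  qed
  hence "cmod (g (z + h) - g z - h * \<phi> D) \<le> 32 * B / r\<^sup>2 * (cmod h)\<^sup>2"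
    using DERIV_imp_deriv[OF gD] by (simp add: power2_eq_square algebra_simps)
  moreover have "\<phi> (f (z + h) - f z - h *\<^sub>C D) = g (z + h) - g z - h * \<phi> D"
    using phi cfunctional_bounded_linear[OF phi]
    by (simp add: g_def linear_diff bounded_linear.linear cfunctional_def)
  ultimately show "cmod (\<phi> (f (z + h) - f z - h *\<^sub>C D)) \<le> 32 * B / r\<^sup>2 * (cmod h)\<^sup>2"
    by simp
qed

lemma has_derivative_at_if_quadratic:
  fixes f :: "'a::real_normed_vector \<Rightarrow> 'b::real_normed_vector"
  assumes f': "bounded_linear f'" and d: "d > 0"
    and le: "\<And>h. norm h \<le> d \<Longrightarrow> norm (f (z + h) - f z - f' h) \<le> C * (norm h)\<^sup>2"
  shows "(f has_derivative f') (at z)"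
  unfolding has_derivative_at
proof (intro conjI f')
  have lim: "(\<lambda>h::'a. C * norm h) \<midarrow>0\<rightarrow> 0"
    by (rule tendsto_mult_right_zero, rule tendsto_norm_zero, rule tendsto_ident_at)
  show "(\<lambda>h. norm (f (z + h) - f z - f' h) / norm h) \<midarrow>0\<rightarrow> 0"
  proof (rule Lim_null_comparison[OF _ lim])
    show "\<forall>\<^sub>F h in at 0. norm (norm (f (z + h) - f z - f' h) / norm h) \<le> C * norm h"
      unfolding eventually_at
    proof (intro exI[of _ d] conjI ballI impI)
      fix h :: 'a assume "h \<noteq> 0 \<and> dist h 0 < d"
      thus "norm (norm (f (z + h) - f z - f' h) / norm h) \<le> C * norm h"
        using le[of h] by (simp add: power2_eq_square divide_le_eq field_simps)
    qed (use d in auto)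
  qed
qed

text \<open>Differentiation under the integral sign: the quadratic remainder is uniform along the
  path, so the derivative is the integral of \<open>k x\<close> times the derivative of
  \<open>U\<close>. That integral exists because the derivative of \<open>U\<close> is continuous
  along the path, being a uniform limit of difference quotients.\<close>

lemma holo_on_integral_translates:
  fixes U :: "complex \<Rightarrow> 'e::complex_banach" and S :: "real set"
  assumes S: "closed S" "is_interval S" and k: "continuous_on S k" and p: "continuous_on S p"
    and g: "g integrable_on S" and kg: "\<And>x. x \<in> S \<Longrightarrow> cmod (k x) \<le> g x"
    and U: "holo_on U W" "open W" and r: "r > 0"
    and sub: "\<And>x. x \<in> S \<Longrightarrow> ball (\<zeta> + p x) r \<subseteq> W"
    and B: "\<And>x w. x \<in> S \<Longrightarrow> w \<in> ball (\<zeta> + p x) r \<Longrightarrow> norm (U w) \<le> B"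
  shows "\<exists>D. ((\<lambda>\<zeta>. integral S (\<lambda>x. k x *\<^sub>C U (\<zeta> + p x))) has_derivative (\<lambda>h. h *\<^sub>C D)) (at \<zeta>)"
proof -
  define D where "D w = (SOME D. (U has_derivative (\<lambda>h. h *\<^sub>C D)) (at w))" for w
  have D: "(U has_derivative (\<lambda>h. h *\<^sub>C D w)) (at w)" if "w \<in> W" for w
  proof -
    have "\<exists>D. (U has_derivative (\<lambda>h. h *\<^sub>C D)) (at w)"
      using bspec[OF U(1)[unfolded holo_on_def] that] unfolding at_within_open[OF that U(2)] .
    thus ?thesis unfolding D_def by (rule someI_ex)
  qed
  have inW: "\<zeta> + p x \<in> W" if "x \<in> S" for x using sub[OF that] r by auto
  have rem: "norm (U (\<zeta> + p x + h) - U (\<zeta> + p x) - h *\<^sub>C D (\<zeta> + p x)) \<le> 32 * B / r\<^sup>2 * (cmod h)\<^sup>2"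
    if x: "x \<in> S" and h: "cmod h \<le> r / 4" for x h
  proof (rule holo_on_quadratic_remainder[OF _ B[OF x] D[OF inW[OF x]] r h])
    show "holo_on U (ball (\<zeta> + p x) r)"
      using U(1) sub[OF x] unfolding holo_on_def by (meson has_derivative_subset subsetD)
  qed
  have cU: "continuous_on S (\<lambda>x. U (\<zeta> + h + p x))" if "cmod h < r" for h
  proof (rule continuous_on_compose2[OF holo_on_continuous_on[OF U(1)]])
    show "continuous_on S (\<lambda>x. \<zeta> + h + p x)" by (intro continuous_intros p)
    show "(\<lambda>x. \<zeta> + h + p x) ` S \<subseteq> W"
    proof
      fix w assume "w \<in> (\<lambda>x. \<zeta> + h + p x) ` S"
      then obtain x where x: "x \<in> S" "w = \<zeta> + h + p x" by blast
      have "w \<in> ball (\<zeta> + p x) r" using that by (simp add: x(2) dist_norm)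
      thus "w \<in> W" using sub[OF x(1)] by blast
    qed
  qed
  define hn where "hn n = complex_of_real (r / 4 / real (Suc n))" for n
  have hn3: "cmod (hn n) = r / 4 / real (Suc n)" for n
    unfolding hn_def norm_of_real using r by simp
  have hn: "cmod (hn n) \<le> r / 4" "hn n \<noteq> 0" "cmod (hn n) = r / 4 / real (Suc n)" for n
  proof -
    have "r / 4 / real (Suc n) \<le> r / 4 / 1" using r by (intro divide_left_mono) auto
    thus "cmod (hn n) \<le> r / 4" by (simp add: hn3)
    show "hn n \<noteq> 0" using hn3[of n] r by (metis divide_pos_pos less_irrefl norm_zero of_nat_0_less_iff zero_less_Suc zero_less_numeral)
  qed (rule hn3)
  define q where "q n x = inverse (hn n) *\<^sub>C (U (\<zeta> + p x + hn n) - U (\<zeta> + p x))" for n x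
  have qD: "norm (q n x - D (\<zeta> + p x)) \<le> 32 * B / r\<^sup>2 * cmod (hn n)" if x: "x \<in> S" for n x
  proof -
    have "q n x - D (\<zeta> + p x) = inverse (hn n) *\<^sub>C (U (\<zeta> + p x + hn n) - U (\<zeta> + p x) - hn n *\<^sub>C D (\<zeta> + p x))"
      using hn(2)[of n] by (simp add: q_def scaleC.diff_right scaleC_scaleC)
    hence "norm (q n x - D (\<zeta> + p x)) \<le> inverse (cmod (hn n)) * (32 * B / r\<^sup>2 * (cmod (hn n))\<^sup>2)"
      using mult_left_mono[OF rem[OF x hn(1)[of n]], of "inverse (cmod (hn n))"]
      by (simp add: norm_scaleC norm_inverse)
    thus ?thesis using hn(2)[of n] by (simp add: power2_eq_square field_simps)
  qed
  have contD: "continuous_on S (\<lambda>x. D (\<zeta> + p x))"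
  proof (rule uniform_limit_theorem)
    have "continuous_on S (q n)" for n
    proof -
      have "cmod (hn n) < r" using hn(1)[of n] r by linarith
      hence 1: "continuous_on S (\<lambda>x. U (\<zeta> + p x + hn n))" using cU[of "hn n"] by (simp add: add_ac)
      have 2: "continuous_on S (\<lambda>x. U (\<zeta> + p x))" using cU[of 0] r by simp
      show ?thesis unfolding q_def
        by (intro scaleC.continuous_on continuous_on_const continuous_on_diff 1 2)
    qed
    thus "\<forall>\<^sub>F n in sequentially. continuous_on S (q n)" by simp
    show "uniform_limit S q (\<lambda>x. D (\<zeta> + p x)) sequentially"
      unfolding uniform_limit_iff
    proof (intro allI impI)
      fix e :: real assume e: "e > 0"
      have "(\<lambda>n. 32 * B / r\<^sup>2 * (r / 4 / real (Suc n))) \<longlonglongrightarrow> 0"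
        by (intro tendsto_mult_right_zero LIMSEQ_Suc[OF lim_const_over_n])
      hence "\<forall>\<^sub>F n in sequentially. 32 * B / r\<^sup>2 * (r / 4 / real (Suc n)) < e"
        using e by (rule order_tendstoD)
      thus "\<forall>\<^sub>F n in sequentially. \<forall>x\<in>S. dist (q n x) (D (\<zeta> + p x)) < e"
      proof eventually_elim
        case (elim n)
        show ?case
        proof
          fix x assume x: "x \<in> S"
          show "dist (q n x) (D (\<zeta> + p x)) < e"
            unfolding dist_norm by (rule le_less_trans[OF qD[OF x, of n, unfolded hn(3)] elim])
        qed
      qed
    qed
  qed simp
  \<comment> \<open>The difference quotient with step \<open>r / 4\<close> is at most
    \<open>8 * B / r\<close>, and so is its distance from the derivative.\<close>
  have Dle: "norm (D (\<zeta> + p x)) \<le> 16 * B / r" if x: "x \<in> S" for x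
  proof -
    have h0: "cmod (hn 0) = r / 4" using hn(3)[of 0] by simp
    have in_b: "\<zeta> + p x + hn 0 \<in> ball (\<zeta> + p x) r" "\<zeta> + p x \<in> ball (\<zeta> + p x) r"
      using h0 r by (auto simp: dist_norm)
    have "norm (q 0 x) \<le> inverse (r/4) * (B + B)"
      unfolding q_def norm_scaleC norm_inverse h0
      using r B[OF x in_b(1)] B[OF x in_b(2)] norm_triangle_ineq4[of "U (\<zeta> + p x + hn 0)" "U (\<zeta> + p x)"]
      by (intro mult_left_mono) auto
    moreover have "norm (D (\<zeta> + p x)) \<le> norm (q 0 x) + norm (q 0 x - D (\<zeta> + p x))"
      by (metis norm_triangle_sub norm_minus_commute)
    ultimately have "norm (D (\<zeta> + p x)) \<le> inverse (r/4) * (B + B) + 32 * B / r\<^sup>2 * (r / 4)"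
      using qD[OF x, of 0] h0 by simp
    thus ?thesis using r by (simp add: field_simps power2_eq_square)
  qed
  have ik: "(\<lambda>x. k x *\<^sub>C f x) integrable_on S"
    if "continuous_on S f" "\<And>x. x \<in> S \<Longrightarrow> norm (f x) \<le> K" for f :: "real \<Rightarrow> 'e" and K
  proof (rule integrable_dominated_continuous[OF _ S, where g = "\<lambda>x. g x * K"])
    show "continuous_on S (\<lambda>x. k x *\<^sub>C f x)" by (intro scaleC.continuous_on k that)
    show "(\<lambda>x. g x * K) integrable_on S" using g by (rule integrable_on_mult_left)
    fix x assume x: "x \<in> S"
    show "norm (k x *\<^sub>C f x) \<le> g x * K"
      unfolding norm_scaleC
      using kg[OF x] that(2)[OF x] order_trans[OF norm_ge_zero kg[OF x]] by (intro mult_mono) auto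
  qed
  have iU: "(\<lambda>x. k x *\<^sub>C U (\<zeta> + h + p x)) integrable_on S" if h: "cmod h < r" for h
    by (rule ik[OF cU[OF h], of B]) (rule B, assumption, simp add: dist_norm h)
  have iD: "(\<lambda>x. k x *\<^sub>C D (\<zeta> + p x)) integrable_on S"
    by (rule ik[OF contD Dle])
  define I where "I = integral S (\<lambda>x. k x *\<^sub>C D (\<zeta> + p x))"
  show ?thesis
  proof (intro exI[of _ I] has_derivative_at_if_quadratic[where d="r/4"])
    show "bounded_linear (\<lambda>h. h *\<^sub>C I)" by (rule scaleC.bounded_linear_left)
    show "r / 4 > 0" using r by simp
    fix h :: complex assume h: "cmod h \<le> r / 4"
    have hr: "cmod h < r" using h r by linarith
    have hI: "h *\<^sub>C I = integral S (\<lambda>x. h *\<^sub>C (k x *\<^sub>C D (\<zeta> + p x)))"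
      unfolding I_def by (rule integral_linear[OF iD scaleC.bounded_linear_right, unfolded o_def, symmetric])
    have ihD: "(\<lambda>x. h *\<^sub>C (k x *\<^sub>C D (\<zeta> + p x))) integrable_on S"
      using integrable_linear[OF iD scaleC.bounded_linear_right] by (simp add: o_def)
    have i0: "(\<lambda>x. k x *\<^sub>C U (\<zeta> + p x)) integrable_on S" using iU[of 0] r by simp
    have "integral S (\<lambda>x. k x *\<^sub>C U (\<zeta> + h + p x)) - integral S (\<lambda>x. k x *\<^sub>C U (\<zeta> + p x)) - h *\<^sub>C I
      = integral S (\<lambda>x. k x *\<^sub>C U (\<zeta> + h + p x) - k x *\<^sub>C U (\<zeta> + p x) - h *\<^sub>C (k x *\<^sub>C D (\<zeta> + p x)))"
      unfolding hI
      by (simp only: Henstock_Kurzweil_Integration.integral_diff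
          Henstock_Kurzweil_Integration.integrable_diff iU[OF hr] i0 ihD)
    also have "norm \<dots> \<le> integral S (\<lambda>x. g x * (32 * B / r\<^sup>2 * (cmod h)\<^sup>2))"
    proof (rule integral_norm_bound_integral)
      show "(\<lambda>x. k x *\<^sub>C U (\<zeta> + h + p x) - k x *\<^sub>C U (\<zeta> + p x) - h *\<^sub>C k x *\<^sub>C D (\<zeta> + p x)) integrable_on S"
        by (intro Henstock_Kurzweil_Integration.integrable_diff iU[OF hr] i0 ihD)
      show "(\<lambda>x. g x * (32 * B / r\<^sup>2 * (cmod h)\<^sup>2)) integrable_on S"
        using g by (rule integrable_on_mult_left)
      fix x assume x: "x \<in> S"
      have "k x *\<^sub>C U (\<zeta> + h + p x) - k x *\<^sub>C U (\<zeta> + p x) - h *\<^sub>C k x *\<^sub>C D (\<zeta> + p x)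
        = k x *\<^sub>C (U (\<zeta> + p x + h) - U (\<zeta> + p x) - h *\<^sub>C D (\<zeta> + p x))"
        by (simp add: scaleC.diff_right scaleC_scaleC mult.commute add_ac)
      also have "norm \<dots> \<le> g x * (32 * B / r\<^sup>2 * (cmod h)\<^sup>2)"
        unfolding norm_scaleC using rem[OF x h] kg[OF x] order_trans[OF norm_ge_zero kg[OF x]]
        by (intro mult_mono) auto
      finally show "norm (k x *\<^sub>C U (\<zeta> + h + p x) - k x *\<^sub>C U (\<zeta> + p x) - h *\<^sub>C k x *\<^sub>C D (\<zeta> + p x))
        \<le> g x * (32 * B / r\<^sup>2 * (cmod h)\<^sup>2)" .
    qed
    also have "\<dots> = (integral S g * (32 * B / r\<^sup>2)) * (cmod h)\<^sup>2" by simp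
    finally show "norm (integral S (\<lambda>x. k x *\<^sub>C U (\<zeta> + h + p x)) - integral S (\<lambda>x. k x *\<^sub>C U (\<zeta> + p x)) - h *\<^sub>C I)
      \<le> (integral S g * (32 * B / r\<^sup>2)) * (cmod h)\<^sup>2" .
  qed
qed

section \<open>Cauchy's theorem in strips\<close>

lemma integral_truncation_tendsto:
  fixes f :: "real \<Rightarrow> 'a::banach"
  assumes f: "f integrable_on S"
  shows "(\<lambda>n. integral (S \<inter> {- real n..real n}) f) \<longlonglongrightarrow> integral S f"
proof (rule metric_LIMSEQ_I)
  fix e :: real assume "e > 0"
  with integrable_integral[OF f] obtain B where B: "B > 0" "\<And>a b. ball 0 B \<subseteq> cbox a b \<Longrightarrow>
      norm (integral (cbox a b) (\<lambda>x. if x \<in> S then f x else 0) - integral S f) < e"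
    unfolding has_integral_alt'[of f] by blast
  obtain N where N: "B \<le> real N" using real_arch_simple by blast
  have "dist (integral (S \<inter> {- real n..real n}) f) (integral S f) < e" if "n \<ge> N" for n
  proof -
    have "ball 0 B \<subseteq> cbox (- real n) (real n)" using N that by (auto simp: dist_real_def)
    from B(2)[OF this] show ?thesis
      by (simp add: dist_norm integral_restrict_Int Int_commute)
  qed
  thus "\<exists>N. \<forall>n\<ge>N. dist (integral (S \<inter> {- real n..real n}) f) (integral S f) < e" by blast
qed

text \<open>On a convex domain \<open>f\<close> has a primitive, and each side contributes the
  difference of its values at two corners.\<close>

lemma Cauchy_rectangle:
  assumes W: "open W" "convex W" and f: "f holomorphic_on W" and lr: "l \<le> r" "b \<le> c"
    and sub: "\<And>x y. l \<le> x \<Longrightarrow> x \<le> r \<Longrightarrow> b \<le> y \<Longrightarrow> y \<le> c \<Longrightarrow> Complex x y \<in> W"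
  shows "integral {l..r} (\<lambda>x. f (Complex x b)) - integral {l..r} (\<lambda>x. f (Complex x c))
     = \<i> * integral {b..c} (\<lambda>y. f (Complex l y)) - \<i> * integral {b..c} (\<lambda>y. f (Complex r y))"
proof -
  obtain H where H: "\<And>w. w \<in> W \<Longrightarrow> (H has_field_derivative f w) (at w within W)"
    using holomorphic_convex_primitive'[OF W(2) W(1) f] by blast
  have h: "((\<lambda>x. f (Complex x y)) has_integral (H (Complex r y) - H (Complex l y))) {l..r}"
    if y: "b \<le> y" "y \<le> c" for y
  proof (rule fundamental_theorem_of_calculus[OF lr(1)])
    fix x assume x: "x \<in> {l..r}"
    have i: "(\<lambda>x. Complex x y) ` {l..r} \<subseteq> W" using sub y by auto
    have d: "((\<lambda>x. Complex x y) has_vector_derivative 1) (at x within {l..r})"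
      unfolding Complex_eq by (auto intro!: derivative_eq_intros)
    have "((\<lambda>x. H (Complex x y)) has_vector_derivative (1 * f (Complex x y))) (at x within {l..r})"
      using field_vector_diff_chain_within[OF d DERIV_subset[OF H i]] sub y x by (simp add: o_def)
    thus "((\<lambda>x. H (Complex x y)) has_vector_derivative f (Complex x y)) (at x within {l..r})" by simp
  qed
  have v: "((\<lambda>y. \<i> * f (Complex x y)) has_integral (H (Complex x c) - H (Complex x b))) {b..c}"
    if x: "l \<le> x" "x \<le> r" for x
  proof (rule fundamental_theorem_of_calculus[OF lr(2)])
    fix y assume y: "y \<in> {b..c}"
    have i: "(\<lambda>y. Complex x y) ` {b..c} \<subseteq> W" using sub x by auto
    have d: "((\<lambda>y. Complex x y) has_vector_derivative \<i>) (at y within {b..c})"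
      unfolding Complex_eq by (auto intro!: derivative_eq_intros)
    show "((\<lambda>y. H (Complex x y)) has_vector_derivative (\<i> * f (Complex x y))) (at y within {b..c})"
      using field_vector_diff_chain_within[OF d DERIV_subset[OF H i]] sub y x by (simp add: o_def)
  qed
  have v': "\<i> * integral {b..c} (\<lambda>y. f (Complex x y)) = H (Complex x c) - H (Complex x b)"
    if x: "l \<le> x" "x \<le> r" for x
    using integral_unique[OF v[OF x]] by simp
  show ?thesis
    using integral_unique[OF h[of b]] integral_unique[OF h[of c]] v'[of l] v'[of r] lr by simp
qed

lemma vertical_integral_bound:
  assumes W: "open W" and f: "f holomorphic_on W" and bc: "b \<le> c"
    and sub: "\<And>y. b \<le> y \<Longrightarrow> y \<le> c \<Longrightarrow> Complex x y \<in> W"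
    and le: "\<And>y. b \<le> y \<Longrightarrow> y \<le> c \<Longrightarrow> cmod (f (Complex x y)) \<le> B"
  shows "cmod (integral {b..c} (\<lambda>y. f (Complex x y))) \<le> B * (c - b)"
proof (rule integral_bound[OF bc])
  show "continuous_on {b..c} (\<lambda>y. f (Complex x y))"
  proof (rule continuous_on_compose2[OF holomorphic_on_imp_continuous_on[OF f]])
    show "continuous_on {b..c} (Complex x)" unfolding Complex_eq by (intro continuous_intros)
  qed (use sub in auto)
qed (use le in auto)

lemma exp_neg_nat_tendsto_0:
  assumes "\<beta> > 0"
  shows "(\<lambda>n. C * exp (- (\<beta> * real n))) \<longlonglongrightarrow> (0::real)"
proof -
  have "(\<lambda>n. exp (- \<beta>) ^ n) \<longlonglongrightarrow> 0" by (rule LIMSEQ_power_zero) (use assms in auto)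
  hence "(\<lambda>n. C * exp (- \<beta>) ^ n) \<longlonglongrightarrow> 0" by (rule tendsto_mult_right_zero)
  moreover have "exp (- \<beta>) ^ n = exp (- (\<beta> * real n))" for n
    by (simp add: exp_of_nat_mult[symmetric] mult.commute)
  ultimately show ?thesis by simp
qed

text \<open>The half strip is cut off at real part \<open>- n\<close>, and the exponential bound
  makes the left side vanish as \<open>n\<close> grows. In this way a vertical piece of a contour is
  traded for two horizontal rays.\<close>

lemma Cauchy_half_strip:
  assumes W: "open W" "convex W" and f: "f holomorphic_on W" and bc: "b \<le> c" and \<beta>: "\<beta> > 0"
    and sub: "\<And>x y. x \<le> a \<Longrightarrow> b \<le> y \<Longrightarrow> y \<le> c \<Longrightarrow> Complex x y \<in> W"
    and le: "\<And>x y. x \<le> a \<Longrightarrow> b \<le> y \<Longrightarrow> y \<le> c \<Longrightarrow> cmod (f (Complex x y)) \<le> C * exp (\<beta> * x)"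
    and int: "(\<lambda>x. f (Complex x b)) integrable_on {..a}" "(\<lambda>x. f (Complex x c)) integrable_on {..a}"
  shows "integral {..a} (\<lambda>x. f (Complex x c)) - integral {..a} (\<lambda>x. f (Complex x b))
     = \<i> * integral {b..c} (\<lambda>y. f (Complex a y))"
proof -
  have t: "(\<lambda>n. integral ({..a} \<inter> {- real n..real n}) (\<lambda>x. f (Complex x c))
        - integral ({..a} \<inter> {- real n..real n}) (\<lambda>x. f (Complex x b)))
      \<longlonglongrightarrow> integral {..a} (\<lambda>x. f (Complex x c)) - integral {..a} (\<lambda>x. f (Complex x b))"
    by (intro tendsto_diff integral_truncation_tendsto int)
  have "(\<lambda>n. integral {b..c} (\<lambda>y. f (Complex (- real n) y))) \<longlonglongrightarrow> 0"
  proof (rule Lim_null_comparison)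
    show "(\<lambda>n. (C * (c - b)) * exp (- (\<beta> * real n))) \<longlonglongrightarrow> 0" by (rule exp_neg_nat_tendsto_0[OF \<beta>])
    obtain N where N: "- a \<le> real N" using real_arch_simple by blast
    show "\<forall>\<^sub>F n in sequentially. norm (integral {b..c} (\<lambda>y. f (Complex (- real n) y))) \<le> (C * (c - b)) * exp (- (\<beta> * real n))"
      using eventually_ge_at_top[of N]
    proof eventually_elim
      case (elim n)
      hence "- real n \<le> a" using N by simp
      thus ?case using vertical_integral_bound[OF W(1) f bc sub le, of "- real n"] by (simp add: mult_ac)
    qed
  qed
  hence t2: "(\<lambda>n. \<i> * integral {b..c} (\<lambda>y. f (Complex a y)) - \<i> * integral {b..c} (\<lambda>y. f (Complex (- real n) y)))
      \<longlonglongrightarrow> \<i> * integral {b..c} (\<lambda>y. f (Complex a y)) - \<i> * 0"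
    by (intro tendsto_intros)
  obtain N where N: "\<bar>a\<bar> \<le> real N" using real_arch_simple by blast
  have "\<forall>\<^sub>F n in sequentially. integral ({..a} \<inter> {- real n..real n}) (\<lambda>x. f (Complex x c))
        - integral ({..a} \<inter> {- real n..real n}) (\<lambda>x. f (Complex x b))
      = \<i> * integral {b..c} (\<lambda>y. f (Complex a y)) - \<i> * integral {b..c} (\<lambda>y. f (Complex (- real n) y))"
    using eventually_ge_at_top[of N]
  proof eventually_elim
    case (elim n)
    hence n: "- real n \<le> a" "{..a} \<inter> {- real n..real n} = {- real n..a}" using N by auto
    show ?case unfolding n(2)
      using Cauchy_rectangle[OF W f n(1) bc sub] by (simp add: algebra_simps)
  qed
  from Lim_transform_eventually[OF t this] t2 show ?thesis
    using LIMSEQ_unique by fastforce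
qed

text \<open>Truncation at both ends: decay in both directions allows the line of integration to be
  moved up and down in the strip.\<close>

lemma Cauchy_strip_shift:
  assumes W: "open W" "convex W" and f: "f holomorphic_on W" and bc: "b \<le> c" and \<beta>: "\<beta> > 0"
    and sub: "\<And>x y. b \<le> y \<Longrightarrow> y \<le> c \<Longrightarrow> Complex x y \<in> W"
    and le: "\<And>x y. b \<le> y \<Longrightarrow> y \<le> c \<Longrightarrow> cmod (f (Complex x y)) \<le> C * exp (- (\<beta> * \<bar>x\<bar>))"
    and int: "(\<lambda>x. f (Complex x b)) integrable_on UNIV" "(\<lambda>x. f (Complex x c)) integrable_on UNIV"
  shows "integral UNIV (\<lambda>x. f (Complex x b)) = integral UNIV (\<lambda>x. f (Complex x c))"
proof -
  have t: "(\<lambda>n. integral (UNIV \<inter> {- real n..real n}) (\<lambda>x. f (Complex x b))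
        - integral (UNIV \<inter> {- real n..real n}) (\<lambda>x. f (Complex x c)))
      \<longlonglongrightarrow> integral UNIV (\<lambda>x. f (Complex x b)) - integral UNIV (\<lambda>x. f (Complex x c))"
    by (intro tendsto_diff integral_truncation_tendsto int)
  have v: "(\<lambda>n. integral {b..c} (\<lambda>y. f (Complex (s * real n) y))) \<longlonglongrightarrow> 0" if s: "\<bar>s\<bar> = 1" for s
  proof (rule Lim_null_comparison)
    show "(\<lambda>n. (C * (c - b)) * exp (- (\<beta> * real n))) \<longlonglongrightarrow> 0" by (rule exp_neg_nat_tendsto_0[OF \<beta>])
    show "\<forall>\<^sub>F n in sequentially. norm (integral {b..c} (\<lambda>y. f (Complex (s * real n) y))) \<le> (C * (c - b)) * exp (- (\<beta> * real n))"
    proof (intro always_eventually allI)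
      fix n
      show "norm (integral {b..c} (\<lambda>y. f (Complex (s * real n) y))) \<le> (C * (c - b)) * exp (- (\<beta> * real n))"
        using vertical_integral_bound[OF W(1) f bc sub le, of "s * real n"] s by (simp add: mult_ac abs_mult)
    qed
  qed
  have t2: "(\<lambda>n. \<i> * integral {b..c} (\<lambda>y. f (Complex (-1 * real n) y)) - \<i> * integral {b..c} (\<lambda>y. f (Complex (1 * real n) y)))
      \<longlonglongrightarrow> \<i> * 0 - \<i> * 0"
    by (intro tendsto_intros v) auto
  have "integral (UNIV \<inter> {- real n..real n}) (\<lambda>x. f (Complex x b))
        - integral (UNIV \<inter> {- real n..real n}) (\<lambda>x. f (Complex x c))
      = \<i> * integral {b..c} (\<lambda>y. f (Complex (-1 * real n) y)) - \<i> * integral {b..c} (\<lambda>y. f (Complex (1 * real n) y))" for n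
    using Cauchy_rectangle[OF W f _ bc sub, of "- real n" "real n"] by simp
  with t t2 have "integral UNIV (\<lambda>x. f (Complex x b)) - integral UNIV (\<lambda>x. f (Complex x c)) = \<i> * 0 - \<i> * 0"
    by (metis (lifting) ext LIMSEQ_unique)
  thus ?thesis by simp
qed

lemma integrable_exp_atMost:
  assumes "a > 0"
  shows "(\<lambda>x::real. exp (a * x)) integrable_on {..c}"
proof -
  have "(\<lambda>x. exp (- a * x)) absolutely_integrable_on {-c..}"
    by (rule nonnegative_absolutely_integrable_1[OF integrable_on_exp_minus_to_infinity[OF assms]]) auto
  hence "(\<lambda>x. exp (- a * (- x))) absolutely_integrable_on {..c}"
    using has_absolute_integral_reflect_real[of "{..c}" "{-c..}" "\<lambda>x. exp (- a * x)"] by auto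
  thus ?thesis by (simp add: absolutely_integrable_on_def)
qed

lemma integrable_exp_abs:
  assumes "a > 0"
  shows "(\<lambda>x::real. exp (- (a * \<bar>x\<bar>))) integrable_on UNIV"
proof -
  have 1: "(\<lambda>x::real. exp (- (a * \<bar>x\<bar>))) integrable_on {..0}"
    by (rule integrable_eq[OF integrable_exp_atMost[OF assms, of 0]]) auto
  have 2: "(\<lambda>x::real. exp (- (a * \<bar>x\<bar>))) integrable_on {0..}"
    by (rule integrable_eq[OF integrable_on_exp_minus_to_infinity[OF assms, of 0]]) auto
  have "{..0} \<inter> {0..} = {0::real}" "{..0} \<union> {0..} = (UNIV::real set)" by auto
  thus ?thesis using integrable_Un[OF _ 1 2] by simp
qed

section \<open>Strongly regular sequences\<close>

lemma strongly_regular_pos: "strongly_regular M \<Longrightarrow> 0 < M p"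
  and strongly_regular_0: "strongly_regular M \<Longrightarrow> M 0 = 1"
  by (simp_all add: strongly_regular_def)

lemma strongly_regular_mg:
  assumes "strongly_regular M"
  obtains A where "A \<ge> 1" "\<And>p q. M (p + q) \<le> A ^ (p + q) * M p * M q"
proof -
  obtain A where A: "A > 0" "\<And>p q. M (p + q) \<le> A ^ (p + q) * M p * M q"
    using assms by (auto simp: strongly_regular_def)
  have "M (p + q) \<le> (max 1 A) ^ (p + q) * M p * M q" for p q
    by (rule order_trans[OF A(2)], intro mult_right_mono power_mono)
      (use A(1) strongly_regular_pos[OF assms] in \<open>auto simp: less_imp_le\<close>)
  thus ?thesis using that[of "max 1 A"] by auto
qed

text \<open>Logarithmic convexity makes \<open>M (Suc p) / M p\<close> nondecreasing, and the
  general quotient is a product of \<open>n\<close> such factors.\<close>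

lemma strongly_regular_quotient_mono:
  assumes M: "strongly_regular M" and "p \<le> q"
  shows "M (p + n) / M p \<le> M (q + n) / M q"
proof -
  note pos = strongly_regular_pos[OF M]
  have "M (Suc p) / M p \<le> M (Suc (Suc p)) / M (Suc p)" for p
  proof -
    have "\<forall>p\<ge>1. (M p)\<^sup>2 \<le> M (p - 1) * M (p + 1)" using M by (simp add: strongly_regular_def)
    from this[rule_format, of "Suc p"] have "M (Suc p) * M (Suc p) \<le> M p * M (Suc (Suc p))"
      by (simp add: power2_eq_square)
    thus ?thesis using pos[of p] pos[of "Suc p"] by (simp add: field_simps)
  qed
  hence 1: "M (Suc p) / M p \<le> M (Suc q) / M q" if "p \<le> q" for p q
    using lift_Suc_mono_le[of "\<lambda>p. M (Suc p) / M p"] that by blast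
  show ?thesis
  proof (induction n)
    case (Suc n)
    have "M (p + n) / M p * (M (Suc (p + n)) / M (p + n)) \<le> M (q + n) / M q * (M (Suc (q + n)) / M (q + n))"
      by (intro mult_mono Suc 1) (use \<open>p \<le> q\<close> pos in \<open>auto simp: less_imp_le\<close>)
    thus ?case using pos[of "p + n"] pos[of "q + n"] by simp
  qed (use pos[of p] pos[of q] in simp)
qed

text \<open>\<open>M (p + n) / M p\<close> is a product of \<open>n\<close> successive quotients,
  which lie between the first of them and the one that follows the last.\<close>

lemma strongly_regular_power_le:
  assumes M: "strongly_regular M"
  shows "(M (Suc p) / M p) ^ n * M p \<le> M (p + n)" "M (p + n) \<le> (M (Suc (p + n)) / M (p + n)) ^ n * M p"
proof -
  note pos = strongly_regular_pos[OF M]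
  show "(M (Suc p) / M p) ^ n * M p \<le> M (p + n)"
  proof (induction n)
    case (Suc n)
    have "(M (Suc p) / M p) * ((M (Suc p) / M p) ^ n * M p) \<le> (M (Suc (p + n)) / M (p + n)) * M (p + n)"
      using strongly_regular_quotient_mono[OF M, of p "p + n" 1] pos
      by (intro mult_mono Suc) (auto simp: less_imp_le)
    thus ?case using pos[of "p + n"] by (simp add: mult_ac)
  qed simp
  show "M (p + n) \<le> (M (Suc (p + n)) / M (p + n)) ^ n * M p"
  proof (induction n)
    case (Suc n)
    have m: "M (Suc (p + n)) / M (p + n) \<le> M (Suc (p + Suc n)) / M (p + Suc n)"
      using strongly_regular_quotient_mono[OF M, of "p + n" "p + Suc n" 1] by simp
    have "(M (Suc (p + n)) / M (p + n)) * M (p + n) \<le>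
        (M (Suc (p + Suc n)) / M (p + Suc n)) * ((M (Suc (p + Suc n)) / M (p + Suc n)) ^ n * M p)"
      by (intro mult_mono order_trans[OF Suc] m mult_right_mono power_mono)
        (use pos in \<open>auto simp: less_imp_le\<close>)
    thus ?case using pos[of "p + n"] by (simp add: mult_ac)
  qed simp
qed

text \<open>\<open>M\<close> may decrease at first if \<open>M 1 < 1\<close>. By logarithmic
  convexity no quotient is below \<open>M 1\<close>, so powers of \<open>1 / M 1\<close> compensate
  for the missing monotonicity.\<close>

lemma strongly_regular_le_geometric:
  assumes M: "strongly_regular M"
  obtains c where "c \<ge> 1" "\<And>p n. p \<le> n \<Longrightarrow> M p \<le> c ^ n * M n"
proof -
  note pos = strongly_regular_pos[OF M]
  define c where "c = max 1 (1 / M 1)"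
  have c: "c \<ge> 1" "c * M 1 \<ge> 1" using pos[of 1] by (auto simp: c_def max_def field_simps)
  have "M p \<le> c ^ n * M n" if "p \<le> n" for p n
  proof -
    define q where "q = n - p"
    have q: "n = p + q" using that by (simp add: q_def)
    have "M 1 ^ q \<le> (M (Suc p) / M p) ^ q"
      using strongly_regular_quotient_mono[OF M, of 0 p 1] strongly_regular_0[OF M] pos
      by (intro power_mono) (auto simp: less_imp_le)
    hence "M 1 ^ q * M p \<le> M n"
      using strongly_regular_power_le(1)[OF M, of p q] pos[of p] unfolding q
      by (meson mult_right_mono order_trans less_imp_le)
    have "M p \<le> (c * M 1) ^ q * M p" using c pos[of p] by (simp add: one_le_power)
    also have "\<dots> = c ^ q * (M 1 ^ q * M p)" by (simp add: power_mult_distrib mult_ac)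
    also have "\<dots> \<le> c ^ n * M n"
      using \<open>M 1 ^ q * M p \<le> M n\<close> c pos[of p] pos[of 1] q
      by (intro mult_mono power_increasing) (auto simp: less_imp_le)
    finally show ?thesis .
  qed
  thus ?thesis using that c(1) by blast
qed

text \<open>
  Moderate growth alone gives \<open>M (p + n) / M p \<le> A ^ (p + n) * M n\<close>.  Applying it to
  \<open>M (p + k * n) / M p \<ge> (M (p + n) / M p) ^ k\<close> and taking \<open>k\<close>-th roots replaces the factor
  \<open>A ^ p\<close> by \<open>A powr (p / k)\<close>, at the price of a larger base for the power of \<open>n\<close>.
\<close>

lemma strongly_regular_quotient_le:
  assumes M: "strongly_regular M" and \<delta>: "\<delta> > 0"
  obtains C where "C \<ge> 1" "\<And>p n. M (p + n) / M p \<le> C ^ n * exp (\<delta> * real p) * M n"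
proof -
  note pos = strongly_regular_pos[OF M]
  obtain A where A: "A \<ge> 1" "\<And>p q. M (p + q) \<le> A ^ (p + q) * M p * M q"
    using strongly_regular_mg[OF M] by blast
  \<comment> \<open>\<open>k\<close> is so large that \<open>A \<le> exp (\<delta> * k)\<close>;
    then the \<open>k\<close>-th root of \<open>A ^ p\<close> is at most
    \<open>exp (\<delta> * p)\<close>.\<close>
  obtain k0 where k0: "ln A / \<delta> \<le> real k0" using real_arch_simple by blast
  define k where "k = Suc k0"
  have "ln A \<le> \<delta> * real k" using k0 \<delta> by (simp add: k_def field_simps)
  hence Ak: "A \<le> exp (\<delta> * real k)" using A(1) by (metis exp_le_cancel_iff exp_ln less_le_trans zero_less_one)
  have kn: "M (j * n) \<le> A ^ (j * j * n) * M n ^ j" for j n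
  proof (induction j)
    case (Suc j)
    have "M (n + j * n) \<le> A ^ (n + j * n) * M n * M (j * n)" by (rule A)
    also have "\<dots> \<le> A ^ (n + j * n) * M n * (A ^ (j * j * n) * M n ^ j)"
      using Suc A(1) pos by (intro mult_left_mono) (auto simp: less_imp_le)
    also have "\<dots> = A ^ (n + j * n + j * j * n) * M n ^ Suc j" by (simp add: power_add mult_ac)
    also have "\<dots> \<le> A ^ (Suc j * Suc j * n) * M n ^ Suc j"
      using A(1) pos[of n] by (intro mult_right_mono power_increasing) (auto simp: algebra_simps)
    finally show ?case by simp
  qed (simp add: strongly_regular_0[OF M])
  have pk: "(M (p + n) / M p) ^ j \<le> M (p + j * n) / M p" for p n j
  proof (induction j)
    case (Suc j)
    have "(M (p + n) / M p) * (M (p + n) / M p) ^ j \<le> (M (p + j * n + n) / M (p + j * n)) * (M (p + j * n) / M p)"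
      by (intro mult_mono Suc strongly_regular_quotient_mono[OF M]) (use pos in \<open>auto simp: less_imp_le\<close>)
    thus ?case using pos[of "p + j * n"] by (simp add: add_ac)
  qed (use pos in \<open>simp add: less_imp_neq[symmetric]\<close>)
  have "M (p + n) / M p \<le> (A ^ (1 + k)) ^ n * exp (\<delta> * real p) * M n" for p n
  proof -
    have "(M (p + n) / M p) ^ k \<le> M (p + k * n) / M p" by (rule pk)
    also have "\<dots> \<le> A ^ (p + k * n) * M (k * n)"
      using A(2)[of p "k * n"] pos[of p] by (simp add: field_simps)
    also have "\<dots> \<le> A ^ (p + k * n) * (A ^ (k * k * n) * M n ^ k)"
      using kn A(1) by (intro mult_left_mono) auto
    also have "\<dots> = A ^ p * ((A ^ (1 + k)) ^ n * M n) ^ k"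
      by (simp add: power_add power_mult power_mult_distrib algebra_simps flip: power_mult)
    also have "\<dots> \<le> (exp (\<delta> * real k)) ^ p * ((A ^ (1 + k)) ^ n * M n) ^ k"
      using Ak A(1) pos[of n] by (intro mult_right_mono power_mono) (auto simp: less_imp_le)
    also have "\<dots> = ((A ^ (1 + k)) ^ n * exp (\<delta> * real p) * M n) ^ k"
      by (simp add: power_mult_distrib exp_of_nat_mult[symmetric] mult_ac)
    finally show ?thesis
      unfolding k_def by (rule power_le_imp_le_base) (use A(1) pos[of n] in \<open>simp add: less_imp_le\<close>)
  qed
  moreover have "A ^ (1 + k) \<ge> 1" using A(1) by (rule one_le_power)
  ultimately show ?thesis using that by blast
qed

text \<open>Dyadic blocks, as in the divergence of the harmonic series: each block from
  \<open>2 ^ j * P\<close> to its double contributes at least 1/2.\<close>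

lemma sum_inverse_dyadic:
  assumes "P \<ge> 1"
  shows "real j / 2 \<le> (\<Sum>R\<in>{P..<2 ^ j * P}. 1 / real R)"
proof (induction j)
  case (Suc j)
  have "1 / 2 = (\<Sum>R\<in>{2 ^ j * P..<2 ^ Suc j * P}. 1 / real (2 ^ Suc j * P))"
    using assms by (simp add: field_simps)
  also have "\<dots> \<le> (\<Sum>R\<in>{2 ^ j * P..<2 ^ Suc j * P}. 1 / real R)"
  proof (intro sum_mono divide_left_mono)
    fix R assume R: "R \<in> {2 ^ j * P..<2 ^ Suc j * P}"
    show "real R \<le> real (2 ^ Suc j * P)" using R by (simp only: of_nat_le_iff) simp
    have "0 < 2 ^ j * P" using assms by simp
    hence "R > 0" using R by (metis atLeastLessThan_iff less_le_trans)
    thus "0 < real (2 ^ Suc j * P) * real R" using assms by simp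
  qed simp
  finally have "real j / 2 + 1 / 2 \<le> (\<Sum>R\<in>{P..<2 ^ j * P}. 1 / real R) + (\<Sum>R\<in>{2 ^ j * P..<2 ^ Suc j * P}. 1 / real R)"
    using Suc by simp
  also have "\<dots> = (\<Sum>R\<in>{P..<2 ^ Suc j * P}. 1 / real R)"
    by (rule sum.atLeastLessThan_concat) auto
  finally show ?case by simp
qed simp

text \<open>Between \<open>P\<close> and \<open>2 ^ j * P\<close> the series of condition (snq)
  contains a piece of the harmonic series divided by at most the last quotient, hence at least
  \<open>j / 2\<close> over that quotient. With \<open>4 * A \<le> j\<close> this respects the bound
  of (snq) only if the quotient has doubled. So quotients grow at least like a power of the
  index.\<close>

lemma strongly_regular_quotient_doubling:
  assumes M: "strongly_regular M"
  obtains c :: nat where "c \<ge> 2" "\<And>i. 2 ^ i * M 1 \<le> M (c ^ i) / M (c ^ i - 1)"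
proof -
  note pos = strongly_regular_pos[OF M]
  obtain A where A: "A > 0" "\<And>p. summable (\<lambda>j. M (p + j) / (real (p + j + 1) * M (p + j + 1)))"
    "\<And>p. (\<Sum>j. M (p + j) / (real (p + j + 1) * M (p + j + 1))) \<le> A * (M p / M (p + 1))"
    using M by (auto simp: strongly_regular_def)
  obtain j where j: "4 * A \<le> real j" using real_arch_simple by blast
  have j1: "j \<ge> 1" using j A(1) by (cases j) auto
  have dbl: "2 * (M P / M (P - 1)) \<le> M (2 ^ j * P) / M (2 ^ j * P - 1)" if P: "P \<ge> 1" for P
  proof -
    define p where "p = P - 1"
    have p: "P = Suc p" using P by (simp add: p_def)
    define \<mu> where "\<mu> = M (2 ^ j * P) / M (2 ^ j * P - 1)"
    have \<mu>: "\<mu> > 0" using pos by (simp add: \<mu>_def)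
    have "real j / 2 * (1 / \<mu>) \<le> (\<Sum>R\<in>{P..<2 ^ j * P}. 1 / real R) * (1 / \<mu>)"
      by (intro mult_right_mono sum_inverse_dyadic P) (use \<mu> in simp)
    also have "\<dots> = (\<Sum>R\<in>{P..<2 ^ j * P}. 1 / real R * (1 / \<mu>))" by (rule sum_distrib_right)
    also have "\<dots> \<le> (\<Sum>R\<in>{P..<2 ^ j * P}. 1 / real R * (M (R - 1) / M R))"
    proof (intro sum_mono mult_left_mono)
      fix R assume R: "R \<in> {P..<2 ^ j * P}"
      hence "R \<ge> 1" using P by auto
      hence "M R / M (R - 1) \<le> \<mu>"
        using strongly_regular_quotient_mono[OF M, of "R - 1" "2 ^ j * P - 1" 1] R P unfolding \<mu>_def by auto
      thus "1 / \<mu> \<le> M (R - 1) / M R" using pos[of R] pos[of "R - 1"] \<mu> by (simp add: field_simps)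
    qed simp
    also have "\<dots> = (\<Sum>i\<in>{0..<2 ^ j * P - P}. M (p + i) / (real (p + i + 1) * M (p + i + 1)))"
      by (subst sum.atLeastLessThan_shift_0) (simp add: p add_ac)
    also have "\<dots> \<le> (\<Sum>i. M (p + i) / (real (p + i + 1) * M (p + i + 1)))"
      by (rule sum_le_suminf[OF A(2)]) (use pos in \<open>auto simp: less_imp_le\<close>)
    also have "\<dots> \<le> A * (M p / M (p + 1))" by (rule A)
    finally have "real j / 2 * (1 / \<mu>) \<le> A * (M p / M (p + 1))" .
    hence "real j * (M P / M p) \<le> 2 * A * \<mu>"
      using \<mu> pos[of p] pos[of P] by (simp add: p field_simps)
    moreover have "4 * A * (M P / M p) \<le> real j * (M P / M p)"
      using j pos[of P] pos[of p] by (intro mult_right_mono) auto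
    ultimately have "(2 * A) * (2 * (M P / M p)) \<le> (2 * A) * \<mu>" by simp
    thus ?thesis using A(1) unfolding \<mu>_def p_def by (subst (asm) mult_le_cancel_left_pos) auto
  qed
  have "2 ^ i * M 1 \<le> M ((2 ^ j) ^ i) / M ((2 ^ j) ^ i - 1)" for i
  proof (induction i)
    case (Suc i)
    have "2 * (2 ^ i * M 1) \<le> 2 * (M ((2 ^ j) ^ i) / M ((2 ^ j) ^ i - 1))" using Suc by simp
    also have "\<dots> \<le> M (2 ^ j * (2 ^ j) ^ i) / M (2 ^ j * (2 ^ j) ^ i - 1)" by (rule dbl) simp
    finally show ?case by simp
  qed (simp add: strongly_regular_0[OF M])
  moreover have "2 ^ j \<ge> (2::nat)" using j1 by (metis power_increasing power_one_right one_le_numeral)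
  ultimately show ?thesis using that by blast
qed

section \<open>The associated function and its order of growth\<close>

lemma assoc_terms_le:
  assumes M: "strongly_regular M" and t: "t > 0" "t \<le> M (Suc K) / M K"
  shows "t ^ p / M p \<le> (max 1 (t / M 1)) ^ K"
proof -
  note pos = strongly_regular_pos[OF M]
  have small: "t ^ p / M p \<le> (max 1 (t / M 1)) ^ K" if "p \<le> K" for p
  proof -
    have "M 1 ^ p \<le> M p" using strongly_regular_power_le(1)[OF M, of 0 p] by (simp add: strongly_regular_0[OF M])
    hence "t ^ p / M p \<le> t ^ p / M 1 ^ p" using t pos by (intro divide_left_mono) auto
    also have "\<dots> = (t / M 1) ^ p" by (simp add: power_divide)
    also have "\<dots> \<le> (max 1 (t / M 1)) ^ p" using t pos[of 1] by (intro power_mono) auto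
    also have "\<dots> \<le> (max 1 (t / M 1)) ^ K" using that by (intro power_increasing) auto
    finally show ?thesis .
  qed
  show ?thesis
  proof (cases "p \<le> K")
    \<comment> \<open>Beyond \<open>K\<close> every quotient is at least \<open>t\<close>, so the
      terms no longer increase and the term \<open>K\<close> dominates.\<close>
    case False
    then obtain n where n: "p = K + n" by (metis nat_le_linear le_Suc_ex)
    have "t ^ n * M K \<le> (M (Suc K) / M K) ^ n * M K"
      using t pos[of K] by (intro mult_right_mono power_mono) auto
    also have "\<dots> \<le> M p" unfolding n by (rule strongly_regular_power_le[OF M])
    finally have "t ^ K * (t ^ n * M K) \<le> t ^ K * M p" using t by (intro mult_left_mono) auto
    hence "t ^ p / M p \<le> t ^ K / M K" using pos[of p] pos[of K] by (simp add: n power_add field_simps)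
    thus ?thesis using small[of K] by simp
  qed (rule small)
qed

text \<open>Since quotients double repeatedly, one of them exceeds \<open>t\<close>; the terms are
  then bounded and the supremum in \<open>assoc_fun\<close> is a genuine one. Nonnegativity comes
  from the term \<open>p = 0\<close>.\<close>

lemma assoc_fun_props:
  assumes M: "strongly_regular M" and t: "t > 0"
  shows "t ^ p / M p \<le> exp (assoc_fun M t)" "0 \<le> assoc_fun M t"
    "(\<And>p. t ^ p / M p \<le> B) \<Longrightarrow> exp (assoc_fun M t) \<le> B"
proof -
  note pos = strongly_regular_pos[OF M]
  obtain c :: nat where c: "c \<ge> 2" "\<And>i. 2 ^ i * M 1 \<le> M (c ^ i) / M (c ^ i - 1)"
    using strongly_regular_quotient_doubling[OF M] by blast
  obtain i where i: "t / M 1 < 2 ^ i" using real_arch_pow[of 2 "t / M 1"] by auto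
  have "t \<le> 2 ^ i * M 1" using i pos[of 1] by (simp add: field_simps less_imp_le)
  also have "\<dots> \<le> M (Suc (c ^ i - 1)) / M (c ^ i - 1)" using c(2)[of i] c(1) by simp
  finally have K: "t \<le> M (Suc (c ^ i - 1)) / M (c ^ i - 1)" .
  have bdd: "bdd_above (range (\<lambda>p. ln (t ^ p / M p)))"
  proof (rule bdd_aboveI2)
    fix p show "ln (t ^ p / M p) \<le> ln ((max 1 (t / M 1)) ^ (c ^ i - 1))"
      using assoc_terms_le[OF M t K, of p] t pos[of p] by (subst ln_le_cancel_iff) auto
  qed
  have "ln (t ^ p / M p) \<le> assoc_fun M t" for p
    using cSUP_upper[OF UNIV_I bdd] t by (simp add: assoc_fun_def)
  note le = this
  show "t ^ p / M p \<le> exp (assoc_fun M t)"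
    using le[of p] t pos[of p] by (metis divide_pos_pos exp_le_cancel_iff exp_ln zero_less_power)
  show "0 \<le> assoc_fun M t" using le[of 0] by (simp add: strongly_regular_0[OF M])
  assume B: "\<And>p. t ^ p / M p \<le> B"
  have B0: "B > 0" using B[of 0] by (simp add: strongly_regular_0[OF M])
  have "assoc_fun M t \<le> ln B"
    unfolding assoc_fun_def using t
    by (auto intro!: cSUP_least iffD2[OF ln_le_cancel_iff] B B0 divide_pos_pos pos simp del: ln_le_cancel_iff)
  thus "exp (assoc_fun M t) \<le> B" using B0 by (metis exp_le_cancel_iff exp_ln)
qed

text \<open>The terms \<open>t ^ q / M q\<close> do not fall while the quotients are at most
  \<open>t\<close> and do not rise afterwards, so for \<open>t\<close> equal to the quotient at
  \<open>p\<close> the largest term is the one at \<open>p\<close>. This \<open>t\<close> gives the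
  optimal radius in the Cauchy estimate for the coefficients of \<open>E\<close>.\<close>

lemma assoc_fun_quotient:
  assumes M: "strongly_regular M"
  shows "exp (assoc_fun M (M (Suc p) / M p)) \<le> (M (Suc p) / M p) ^ p / M p"
proof (rule assoc_fun_props(3)[OF M])
  note pos = strongly_regular_pos[OF M]
  define \<mu> where "\<mu> = M (Suc p) / M p"
  show "0 < M (Suc p) / M p" using pos by simp
  fix q
  show "(M (Suc p) / M p) ^ q / M q \<le> (M (Suc p) / M p) ^ p / M p"
    unfolding \<mu>_def[symmetric]
  proof (cases "p \<le> q")
    case True
    then obtain n where n: "q = p + n" using le_Suc_ex by blast
    have "\<mu> ^ p * (\<mu> ^ n * M p) \<le> \<mu> ^ p * M q"
      unfolding \<mu>_def n using pos by (intro mult_left_mono strongly_regular_power_le[OF M]) (auto simp: less_imp_le)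
    thus "\<mu> ^ q / M q \<le> \<mu> ^ p / M p" using pos[of p] pos[of q] by (simp add: n power_add field_simps)
  next
    case False
    then obtain n where n: "p = q + n" by (metis nat_le_linear le_Suc_ex)
    have "\<mu> ^ q * M p \<le> \<mu> ^ q * (\<mu> ^ n * M q)"
      unfolding \<mu>_def n using pos by (intro mult_left_mono strongly_regular_power_le[OF M]) (auto simp: less_imp_le)
    thus "\<mu> ^ q / M q \<le> \<mu> ^ p / M p" using pos[of p] pos[of q] by (simp add: n power_add field_simps)
  qed
qed

text \<open>For \<open>2 ^ i\<close> comparable to \<open>t / M 1\<close>, doubling places the
  largest term at an index below \<open>c ^ i\<close>, which is bounded by a power of
  \<open>t\<close>; the associated function is then at most \<open>c ^ i * ln (t / M 1)\<close>.
  Finiteness matters because \<open>real_of_ereal\<close> sends infinity to 0, which would make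
  \<open>omega\<close> equal to 0.\<close>

lemma rho_finite:
  assumes M: "strongly_regular M"
  shows "rho M < \<infinity>"
proof -
  note pos = strongly_regular_pos[OF M]
  obtain c :: nat where c: "c \<ge> 2" "\<And>i. 2 ^ i * M 1 \<le> M (c ^ i) / M (c ^ i - 1)"
    using strongly_regular_quotient_doubling[OF M] by blast
  \<comment> \<open>Beyond \<open>T\<close> one has \<open>ln t \<ge> 1\<close>,
    \<open>t / M 1 \<ge> 1\<close> and \<open>t / M 1 \<le> t * t\<close>, which is what the
    estimate needs.\<close>
  define T where "T = max (exp 1) (max (M 1) (1 / M 1))"
  have bound: "ln (assoc_fun M t) / ln t \<le> 2 * ln (real c) / ln 2 + ln (real c) + 2" if tT: "t \<ge> T" for t
  proof -
    have t: "t \<ge> exp 1" "t \<ge> M 1" "t \<ge> 1 / M 1" using tT by (auto simp: T_def)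
    have t0: "t > 0" using t(1) by (meson exp_gt_zero less_le_trans)
    have lt: "ln t \<ge> 1" using t(1) t0 by (metis ln_exp ln_le_cancel_iff exp_gt_zero)
    have q1: "t / M 1 \<ge> 1" using t(2) pos[of 1] by simp
    have "t / M 1 \<le> t * t" using t(3) t0 by (metis mult.commute divide_inverse inverse_eq_divide mult_le_cancel_right_pos)
    hence l2: "ln (t / M 1) \<le> 2 * ln t" using q1 t0 by (metis ln_le_cancel_iff ln_mult mult_2 less_le_trans zero_less_one mult_pos_pos less_numeral_extra(3) linorder_not_less)
    define i where "i = nat \<lceil>log 2 (t / M 1)\<rceil>"
    have i: "log 2 (t / M 1) \<le> real i" "real i \<le> log 2 (t / M 1) + 1"
      using q1 by (auto simp: i_def) 
    have "t / M 1 \<le> 2 ^ i"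
      using i(1) q1 by (subst (asm) log_le_iff) (auto simp: powr_realpow)
    hence "t \<le> 2 ^ i * M 1" using pos[of 1] by (simp add: field_simps)
    also have "\<dots> \<le> M (Suc (c ^ i - 1)) / M (c ^ i - 1)" using c(2)[of i] c(1) by simp
    finally have "exp (assoc_fun M t) \<le> (max 1 (t / M 1)) ^ (c ^ i - 1)"
      using assoc_fun_props(3)[OF M t0] assoc_terms_le[OF M t0] by blast
    also have "\<dots> = (t / M 1) ^ (c ^ i - 1)" using q1 by simp
    also have "\<dots> \<le> (t / M 1) ^ (c ^ i)" using q1 by (intro power_increasing) auto
    also have "\<dots> = exp (real (c ^ i) * ln (t / M 1))"
      unfolding exp_of_nat_mult using q1 by (subst exp_ln) auto
    finally have N: "assoc_fun M t \<le> real (c ^ i) * ln (t / M 1)" by simp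
    have "ln (assoc_fun M t) \<le> (2 * ln (real c) / ln 2 + ln (real c) + 2) * ln t"
    proof (cases "assoc_fun M t = 0")
      case True
      thus ?thesis using lt c(1) by simp
    next
      case False
      hence Np: "assoc_fun M t > 0" using assoc_fun_props(2)[OF M t0] by simp
      have q2: "ln (t / M 1) > 0" using N Np by (metis less_le_trans of_nat_0_le_iff zero_less_mult_iff linorder_not_less)
      have cp: "real (c ^ i) > 0" using c(1) by simp
      have "ln (assoc_fun M t) \<le> ln (real (c ^ i) * ln (t / M 1))" using N Np by simp
      also have "\<dots> = real i * ln (real c) + ln (ln (t / M 1))"
        using q2 cp c(1) by (subst ln_mult) (auto simp: ln_realpow)
      also have "\<dots> \<le> (ln (t / M 1) / ln 2 + 1) * ln (real c) + ln (t / M 1)"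
        using i(2) c(1) ln_bound[OF q2] by (intro add_mono mult_right_mono) (auto simp: log_def)
      also have "\<dots> \<le> (2 * ln t / ln 2 + ln t) * ln (real c) + 2 * ln t"
        using l2 lt c(1) by (intro add_mono mult_right_mono divide_right_mono) auto
      also have "\<dots> \<le> (2 * ln (real c) / ln 2 + ln (real c) + 2) * ln t"
      proof -
        have "0 \<le> ln t * ln (real c) / ln 2" using lt c(1) by simp
        thus ?thesis by (simp add: algebra_simps add_divide_distrib)
      qed
      finally show ?thesis .
    qed
    thus ?thesis using lt by (simp add: divide_le_eq)
  qed
  have "rho M \<le> ereal (max 0 (2 * ln (real c) / ln 2 + ln (real c) + 2))"
    unfolding rho_def
    by (rule Limsup_bounded, rule eventually_mono[OF eventually_ge_at_top[of T]]) (use bound in \<open>auto intro: max.coboundedI2\<close>)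
  thus ?thesis by (rule le_less_trans) (simp only: less_ereal.simps)
qed

text \<open>Moderate growth, iterated along powers of 2, gives
  \<open>ln (M (2 ^ i)) \<le> 2 ^ i * (ln (M 1) + i * b)\<close>. The term at index
  \<open>2 ^ i\<close> then raises the associated function to at least \<open>2 ^ i\<close> at a
  point \<open>t i\<close> whose logarithm is linear in \<open>i\<close>.\<close>

lemma rho_positive:
  assumes M: "strongly_regular M"
  shows "rho M > 0"
proof -
  note pos = strongly_regular_pos[OF M]
  obtain A0 where A0: "A0 \<ge> 1" "\<And>p q. M (p + q) \<le> A0 ^ (p + q) * M p * M q"
    using strongly_regular_mg[OF M] by blast
  define A where "A = max (exp 1) A0"
  have Apos: "A > 0" and Ae: "A \<ge> exp 1" by (auto simp: A_def less_max_iff_disj)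
  have mg: "M (2 * p) \<le> A ^ (2 * p) * (M p)\<^sup>2" for p
  proof -
    have "M (p + p) \<le> A0 ^ (p + p) * M p * M p" by (rule A0)
    also have "\<dots> \<le> A ^ (p + p) * M p * M p"
      using A0(1) pos[of p] by (intro mult_right_mono power_mono) (auto simp: A_def)
    finally show ?thesis by (simp only: mult_2 power2_eq_square mult.assoc)
  qed
  define b where "b = ln A"
  have b1: "b \<ge> 1" unfolding b_def using Ae Apos by (metis ln_exp ln_le_cancel_iff exp_gt_zero)
  have lnM: "ln (M (2 ^ i)) \<le> 2 ^ i * (ln (M 1) + real i * b)" for i
  proof (induction i)
    case (Suc i)
    have "ln (M (2 * 2 ^ i)) \<le> ln (A ^ (2 * 2 ^ i) * (M (2 ^ i))\<^sup>2)"
      using mg[of "2 ^ i"] pos[of "2 * 2 ^ i"] pos[of "2 ^ i"] Apos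
      by (intro ln_mono) auto
    also have "\<dots> = 2 * 2 ^ i * b + 2 * ln (M (2 ^ i))"
      using pos[of "2 ^ i"] Apos by (simp add: ln_mult ln_realpow b_def)
    also have "\<dots> \<le> 2 * 2 ^ i * b + 2 * (2 ^ i * (ln (M 1) + real i * b))" using Suc by simp
    finally show ?case by (simp add: algebra_simps)
  qed simp
  \<comment> \<open>The summand 1 is what leaves the exponent \<open>2 ^ i\<close> after
    \<open>ln (M (2 ^ i))\<close> has been subtracted.\<close>
  define t where "t i = exp (ln (M 1) + real i * b + 1)" for i
  have N: "2 ^ i \<le> assoc_fun M (t i)" for i
  proof -
    have "exp (2 ^ i) \<le> exp (2 ^ i * (ln (M 1) + real i * b + 1) - ln (M (2 ^ i)))"
      using lnM[of i] by (simp add: algebra_simps)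
    also have "\<dots> = t i ^ (2 ^ i) / M (2 ^ i)"
      using pos[of "2 ^ i"] by (simp add: exp_diff t_def flip: exp_of_nat_mult)
    also have "\<dots> \<le> exp (assoc_fun M (t i))" by (rule assoc_fun_props[OF M]) (simp add: t_def)
    finally show ?thesis by simp
  qed
  show ?thesis
  proof (rule ccontr)
    assume "\<not> rho M > 0"
    hence "rho M \<le> 0" by simp
    also have "0 < ereal (ln 2 / (2 * b))" using b1 by simp
    finally have "rho M < ereal (ln 2 / (2 * b))" .
    hence ev: "\<forall>\<^sub>F s in at_top. ereal (max 0 (ln (assoc_fun M s) / ln s)) < ereal (ln 2 / (2 * b))"
      unfolding rho_def by (rule Limsup_lessD)
    have "filterlim t at_top sequentially"
      unfolding t_def
    proof (rule filterlim_compose[OF exp_at_top])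
      have "filterlim (\<lambda>i. (ln (M 1) + 1) + real i * b) at_top sequentially"
        by (rule filterlim_tendsto_add_at_top[OF tendsto_const],
            rule filterlim_at_top_mult_tendsto_pos[OF tendsto_const _ filterlim_real_sequentially]) (use b1 in auto)
      thus "filterlim (\<lambda>i. ln (M 1) + real i * b + 1) at_top sequentially" by (simp add: algebra_simps)
    qed
    with ev have ev2: "\<forall>\<^sub>F i in sequentially. ereal (max 0 (ln (assoc_fun M (t i)) / ln (t i))) < ereal (ln 2 / (2 * b))"
      by (rule eventually_compose_filterlim)
    obtain n0 where n0: "\<bar>ln (M 1) + 1\<bar> + 1 \<le> real n0" using real_arch_simple by blast
    have "\<forall>\<^sub>F i in sequentially. False"
      using ev2 eventually_ge_at_top[of n0]
    proof eventually_elim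
      case (elim i)
      have ib: "\<bar>ln (M 1) + 1\<bar> + 1 \<le> real i * b"
        using n0 elim(2) b1 by (smt (verit) mult_left_le mult_le_cancel_left1 of_nat_0_le_iff of_nat_le_iff)
      have lt: "ln (t i) = ln (M 1) + real i * b + 1" by (simp add: t_def)
      have ltp: "ln (t i) > 0" "ln (t i) \<le> 2 * b * real i" using ib lt by (auto simp: algebra_simps)
      have "real i * ln 2 = ln (2 ^ i)" by (simp add: ln_realpow)
      also have "\<dots> \<le> ln (assoc_fun M (t i))" using N[of i] by (intro ln_mono) auto
      finally have "real i * ln 2 / ln (t i) \<le> ln (assoc_fun M (t i)) / ln (t i)"
        using ltp by (intro divide_right_mono) auto
      moreover have "ln 2 / (2 * b) \<le> real i * ln 2 / ln (t i)"
        using ltp b1 by (simp add: field_simps)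
      ultimately show False using elim(1) by simp
    qed
    thus False by simp
  qed
qed

lemma omega_positive:
  assumes "strongly_regular M"
  shows "omega M > 0"
  using rho_finite[OF assms] rho_positive[OF assms]
  by (cases "rho M") (auto simp: omega_def)

section \<open>The analytic continuation of the kernel series\<close>

locale kernel_setup =
  fixes N :: "nat \<Rightarrow> real" and e E :: "complex \<Rightarrow> complex"
  assumes N: "strongly_regular N" and omega_less: "omega N < 2" and pair: "kernel_pair N e E"
begin

text \<open>In the chart \<open>\<xi> = log z\<close>, \<open>e\<close> is holomorphic for
  \<open>\<bar>Im \<xi>\<bar> < a * pi / 2\<close>, and \<open>E\<close> decays for
  \<open>Im \<xi>\<close> strictly between \<open>a * pi / 2\<close> and
  \<open>2 * pi - a * pi / 2\<close>. The second range is nonempty because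
  \<open>a < 2\<close>.\<close>

definition "a = omega N"

definition "\<mu> p = kernel_moment e (of_nat p)"

lemma a_bounds: "0 < a" "a < 2"
  using omega_positive[OF N] omega_less by (auto simp: a_def)

lemma pair_facts:
  "e holomorphic_on csector 0 (omega N * pi)"
  "\<forall>\<epsilon>>0. \<exists>c>0. \<exists>k>0. \<forall>z\<in>csector 0 (omega N * pi - \<epsilon>).
     cmod (e z) \<le> c * exp (- assoc_fun N (cmod z / k))"
  "E holomorphic_on UNIV"
  "\<exists>c>0. \<exists>k>0. \<forall>z. cmod (E z) \<le> c * exp (assoc_fun N (cmod z / k))"
  "\<exists>\<beta>>0. \<forall>\<theta> R. 0 < \<theta> \<and> \<theta> < 2 * pi - omega N * pi \<and> 0 < R \<longrightarrow>
     (\<exists>c>0. \<forall>z\<in>csector pi \<theta> - ball 0 R. cmod (E z) \<le> c * cmod z powr (- \<beta>))"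
  "\<forall>p::nat. kernel_moment e (of_nat p) \<noteq> 0"
  "\<forall>z. (\<lambda>p. z ^ p / kernel_moment e (of_nat p)) sums E z"
  by (insert pair[unfolded kernel_pair_def], (elim conjE, assumption)+)

lemma E_sums: "(\<lambda>p. z ^ p / \<mu> p) sums E z" and \<mu>_nonzero: "\<mu> p \<noteq> 0"
  unfolding \<mu>_def by (rule pair_facts(7)[rule_format] pair_facts(6)[rule_format])+

lemmas E_holo = pair_facts(3)

text \<open>Cauchy's inequality for the Taylor coefficients \<open>1 / \<mu> p\<close> of
  \<open>E\<close> on the circle of radius \<open>k * N (Suc p) / N p\<close>, where the growth
  bound of \<open>E\<close> is used best. The kernels are estimated through \<open>N\<close> but the
  claim is about moments; this is the bridge between them.\<close>

lemma N_le_moment: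
  obtains C B where "C > 0" "B \<ge> 1" "\<And>p. N p \<le> C * B ^ p * cmod (\<mu> p)"
proof -
  note pos = strongly_regular_pos[OF N]
  obtain c k where ck: "c > 0" "k > 0" "\<And>z. cmod (E z) \<le> c * exp (assoc_fun N (cmod z / k))"
    using pair_facts(4) by blast
  have "E has_fps_expansion Abs_fps (\<lambda>p. 1 / \<mu> p)"
    by (rule has_fps_expansionI) (use E_sums in simp)
  from fps_nth_fps_expansion[OF this]
  have coeff: "(deriv ^^ p) E 0 = fact p / \<mu> p" for p by (simp add: field_simps)
  have "N p \<le> c * (1 / k) ^ p * cmod (\<mu> p)" for p
  proof -
    define q where "q = N (Suc p) / N p"
    have q: "q > 0" using pos by (simp add: q_def)
    have "cmod ((deriv ^^ p) E 0) \<le> fact p * (c * (q ^ p / N p)) / (k * q) ^ p"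
    proof (rule Cauchy_inequality)
      show "E holomorphic_on ball 0 (k * q)" by (rule holomorphic_on_subset[OF E_holo]) simp
      show "continuous_on (cball 0 (k * q)) E"
        by (rule holomorphic_on_imp_continuous_on, rule holomorphic_on_subset[OF E_holo]) simp
      show "0 < k * q" using q ck by simp
      fix z :: complex assume "norm (0 - z) = k * q"
      hence "cmod z / k = q" using ck by simp
      hence "cmod (E z) \<le> c * exp (assoc_fun N q)" using ck(3)[of z] by simp
      also have "\<dots> \<le> c * (q ^ p / N p)"
        unfolding q_def using ck(1) assoc_fun_quotient[OF N, of p] by (intro mult_left_mono) auto
      finally show "cmod (E z) \<le> c * (q ^ p / N p)" .
    qed
    moreover have "fact p * (c * (q ^ p / N p)) / (k * q) ^ p = fact p * (c / (N p * k ^ p))"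
      using q by (simp add: power_mult_distrib)
    ultimately have "fact p * (1 / cmod (\<mu> p)) \<le> fact p * (c / (N p * k ^ p))"
      by (simp add: coeff norm_divide)
    hence "1 / cmod (\<mu> p) \<le> c / (N p * k ^ p)" by (subst (asm) mult_le_cancel_left_pos) auto
    thus ?thesis using \<mu>_nonzero[of p] pos[of p] ck by (simp add: field_simps power_one_over)
  qed
  moreover have "c * (1 / k) ^ p * cmod (\<mu> p) \<le> c * max 1 (1 / k) ^ p * cmod (\<mu> p)" for p
    using ck by (intro mult_left_mono mult_right_mono power_mono) auto
  ultimately show ?thesis using that[of c "max 1 (1 / k)"] ck(1) by (meson max.cobounded1 order_trans)
qed

text \<open>Keeping a single term \<open>q\<close> of the supremum turns the decay
  \<open>exp (- assoc_fun N t)\<close> into \<open>N q / t ^ q\<close>, and \<open>q\<close> can be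
  chosen differently on different parts of the path.\<close>

lemma e_exp_bound:
  assumes "\<epsilon> > 0"
  obtains c b where "c > 0" "b \<ge> 1"
    "\<And>\<xi> q. \<bar>Im \<xi>\<bar> \<le> a * pi / 2 - \<epsilon> \<Longrightarrow> cmod (e (exp \<xi>)) \<le> c * b ^ q * N q * exp (- (real q * Re \<xi>))"
proof -
  note pos = strongly_regular_pos[OF N]
  obtain c k where ck: "c > 0" "k > 0"
    "\<And>z. z \<in> csector 0 (omega N * pi - \<epsilon>) \<Longrightarrow> cmod (e z) \<le> c * exp (- assoc_fun N (cmod z / k))"
    using pair_facts(2) assms by blast
  have "cmod (e (exp \<xi>)) \<le> c * (max 1 k) ^ q * N q * exp (- (real q * Re \<xi>))"
    if "\<bar>Im \<xi>\<bar> \<le> a * pi / 2 - \<epsilon>" for \<xi> q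
  proof -
    define t where "t = exp (Re \<xi>) / k"
    have t: "t > 0" using ck by (simp add: t_def)
    have "exp \<xi> \<in> csector 0 (omega N * pi - \<epsilon>)"
      unfolding csector_def sector_def using that assms by (intro imageI) (simp add: a_def)
    from ck(3)[OF this] have "cmod (e (exp \<xi>)) \<le> c * exp (- assoc_fun N t)" by (simp add: t_def)
    also have "\<dots> \<le> c * (N q / t ^ q)"
    proof (intro mult_left_mono)
      have "t ^ q / N q \<le> exp (assoc_fun N t)" by (rule assoc_fun_props[OF N t])
      thus "exp (- assoc_fun N t) \<le> N q / t ^ q"
        using pos[of q] t by (simp add: exp_minus field_simps)
    qed (use ck in simp)
    also have "\<dots> = c * k ^ q * N q * exp (- (real q * Re \<xi>))"
      using ck(2) by (simp add: t_def power_divide exp_minus flip: exp_of_nat_mult) (simp add: field_simps)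
    also have "\<dots> \<le> c * (max 1 k) ^ q * N q * exp (- (real q * Re \<xi>))"
      using ck pos[of q] by (intro mult_right_mono mult_left_mono power_mono) auto
    finally show ?thesis .
  qed
  thus ?thesis using that ck(1) by (meson max.cobounded1)
qed

text \<open>Decay of order \<open>q = 0\<close> where \<open>Re \<xi> \<le> 0\<close> and of order
  \<open>q = k + 1\<close> elsewhere leaves a factor \<open>exp (- \<bar>Re \<xi>\<bar>)\<close> at
  both ends, on the left thanks to \<open>k \<ge> 1\<close>. Moderate growth brings
  \<open>N (k + 1)\<close> back to \<open>N k\<close>.\<close>

lemma e_weight_bound:
  assumes "\<epsilon> > 0"
  obtains C B where "C > 0" "B \<ge> 1"
    "\<And>\<xi> k. k \<ge> 1 \<Longrightarrow> \<bar>Im \<xi>\<bar> \<le> a * pi / 2 - \<epsilon> \<Longrightarrow>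
       cmod (exp (of_nat k * \<xi>) * e (exp \<xi>)) \<le> C * B ^ k * N k * exp (- \<bar>Re \<xi>\<bar>)"
proof -
  note pos = strongly_regular_pos[OF N]
  obtain c b where cb: "c > 0" "b \<ge> 1"
    "\<And>\<xi> q. \<bar>Im \<xi>\<bar> \<le> a * pi / 2 - \<epsilon> \<Longrightarrow> cmod (e (exp \<xi>)) \<le> c * b ^ q * N q * exp (- (real q * Re \<xi>))"
    using e_exp_bound[OF assms] by blast
  obtain A where A: "A \<ge> 1" "\<And>p q. N (p + q) \<le> A ^ (p + q) * N p * N q"
    using strongly_regular_mg[OF N] by blast
  obtain c0 where c0: "c0 \<ge> 1" "\<And>p n. p \<le> n \<Longrightarrow> N p \<le> c0 ^ n * N n"
    using strongly_regular_le_geometric[OF N] by blast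
  define B where "B = c0 * b * A"
  have "1 * 1 \<le> b * A" using cb(2) A(1) by (intro mult_mono) auto
  hence bA: "1 \<le> b * A" by simp
  have "1 * 1 \<le> c0 * (b * A)" using c0(1) bA by (intro mult_mono) auto
  hence B1: "B \<ge> 1" by (simp add: B_def mult.assoc)
  have "cmod (exp (of_nat k * \<xi>) * e (exp \<xi>)) \<le> (c * (1 + b * A * N 1)) * B ^ k * N k * exp (- \<bar>Re \<xi>\<bar>)"
    if k: "k \<ge> 1" and \<xi>: "\<bar>Im \<xi>\<bar> \<le> a * pi / 2 - \<epsilon>" for \<xi> k
  proof (cases "Re \<xi> \<le> 0")
    case True
    have "cmod (exp (of_nat k * \<xi>) * e (exp \<xi>)) \<le> exp (real k * Re \<xi>) * c"
      using cb(3)[OF \<xi>, of 0] by (simp add: norm_mult strongly_regular_0[OF N])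
    also have "\<dots> \<le> exp (- \<bar>Re \<xi>\<bar>) * c"
      using True k cb(1) mult_right_mono_neg[of 1 "real k" "Re \<xi>"] by (intro mult_right_mono) auto
    also have "\<dots> \<le> exp (- \<bar>Re \<xi>\<bar>) * ((c * (1 + b * A * N 1)) * (B ^ k * N k))"
    proof (intro mult_left_mono)
      have "1 \<le> c0 ^ k * N k" using c0(2)[of 0 k] by (simp add: strongly_regular_0[OF N])
      also have "\<dots> \<le> B ^ k * N k"
      proof (intro mult_right_mono power_mono)
        have "c0 * 1 \<le> c0 * (b * A)" using c0(1) bA by (intro mult_left_mono) auto
        thus "c0 \<le> B" by (simp add: B_def mult.assoc)
      qed (use c0 pos[of k] in auto)
      finally have 1: "1 \<le> B ^ k * N k" .
      have "c * 1 \<le> c * (1 + b * A * N 1)" using cb A pos[of 1] by (intro mult_left_mono) auto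
      from mult_mono[OF this 1] show "c \<le> c * (1 + b * A * N 1) * (B ^ k * N k)"
        using cb A pos[of 1] by simp
    qed simp
    finally show ?thesis by (simp add: mult_ac)
  next
    case False
    have "cmod (exp (of_nat k * \<xi>) * e (exp \<xi>)) \<le> exp (real k * Re \<xi>) * (c * b ^ (k + 1) * N (k + 1) * exp (- (real (k + 1) * Re \<xi>)))"
      using cb(3)[OF \<xi>, of "k + 1"] by (simp add: norm_mult)
    also have "\<dots> = c * b ^ (k + 1) * N (k + 1) * exp (- \<bar>Re \<xi>\<bar>)"
      using False by (simp add: algebra_simps flip: exp_add)
    also have "\<dots> \<le> c * b ^ (k + 1) * (A ^ (k + 1) * N k * N 1) * exp (- \<bar>Re \<xi>\<bar>)"
      using cb by (intro mult_right_mono mult_left_mono A) auto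
    also have "\<dots> = (c * (b * A * N 1)) * ((b * A) ^ k * N k * exp (- \<bar>Re \<xi>\<bar>))"
      by (simp add: power_mult_distrib algebra_simps)
    also have "\<dots> \<le> (c * (1 + b * A * N 1)) * (B ^ k * N k * exp (- \<bar>Re \<xi>\<bar>))"
    proof (intro mult_mono mult_right_mono mult_left_mono power_mono)
      have "1 * (b * A) \<le> c0 * (b * A)" using c0(1) cb(2) A(1) by (intro mult_right_mono) auto
      thus "b * A \<le> B" by (simp add: B_def mult.assoc)
    qed (use cb A B1 pos in \<open>auto simp: less_imp_le\<close>)
    finally show ?thesis by (simp add: mult_ac)
  qed
  moreover note B1
  moreover have "c * (1 + b * A * N 1) > 0" using cb A pos[of 1] by (simp add: add_pos_pos)
  ultimately show ?thesis using that by blast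
qed

text \<open>The exponent is capped at 1/2 so that \<open>exp (- (\<beta> * Re \<xi>))\<close>, which
  grows to the left, is absorbed by half of the weight \<open>exp (- \<bar>Re \<xi>\<bar>)\<close>.
  On the unit disc, where no decay is given, compactness bounds \<open>E\<close>. One exponent
  serves for all margins \<epsilon>.\<close>

lemma E_exp_bound:
  obtains \<beta> where "0 < \<beta>" "\<beta> \<le> 1 / 2"
    "\<And>\<epsilon>. \<epsilon> > 0 \<Longrightarrow> \<exists>c>0. \<forall>\<xi>. a * pi / 2 + \<epsilon> \<le> Im \<xi> \<and> Im \<xi> \<le> 2 * pi - a * pi / 2 - \<epsilon> \<longrightarrow>
       cmod (E (exp \<xi>)) \<le> c \<and> cmod (E (exp \<xi>)) \<le> c * exp (- (\<beta> * Re \<xi>))"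
proof -
  obtain \<beta>0 where b0: "\<beta>0 > 0" "\<And>\<theta> R. 0 < \<theta> \<Longrightarrow> \<theta> < 2 * pi - omega N * pi \<Longrightarrow> 0 < R \<Longrightarrow>
        (\<exists>c>0. \<forall>z\<in>csector pi \<theta> - ball 0 R. cmod (E z) \<le> c * cmod z powr (- \<beta>0))"
    using pair_facts(5) by blast
  define \<beta> where "\<beta> = min \<beta>0 (1/2)"
  have \<beta>: "0 < \<beta>" "\<beta> \<le> 1 / 2" "\<beta> \<le> \<beta>0" using b0 by (auto simp: \<beta>_def)
  have "bounded (E ` cball 0 1)"
    by (intro compact_imp_bounded compact_continuous_image holomorphic_on_imp_continuous_on
        holomorphic_on_subset[OF E_holo]) auto
  then obtain c2 where c2: "c2 > 0" "\<And>z. cmod z \<le> 1 \<Longrightarrow> cmod (E z) \<le> c2"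
    unfolding bounded_pos by auto
  have "\<exists>c>0. \<forall>\<xi>. a * pi / 2 + \<epsilon> \<le> Im \<xi> \<and> Im \<xi> \<le> 2 * pi - a * pi / 2 - \<epsilon> \<longrightarrow>
       cmod (E (exp \<xi>)) \<le> c \<and> cmod (E (exp \<xi>)) \<le> c * exp (- (\<beta> * Re \<xi>))" if \<epsilon>: "\<epsilon> > 0" for \<epsilon>
  proof (cases "2 * pi - a * pi - \<epsilon> > 0")
    \<comment> \<open>No \<xi> satisfies the two bounds on \<open>Im \<xi>\<close> in this
      case.\<close>
    case False
    show ?thesis by (rule exI[of _ 1]) (use False \<epsilon> in auto)
  next
    case True
    then obtain c1 where c1: "c1 > 0"
      "\<And>z. z \<in> csector pi (2 * pi - a * pi - \<epsilon>) - ball 0 1 \<Longrightarrow> cmod (E z) \<le> c1 * cmod z powr (- \<beta>0)"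
      using b0(2)[of "2 * pi - a * pi - \<epsilon>" 1] \<epsilon> by (auto simp: a_def)
    have "cmod (E (exp \<xi>)) \<le> max c1 c2 \<and> cmod (E (exp \<xi>)) \<le> max c1 c2 * exp (- (\<beta> * Re \<xi>))"
      if \<xi>: "a * pi / 2 + \<epsilon> \<le> Im \<xi>" "Im \<xi> \<le> 2 * pi - a * pi / 2 - \<epsilon>" for \<xi>
    proof (cases "Re \<xi> \<le> 0")
      case True
      hence "cmod (exp \<xi>) \<le> 1" by simp
      hence 1: "cmod (E (exp \<xi>)) \<le> max c1 c2" using c2 by (meson max.coboundedI2)
      have "1 \<le> exp (- (\<beta> * Re \<xi>))" using True \<beta> by (simp add: mult_nonneg_nonpos)
      hence "max c1 c2 * 1 \<le> max c1 c2 * exp (- (\<beta> * Re \<xi>))" using c1(1) by (intro mult_left_mono) auto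
      hence "max c1 c2 \<le> max c1 c2 * exp (- (\<beta> * Re \<xi>))" by (simp only: mult_1_right)
      thus ?thesis using 1 order_trans by blast
    next
      case False
      have "(2 * pi - a * pi - \<epsilon>) / 2 = pi - a * pi / 2 - \<epsilon> / 2" by (simp add: field_simps)
      hence "\<bar>Im \<xi> - pi\<bar> < (2 * pi - a * pi - \<epsilon>) / 2"
        unfolding abs_less_iff using \<xi> \<epsilon> by (intro conjI) linarith+
      hence "exp \<xi> \<in> csector pi (2 * pi - a * pi - \<epsilon>)"
        unfolding csector_def sector_def by (intro imageI) simp
      moreover have "exp \<xi> \<notin> ball 0 1" using False by simp
      ultimately have "cmod (E (exp \<xi>)) \<le> c1 * exp (- (\<beta>0 * Re \<xi>))"
        using c1(2)[of "exp \<xi>"] by (simp add: powr_def)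
      also have "\<dots> \<le> max c1 c2 * exp (- (\<beta> * Re \<xi>))"
        using \<beta> False c1 by (intro mult_mono) auto
      finally have 1: "cmod (E (exp \<xi>)) \<le> max c1 c2 * exp (- (\<beta> * Re \<xi>))" .
      also have "\<dots> \<le> max c1 c2 * 1" using \<beta> False c1(1) by (intro mult_left_mono) auto
      finally show ?thesis using 1 by simp
    qed
    thus ?thesis using c1(1) by (intro exI[of _ "max c1 c2"]) auto
  qed
  thus ?thesis using that \<beta> by blast
qed

lemma e_exp_holo: "(\<lambda>\<xi>. e (exp \<xi>)) holomorphic_on {\<xi>. \<bar>Im \<xi>\<bar> < a * pi / 2}"
proof -
  have "(e \<circ> exp) holomorphic_on {\<xi>. \<bar>Im \<xi>\<bar> < a * pi / 2}"
    by (rule holomorphic_on_compose_gen[OF holomorphic_on_exp pair_facts(1)])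
      (auto simp: csector_def sector_def a_def)
  thus ?thesis by (simp add: o_def)
qed

definition integrand :: "nat \<Rightarrow> complex \<Rightarrow> complex \<Rightarrow> complex" where
  "integrand k \<eta> \<xi> = exp (of_nat k * \<xi>) * e (exp \<xi>) * E (exp (\<xi> - \<eta>))"

text \<open>The height \<tau> of the path is a free parameter. At height 0, with
  \<open>Im \<eta> = pi\<close>, expanding \<open>E\<close> gives the kernel series; for other
  \<eta> the path is raised or lowered so that the arguments of \<open>e\<close> and of
  \<open>E\<close> both stay in their sectors of decay.\<close>

definition \<Phi> :: "nat \<Rightarrow> real \<Rightarrow> complex \<Rightarrow> complex" where
  "\<Phi> k \<tau> \<eta> = integral UNIV (\<lambda>x. integrand k \<eta> (Complex x \<tau>))"

text \<open>
  \<open>E\<close> decays along \<open>exp (\<xi> - \<eta>)\<close>, with \<open>Im \<xi> = \<tau>\<close>, as long as \<open>\<tau> - Im \<eta>\<close> stays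
  inside the decay sector of \<open>E\<close> shifted by \<open>- 2 * pi\<close>.
\<close>

definition good :: "real \<Rightarrow> real \<Rightarrow> complex \<Rightarrow> bool" where
  "good \<epsilon> \<tau> \<eta> \<longleftrightarrow> \<bar>\<tau>\<bar> \<le> a * pi / 2 - \<epsilon> \<and>
     a * pi / 2 + \<epsilon> \<le> \<tau> - Im \<eta> + 2 * pi \<and> \<tau> - Im \<eta> + 2 * pi \<le> 2 * pi - a * pi / 2 - \<epsilon>"

text \<open>Adding \<open>2 * pi * \<i>\<close> brings \<open>Im (\<xi> - \<eta>)\<close> into the
  interval from 0 to \<open>2 * pi\<close> in which the decay of \<open>E\<close> is
  expressed.\<close>

lemma exp_shift: "exp (\<xi> - \<eta>) = exp (\<xi> - \<eta> + 2 * of_real pi * \<i>)"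
  by (simp add: exp_add)

text \<open>The growth of \<open>exp (- (\<beta> * Re \<xi>))\<close> to the left costs half of the
  weight. The dependence on \<eta> survives as \<open>exp (\<beta> * Re \<eta>)\<close> and becomes
  the decay of the kernel towards the vertex.\<close>

lemma integrand_bound:
  obtains \<beta> where "0 < \<beta>"
    "\<And>\<epsilon>. \<epsilon> > 0 \<Longrightarrow> \<exists>C>0. \<exists>B\<ge>1. \<forall>k\<ge>1. \<forall>\<eta> \<xi>. good \<epsilon> (Im \<xi>) \<eta> \<longrightarrow>
       cmod (integrand k \<eta> \<xi>) \<le> C * B ^ k * N k * exp (\<beta> * Re \<eta>) * exp (- (1/2 * \<bar>Re \<xi>\<bar>))"
proof -
  obtain \<beta> where \<beta>: "0 < \<beta>" "\<beta> \<le> 1 / 2"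
    "\<And>\<epsilon>. \<epsilon> > 0 \<Longrightarrow> \<exists>c>0. \<forall>\<xi>. a * pi / 2 + \<epsilon> \<le> Im \<xi> \<and> Im \<xi> \<le> 2 * pi - a * pi / 2 - \<epsilon> \<longrightarrow>
       cmod (E (exp \<xi>)) \<le> c \<and> cmod (E (exp \<xi>)) \<le> c * exp (- (\<beta> * Re \<xi>))"
    by (rule E_exp_bound, rule that)
  have "\<exists>C>0. \<exists>B\<ge>1. \<forall>k\<ge>1. \<forall>\<eta> \<xi>. good \<epsilon> (Im \<xi>) \<eta> \<longrightarrow>
       cmod (integrand k \<eta> \<xi>) \<le> C * B ^ k * N k * exp (\<beta> * Re \<eta>) * exp (- (1/2 * \<bar>Re \<xi>\<bar>))"
    if \<epsilon>: "\<epsilon> > 0" for \<epsilon>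
  proof -
    obtain C B where CB: "C > 0" "B \<ge> 1"
      "\<And>\<xi> k. k \<ge> 1 \<Longrightarrow> \<bar>Im \<xi>\<bar> \<le> a * pi / 2 - \<epsilon> \<Longrightarrow>
         cmod (exp (of_nat k * \<xi>) * e (exp \<xi>)) \<le> C * B ^ k * N k * exp (- \<bar>Re \<xi>\<bar>)"
      by (rule e_weight_bound[OF \<epsilon>], rule that)
    obtain c where c: "c > 0" "\<And>\<xi>. a * pi / 2 + \<epsilon> \<le> Im \<xi> \<Longrightarrow> Im \<xi> \<le> 2 * pi - a * pi / 2 - \<epsilon> \<Longrightarrow>
       cmod (E (exp \<xi>)) \<le> c * exp (- (\<beta> * Re \<xi>))"
      using \<beta>(3)[OF \<epsilon>] by blast
    have "cmod (integrand k \<eta> \<xi>) \<le> (C * c) * B ^ k * N k * exp (\<beta> * Re \<eta>) * exp (- (1/2 * \<bar>Re \<xi>\<bar>))"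
      if k: "k \<ge> 1" and g: "good \<epsilon> (Im \<xi>) \<eta>" for k \<eta> \<xi>
    proof -
      have "cmod (E (exp (\<xi> - \<eta>))) \<le> c * exp (- (\<beta> * (Re \<xi> - Re \<eta>)))"
        using c(2)[of "\<xi> - \<eta> + 2 * of_real pi * \<i>"] g unfolding exp_shift[of \<xi>] good_def by simp
      hence "cmod (integrand k \<eta> \<xi>) \<le> (C * B ^ k * N k * exp (- \<bar>Re \<xi>\<bar>)) * (c * exp (- (\<beta> * (Re \<xi> - Re \<eta>))))"
        unfolding integrand_def norm_mult[of "_ * _"]
        using CB(3)[OF k, of \<xi>] g CB(1,2) strongly_regular_pos[OF N, of k]
        by (intro mult_mono) (auto simp: good_def)
      also have "\<dots> = (C * c) * B ^ k * N k * exp (\<beta> * Re \<eta>) * exp (- \<bar>Re \<xi>\<bar> - \<beta> * Re \<xi>)"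
        by (simp add: algebra_simps exp_add exp_diff exp_minus)
      also have "\<dots> \<le> (C * c) * B ^ k * N k * exp (\<beta> * Re \<eta>) * exp (- (1/2 * \<bar>Re \<xi>\<bar>))"
      proof (intro mult_left_mono)
        have "- (\<beta> * Re \<xi>) \<le> \<beta> * \<bar>Re \<xi>\<bar>" using \<beta>(1) by (metis abs_ge_minus_self abs_mult abs_of_pos)
        also have "\<dots> \<le> 1/2 * \<bar>Re \<xi>\<bar>" using \<beta>(2) by (intro mult_right_mono) auto
        finally show "exp (- \<bar>Re \<xi>\<bar> - \<beta> * Re \<xi>) \<le> exp (- (1/2 * \<bar>Re \<xi>\<bar>))" by simp
      qed (use CB(1,2) c(1) strongly_regular_pos[OF N, of k] in auto)
      finally show ?thesis .
    qed
    thus ?thesis using CB(1,2) c(1) by (intro exI[of _ "C * c"] conjI exI[of _ B]) auto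
  qed
  thus ?thesis using that \<beta>(1) by blast
qed

lemma integrand_continuous:
  assumes "\<bar>\<tau>\<bar> < a * pi / 2"
  shows "continuous_on UNIV (\<lambda>x. integrand k \<eta> (Complex x \<tau>))"
    "continuous_on UNIV (\<lambda>x. exp (of_nat k * Complex x \<tau>) * e (exp (Complex x \<tau>)))"
proof -
  have c: "continuous_on UNIV (\<lambda>x. Complex x \<tau>)" unfolding Complex_eq by (intro continuous_intros)
  have "continuous_on UNIV (\<lambda>x. e (exp (Complex x \<tau>)))"
    by (rule continuous_on_compose2[OF holomorphic_on_imp_continuous_on[OF e_exp_holo] c]) (use assms in auto)
  moreover have "continuous_on UNIV (\<lambda>x. E (exp (Complex x \<tau> - \<eta>)))"
    by (rule continuous_on_compose2[OF holomorphic_on_imp_continuous_on[OF E_holo]]) (intro continuous_intros c, simp)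
  ultimately show "continuous_on UNIV (\<lambda>x. integrand k \<eta> (Complex x \<tau>))"
    "continuous_on UNIV (\<lambda>x. exp (of_nat k * Complex x \<tau>) * e (exp (Complex x \<tau>)))"
    unfolding integrand_def by (intro continuous_intros c; simp)+
qed

lemma integrand_integrable:
  assumes "\<epsilon> > 0" "k \<ge> 1" "good \<epsilon> \<tau> \<eta>"
  shows "(\<lambda>x. integrand k \<eta> (Complex x \<tau>)) integrable_on UNIV"
proof -
  obtain \<beta> where b0: "0 < \<beta>" and b: "\<And>\<epsilon>. \<epsilon> > 0 \<Longrightarrow> \<exists>C>0. \<exists>B\<ge>1. \<forall>k\<ge>1. \<forall>\<eta> \<xi>. good \<epsilon> (Im \<xi>) \<eta> \<longrightarrow>
       cmod (integrand k \<eta> \<xi>) \<le> C * B ^ k * N k * exp (\<beta> * Re \<eta>) * exp (- (1/2 * \<bar>Re \<xi>\<bar>))"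
    by (rule integrand_bound, rule that)
  from b[OF assms(1)] obtain C B where CB: "\<And>k \<eta> \<xi>. k \<ge> 1 \<Longrightarrow> good \<epsilon> (Im \<xi>) \<eta> \<Longrightarrow>
       cmod (integrand k \<eta> \<xi>) \<le> C * B ^ k * N k * exp (\<beta> * Re \<eta>) * exp (- (1/2 * \<bar>Re \<xi>\<bar>))"
    by blast
  define K where "K = C * B ^ k * N k * exp (\<beta> * Re \<eta>)"
  have K: "cmod (integrand k \<eta> (Complex x \<tau>)) \<le> K * exp (- (1/2 * \<bar>x\<bar>))" for x
    using CB[OF assms(2), of "Complex x \<tau>" \<eta>] assms(3) by (simp add: K_def)
  show ?thesis
  proof (rule integrable_dominated_continuous[OF _ closed_UNIV is_interval_univ])
    show "continuous_on UNIV (\<lambda>x. integrand k \<eta> (Complex x \<tau>))"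
      using assms by (intro integrand_continuous) (auto simp: good_def)
    show "(\<lambda>x::real. K * exp (- (1/2 * \<bar>x\<bar>))) integrable_on UNIV"
      by (intro integrable_on_mult_right integrable_exp_abs) simp
  qed (rule K)
qed

lemma \<Phi>_bound:
  obtains \<beta> where "0 < \<beta>"
    "\<And>\<epsilon>. \<epsilon> > 0 \<Longrightarrow> \<exists>C>0. \<exists>B\<ge>1. \<forall>k\<ge>1. \<forall>\<tau> \<eta>. good \<epsilon> \<tau> \<eta> \<longrightarrow>
       cmod (\<Phi> k \<tau> \<eta>) \<le> C * B ^ k * N k * exp (\<beta> * Re \<eta>)"
proof -
  obtain \<beta> where b: "0 < \<beta>" "\<And>\<epsilon>. \<epsilon> > 0 \<Longrightarrow> \<exists>C>0. \<exists>B\<ge>1. \<forall>k\<ge>1. \<forall>\<eta> \<xi>. good \<epsilon> (Im \<xi>) \<eta> \<longrightarrow>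
       cmod (integrand k \<eta> \<xi>) \<le> C * B ^ k * N k * exp (\<beta> * Re \<eta>) * exp (- (1/2 * \<bar>Re \<xi>\<bar>))"
    by (rule integrand_bound, rule that)
  have "\<exists>C>0. \<exists>B\<ge>1. \<forall>k\<ge>1. \<forall>\<tau> \<eta>. good \<epsilon> \<tau> \<eta> \<longrightarrow> cmod (\<Phi> k \<tau> \<eta>) \<le> C * B ^ k * N k * exp (\<beta> * Re \<eta>)"
    if \<epsilon>: "\<epsilon> > 0" for \<epsilon>
  proof -
    obtain C B where CB: "C > 0" "B \<ge> 1" "\<And>k \<eta> \<xi>. k \<ge> 1 \<Longrightarrow> good \<epsilon> (Im \<xi>) \<eta> \<Longrightarrow>
       cmod (integrand k \<eta> \<xi>) \<le> C * B ^ k * N k * exp (\<beta> * Re \<eta>) * exp (- (1/2 * \<bar>Re \<xi>\<bar>))"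
      using b(2)[OF \<epsilon>] by blast
    define I where "I = integral UNIV (\<lambda>x::real. exp (- (1/2 * \<bar>x\<bar>)))"
    have I: "I \<ge> 0" unfolding I_def by (intro integral_nonneg integrable_exp_abs) auto
    have "cmod (\<Phi> k \<tau> \<eta>) \<le> (C * (I + 1)) * B ^ k * N k * exp (\<beta> * Re \<eta>)"
      if "k \<ge> 1" "good \<epsilon> \<tau> \<eta>" for k \<tau> \<eta>
    proof -
      have "cmod (\<Phi> k \<tau> \<eta>) \<le> integral UNIV (\<lambda>x. (C * B ^ k * N k * exp (\<beta> * Re \<eta>)) * exp (- (1/2 * \<bar>x\<bar>)))"
        unfolding \<Phi>_def
      proof (rule integral_norm_bound_integral[OF integrand_integrable[OF \<epsilon> that]])
        show "(\<lambda>x. (C * B ^ k * N k * exp (\<beta> * Re \<eta>)) * exp (- (1/2 * \<bar>x\<bar>))) integrable_on UNIV"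
          by (intro integrable_on_mult_right integrable_exp_abs) simp
        show "cmod (integrand k \<eta> (Complex x \<tau>)) \<le> (C * B ^ k * N k * exp (\<beta> * Re \<eta>)) * exp (- (1/2 * \<bar>x\<bar>))" for x
          using CB(3)[OF that(1), of "Complex x \<tau>" \<eta>] that(2) by simp
      qed
      also have "\<dots> = (C * I) * (B ^ k * N k * exp (\<beta> * Re \<eta>))" by (simp add: I_def)
      also have "\<dots> \<le> (C * (I + 1)) * (B ^ k * N k * exp (\<beta> * Re \<eta>))"
        using CB(1,2) strongly_regular_pos[OF N, of k] by (intro mult_right_mono) auto
      finally show ?thesis by (simp add: mult_ac)
    qed
    thus ?thesis using CB(1,2) I by (intro exI[of _ "C * (I + 1)"] conjI exI[of _ B]) auto
  qed
  thus ?thesis using that b(1) by blast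
qed

text \<open>In \<xi> the integrand is holomorphic on the strip of \<open>e\<close> and decays at
  both ends, and all heights between two good ones are good; so Cauchy's theorem moves the line of
  integration.\<close>

lemma \<Phi>_shift:
  assumes \<epsilon>: "\<epsilon> > 0" and k: "k \<ge> 1" and g: "good \<epsilon> \<tau> \<eta>" "good \<epsilon> \<tau>' \<eta>"
  shows "\<Phi> k \<tau> \<eta> = \<Phi> k \<tau>' \<eta>"
proof -
  have le: "\<Phi> k \<tau> \<eta> = \<Phi> k \<tau>' \<eta>" if g: "good \<epsilon> \<tau> \<eta>" "good \<epsilon> \<tau>' \<eta>" and tt: "\<tau> \<le> \<tau>'" for \<tau> \<tau>'
  proof -
    have gy: "good \<epsilon> y \<eta>" if "\<tau> \<le> y" "y \<le> \<tau>'" for y using g that by (auto simp: good_def)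
    obtain \<beta> where "0 < \<beta>" and b: "\<And>\<epsilon>. \<epsilon> > 0 \<Longrightarrow> \<exists>C>0. \<exists>B\<ge>1. \<forall>k\<ge>1. \<forall>\<eta> \<xi>. good \<epsilon> (Im \<xi>) \<eta> \<longrightarrow>
       cmod (integrand k \<eta> \<xi>) \<le> C * B ^ k * N k * exp (\<beta> * Re \<eta>) * exp (- (1/2 * \<bar>Re \<xi>\<bar>))"
      by (rule integrand_bound, rule that)
    from b[OF \<epsilon>] obtain C B where CB: "\<And>k \<eta> \<xi>. k \<ge> 1 \<Longrightarrow> good \<epsilon> (Im \<xi>) \<eta> \<Longrightarrow>
       cmod (integrand k \<eta> \<xi>) \<le> C * B ^ k * N k * exp (\<beta> * Re \<eta>) * exp (- (1/2 * \<bar>Re \<xi>\<bar>))"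
      by blast
    define K where "K = C * B ^ k * N k * exp (\<beta> * Re \<eta>)"
    have K: "cmod (integrand k \<eta> (Complex x y)) \<le> K * exp (- (1/2 * \<bar>x\<bar>))"
      if "\<tau> \<le> y" "y \<le> \<tau>'" for x y
      using CB[OF k, of "Complex x y" \<eta>] gy[OF that] by (simp add: K_def)
    show ?thesis
      unfolding \<Phi>_def
    proof (rule Cauchy_strip_shift[where W = "{\<xi>. \<bar>Im \<xi>\<bar> < a * pi / 2}" and f = "integrand k \<eta>", OF _ _ _ tt _ _ K])
      have *: "{\<xi>. \<bar>Im \<xi>\<bar> < a * pi / 2} = {\<xi>. Im \<xi> < a * pi / 2} \<inter> {\<xi>. Im \<xi> > - (a * pi / 2)}" by auto
      show "open {\<xi>. \<bar>Im \<xi>\<bar> < a * pi / 2}" unfolding * by (intro open_Int open_halfspace_Im_lt open_halfspace_Im_gt)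
      show "convex {\<xi>. \<bar>Im \<xi>\<bar> < a * pi / 2}" unfolding * by (intro convex_Int convex_halfspace_Im_lt convex_halfspace_Im_gt)
      have "(E \<circ> (\<lambda>\<xi>. exp (\<xi> - \<eta>))) holomorphic_on {\<xi>. \<bar>Im \<xi>\<bar> < a * pi / 2}"
        by (rule holomorphic_on_compose_gen[OF _ E_holo]) (auto intro!: holomorphic_intros)
      thus "integrand k \<eta> holomorphic_on {\<xi>. \<bar>Im \<xi>\<bar> < a * pi / 2}"
        unfolding integrand_def[abs_def] by (intro holomorphic_intros e_exp_holo) (simp add: o_def)
      show "Complex x y \<in> {\<xi>. \<bar>Im \<xi>\<bar> < a * pi / 2}" if "\<tau> \<le> y" "y \<le> \<tau>'" for x y
        using gy[OF that] \<epsilon> by (simp add: good_def)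
    qed (use integrand_integrable[OF \<epsilon> k] g in auto)
  qed
  show ?thesis
  proof (cases "\<tau> \<le> \<tau>'")
    case False
    hence "\<tau>' \<le> \<tau>" by simp
    from le[OF g(2,1) this] show ?thesis by (rule sym)
  qed (rule le[OF g])
qed

text \<open>The weight \<open>exp (k * \<xi>) * e (exp \<xi>)\<close> is fixed and \<eta> enters
  only through the translate \<open>U (\<eta> - \<xi>)\<close> with
  \<open>U w = E (exp (- w))\<close>. The doubled margin leaves room for discs of radius
  \<epsilon>.\<close>

lemma \<Phi>_differentiable:
  assumes \<epsilon>: "\<epsilon> > 0" and k: "k \<ge> 1" and g: "good (2 * \<epsilon>) \<tau> \<eta>"
  shows "\<exists>D. (\<Phi> k \<tau> has_field_derivative D) (at \<eta>)"
proof -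
  define W where "W = {w. a * pi / 2 + \<epsilon> < 2 * pi - Im w} \<inter> {w. 2 * pi - Im w < 2 * pi - a * pi / 2 - \<epsilon>}"
  have "W = {w. Im w < 2 * pi - (a * pi / 2 + \<epsilon>)} \<inter> {w. Im w > a * pi / 2 + \<epsilon>}"
    unfolding W_def by auto
  hence W: "open W" by (auto intro!: open_Int open_halfspace_Im_lt open_halfspace_Im_gt)
  define U where "U = (\<lambda>w. E (exp (- w)))"
  have "(E \<circ> (\<lambda>w. exp (- w))) holomorphic_on W"
    by (rule holomorphic_on_compose_gen[OF _ E_holo]) (auto intro!: holomorphic_intros)
  hence U: "holo_on U W" by (simp add: holo_on_complex_iff[OF W] U_def o_def)
  obtain \<beta> where "0 < \<beta>" "\<beta> \<le> 1 / 2" and b: "\<And>\<epsilon>. \<epsilon> > 0 \<Longrightarrow> \<exists>c>0. \<forall>\<xi>. a * pi / 2 + \<epsilon> \<le> Im \<xi> \<and> Im \<xi> \<le> 2 * pi - a * pi / 2 - \<epsilon> \<longrightarrow>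
       cmod (E (exp \<xi>)) \<le> c \<and> cmod (E (exp \<xi>)) \<le> c * exp (- (\<beta> * Re \<xi>))"
    by (rule E_exp_bound, rule that)
  from b[OF \<epsilon>] obtain c where c: "\<And>\<xi>. a * pi / 2 + \<epsilon> \<le> Im \<xi> \<Longrightarrow> Im \<xi> \<le> 2 * pi - a * pi / 2 - \<epsilon> \<Longrightarrow>
       cmod (E (exp \<xi>)) \<le> c" by blast
  have UB: "cmod (U w) \<le> c" if "w \<in> W" for w
    using that c[of "- w + 2 * of_real pi * \<i>"] exp_shift[of 0 w] by (simp add: W_def U_def)
  obtain C B where "C > 0" "B \<ge> 1" and CB: "\<And>\<xi> k. k \<ge> 1 \<Longrightarrow> \<bar>Im \<xi>\<bar> \<le> a * pi / 2 - \<epsilon> \<Longrightarrow>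
         cmod (exp (of_nat k * \<xi>) * e (exp \<xi>)) \<le> C * B ^ k * N k * exp (- \<bar>Re \<xi>\<bar>)"
    by (rule e_weight_bound[OF \<epsilon>], rule that)
  define p where "p x = - Complex x \<tau>" for x
  define w where "w x = exp (of_nat k * Complex x \<tau>) * e (exp (Complex x \<tau>))" for x
  have sub: "ball (\<eta> + p x) \<epsilon> \<subseteq> W" for x
  proof
    fix v assume "v \<in> ball (\<eta> + p x) \<epsilon>"
    hence "\<bar>Im (\<eta> + p x - v)\<bar> < \<epsilon>" using abs_Im_le_cmod[of "\<eta> + p x - v"] by (simp add: dist_norm)
    thus "v \<in> W" using g by (auto simp: W_def p_def good_def abs_less_iff)
  qed
  have "\<exists>D. ((\<lambda>\<zeta>. integral UNIV (\<lambda>x. w x *\<^sub>C U (\<zeta> + p x))) has_derivative (\<lambda>h. h *\<^sub>C D)) (at \<eta>)"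
  proof (rule holo_on_integral_translates[OF closed_UNIV is_interval_univ _ _ _ _ U W \<epsilon> sub])
    show "continuous_on UNIV w"
      unfolding w_def using g \<epsilon> by (intro integrand_continuous) (auto simp: good_def)
    show "continuous_on UNIV p" unfolding p_def Complex_eq by (intro continuous_intros)
    show "(\<lambda>x. C * B ^ k * N k * exp (- (1 * \<bar>x\<bar>))) integrable_on UNIV"
      by (intro integrable_on_mult_right integrable_exp_abs) simp
    show "cmod (w x) \<le> C * B ^ k * N k * exp (- (1 * \<bar>x\<bar>))" for x
      using CB[OF k, of "Complex x \<tau>"] g \<epsilon> by (simp add: w_def good_def)
    show "norm (U v) \<le> c" if "v \<in> ball (\<eta> + p x) \<epsilon>" for x v using UB sub that by blast
  qed
  moreover have "(\<lambda>\<zeta>. integral UNIV (\<lambda>x. w x *\<^sub>C U (\<zeta> + p x))) = \<Phi> k \<tau>"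
    by (simp add: fun_eq_iff \<Phi>_def integrand_def w_def U_def p_def scaleC_complex_def)
  ultimately obtain D where "(\<Phi> k \<tau> has_derivative (\<lambda>h. h *\<^sub>C D)) (at \<eta>)" by auto
  thus ?thesis
    unfolding has_field_derivative_def scaleC_complex_def by (auto simp: mult.commute[of _ D])
qed

text \<open>The height is linear in \<open>Im \<eta>\<close>: while \<open>Im \<eta>\<close> runs
  from 0 to \<open>2 * pi\<close>, it runs from \<open>- (a * pi / 2)\<close> to
  \<open>a * pi / 2\<close>, and \<open>\<tau> - Im \<eta> + 2 * pi\<close> falls from
  \<open>2 * pi - a * pi / 2\<close> to \<open>a * pi / 2\<close>. So both conditions in
  \<open>good\<close> hold with a positive margin right up to the cut.\<close>

definition \<kappa> :: "nat \<Rightarrow> complex \<Rightarrow> complex" where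
  "\<kappa> k \<eta> = \<Phi> k (a * (Im \<eta> - pi) / 2) \<eta>"

text \<open>The distances to the ends of the two ranges are at least \<open>a * \<delta> / 2\<close>
  and \<open>(1 - a / 2) * \<delta>\<close>, both positive because \<open>0 < a < 2\<close>.\<close>

lemma good_direction:
  assumes "\<delta> > 0"
  obtains \<epsilon> where "\<epsilon> > 0" "\<And>\<eta>. \<delta> \<le> Im \<eta> \<Longrightarrow> Im \<eta> \<le> 2 * pi - \<delta> \<Longrightarrow> good \<epsilon> (a * (Im \<eta> - pi) / 2) \<eta>"
proof -
  define \<epsilon> where "\<epsilon> = min (a * \<delta> / 2) ((1 - a / 2) * \<delta>)"
  have "\<epsilon> > 0" using a_bounds assms by (simp add: \<epsilon>_def)
  moreover have "good \<epsilon> (a * (Im \<eta> - pi) / 2) \<eta>" if h: "\<delta> \<le> Im \<eta>" "Im \<eta> \<le> 2 * pi - \<delta>" for \<eta>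
  proof -
    have e: "\<epsilon> \<le> a * \<delta> / 2" "\<epsilon> \<le> (1 - a / 2) * \<delta>" by (auto simp: \<epsilon>_def)
    have 1: "a * \<delta> \<le> a * Im \<eta>" "a * Im \<eta> \<le> a * (2 * pi - \<delta>)" using a_bounds h by (auto intro!: mult_left_mono)
    have 2: "(1 - a / 2) * \<delta> \<le> (1 - a / 2) * Im \<eta>" "(1 - a / 2) * Im \<eta> \<le> (1 - a / 2) * (2 * pi - \<delta>)"
      using a_bounds h by (auto intro!: mult_left_mono)
    define u v w where "u = a * Im \<eta> / 2" and "v = a * pi / 2" and "w = a * \<delta> / 2"
    have uvw: "a * (Im \<eta> - pi) / 2 = u - v" "(1 - a / 2) * \<delta> = \<delta> - w" "(1 - a / 2) * Im \<eta> = Im \<eta> - u"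
      "(1 - a / 2) * (2 * pi - \<delta>) = 2 * pi - \<delta> - 2 * v + w" "a * (2 * pi - \<delta>) = 4 * v - 2 * w"
      "a * \<delta> = 2 * w" "a * Im \<eta> = 2 * u"
      by (simp_all add: u_def v_def w_def field_simps)
    show ?thesis unfolding good_def uvw v_def[symmetric] abs_le_iff
      using e 1 2 unfolding uvw by auto
  qed
  ultimately show ?thesis using that by blast
qed

lemma \<kappa>_bound:
  obtains \<beta> where "0 < \<beta>"
    "\<And>\<delta>. \<delta> > 0 \<Longrightarrow> \<exists>C>0. \<exists>B\<ge>1. \<forall>k\<ge>1. \<forall>\<eta>. \<delta> \<le> Im \<eta> \<and> Im \<eta> \<le> 2 * pi - \<delta> \<longrightarrow>
       cmod (\<kappa> k \<eta>) \<le> C * B ^ k * N k * exp (\<beta> * Re \<eta>)"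
proof -
  obtain \<beta> where b: "0 < \<beta>" "\<And>\<epsilon>. \<epsilon> > 0 \<Longrightarrow> \<exists>C>0. \<exists>B\<ge>1. \<forall>k\<ge>1. \<forall>\<tau> \<eta>. good \<epsilon> \<tau> \<eta> \<longrightarrow>
       cmod (\<Phi> k \<tau> \<eta>) \<le> C * B ^ k * N k * exp (\<beta> * Re \<eta>)" by (rule \<Phi>_bound, rule that)
  show ?thesis
  proof (rule that[OF b(1)])
    fix \<delta> :: real assume "\<delta> > 0"
    then obtain \<epsilon> where \<epsilon>: "\<epsilon> > 0" "\<And>\<eta>. \<delta> \<le> Im \<eta> \<Longrightarrow> Im \<eta> \<le> 2 * pi - \<delta> \<Longrightarrow> good \<epsilon> (a * (Im \<eta> - pi) / 2) \<eta>"
      using good_direction by blast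
    thus "\<exists>C>0. \<exists>B\<ge>1. \<forall>k\<ge>1. \<forall>\<eta>. \<delta> \<le> Im \<eta> \<and> Im \<eta> \<le> 2 * pi - \<delta> \<longrightarrow>
       cmod (\<kappa> k \<eta>) \<le> C * B ^ k * N k * exp (\<beta> * Re \<eta>)"
      unfolding \<kappa>_def using b(2)[OF \<epsilon>(1)] by blast
  qed
qed

text \<open>The height of the path depends on \<eta>, and not holomorphically. Near a given point it
  is frozen, and \<open>\<Phi>_shift\<close> shows that the fixed height yields the same
  values.\<close>

lemma \<kappa>_holo:
  assumes k: "k \<ge> 1"
  shows "\<kappa> k holomorphic_on {\<eta>. 0 < Im \<eta> \<and> Im \<eta> < 2 * pi}"
  unfolding holomorphic_on_def field_differentiable_def
proof
  fix \<eta>0 :: complex assume h: "\<eta>0 \<in> {\<eta>. 0 < Im \<eta> \<and> Im \<eta> < 2 * pi}"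
  define \<delta> where "\<delta> = min (Im \<eta>0) (2 * pi - Im \<eta>0) / 2"
  have \<delta>: "\<delta> > 0" "2 * \<delta> \<le> Im \<eta>0" "Im \<eta>0 \<le> 2 * pi - 2 * \<delta>" using h by (auto simp: \<delta>_def min_def)
  obtain \<epsilon> where \<epsilon>: "\<epsilon> > 0" "\<And>\<eta>. \<delta> \<le> Im \<eta> \<Longrightarrow> Im \<eta> \<le> 2 * pi - \<delta> \<Longrightarrow> good \<epsilon> (a * (Im \<eta> - pi) / 2) \<eta>"
    using good_direction[OF \<delta>(1)] by blast
  define \<tau> where "\<tau> = a * (Im \<eta>0 - pi) / 2"
  have g0: "good \<epsilon> \<tau> \<eta>0" unfolding \<tau>_def by (rule \<epsilon>(2)) (use \<delta> in auto)
  define r where "r = min \<delta> (\<epsilon> / 2)"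
  have eq: "\<Phi> k \<tau> \<eta> = \<kappa> k \<eta>" if "\<eta> \<in> ball \<eta>0 r" for \<eta>
  proof -
    have d: "\<bar>Im (\<eta>0 - \<eta>)\<bar> < r" using that abs_Im_le_cmod[of "\<eta>0 - \<eta>"] by (simp add: dist_norm)
    have "good \<epsilon> (a * (Im \<eta> - pi) / 2) \<eta>" by (rule \<epsilon>(2)) (use d \<delta> in \<open>auto simp: r_def\<close>)
    hence "good (\<epsilon> / 2) (a * (Im \<eta> - pi) / 2) \<eta>" using \<epsilon>(1) by (auto simp: good_def)
    moreover have "\<bar>Im \<eta>0 - Im \<eta>\<bar> < \<epsilon> / 2" using d by (simp add: r_def)
    hence "Im \<eta>0 - Im \<eta> < \<epsilon> / 2" "Im \<eta> - Im \<eta>0 < \<epsilon> / 2" by linarith+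
    hence "good (\<epsilon> / 2) \<tau> \<eta>" using g0 \<epsilon>(1) by (auto simp: good_def)
    ultimately show ?thesis unfolding \<kappa>_def using \<epsilon>(1) by (intro \<Phi>_shift[OF _ k]) auto
  qed
  obtain D where D: "(\<Phi> k \<tau> has_field_derivative D) (at \<eta>0)"
    using \<Phi>_differentiable[of "\<epsilon> / 2" k \<tau> \<eta>0] g0 \<epsilon>(1) k by auto
  have "r > 0" using \<delta>(1) \<epsilon>(1) by (simp add: r_def)
  hence "(\<kappa> k has_field_derivative D) (at \<eta>0)"
    using has_field_derivative_transform_within_open[OF D open_ball _ eq, of \<eta>0 r] by simp
  thus "\<exists>f'. (\<kappa> k has_field_derivative f') (at \<eta>0 within {\<eta>. 0 < Im \<eta> \<and> Im \<eta> < 2 * pi})"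
    by (blast intro: has_field_derivative_at_within)
qed

end

section \<open>The continued kernel agrees with the kernel series\<close>

lemma exp_series_geometric:
  fixes c :: "nat \<Rightarrow> complex"
  assumes c: "\<And>p. cmod (c p) \<le> C * B ^ p" and B: "B > 0"
  shows "ln B < Re \<eta> \<Longrightarrow> summable (\<lambda>p. exp (- (of_nat p * \<eta>)) * c p)"
    "ln B < Re \<eta> \<Longrightarrow> cmod (\<Sum>p. exp (- (of_nat p * \<eta>)) * c p) \<le> C / (1 - B * exp (- Re \<eta>))"
    "(\<lambda>\<eta>. \<Sum>p. exp (- (of_nat p * \<eta>)) * c p) holomorphic_on {\<eta>. ln B < Re \<eta>}"
proof -
  have lt: "B * exp (- Re \<eta>) < 1" if "ln B < Re \<eta>" for \<eta>
  proof -
    have "B = exp (ln B)" using B by simp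
    hence "B * exp (- Re \<eta>) = exp (ln B - Re \<eta>)" by (metis exp_diff exp_minus divide_inverse)
    thus ?thesis using that by simp
  qed
  have le: "cmod (exp (- (of_nat p * \<eta>)) * c p) \<le> C * (B * exp (- Re \<eta>)) ^ p" for p \<eta>
  proof -
    have "cmod (exp (- (of_nat p * \<eta>)) * c p) \<le> exp (- Re \<eta>) ^ p * (C * B ^ p)"
      unfolding norm_mult using c[of p] by (intro mult_mono) (auto simp flip: exp_of_nat_mult)
    thus ?thesis by (simp add: power_mult_distrib mult_ac)
  qed
  have geo: "(\<lambda>p. C * (B * exp (- Re \<eta>)) ^ p) sums (C * (1 / (1 - B * exp (- Re \<eta>))))"
    if "ln B < Re \<eta>" for \<eta>
    by (intro sums_mult geometric_sums) (use lt[OF that] B in auto)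
  show s: "summable (\<lambda>p. exp (- (of_nat p * \<eta>)) * c p)" if "ln B < Re \<eta>" for \<eta>
    by (rule summable_comparison_test'[OF sums_summable[OF geo[OF that]] le])
  have ns: "summable (\<lambda>p. norm (exp (- (of_nat p * \<eta>)) * c p))" if "ln B < Re \<eta>" for \<eta>
    by (rule summable_comparison_test'[OF sums_summable[OF geo[OF that]]]) (use le in simp)
  show "cmod (\<Sum>p. exp (- (of_nat p * \<eta>)) * c p) \<le> C / (1 - B * exp (- Re \<eta>))" if "ln B < Re \<eta>" for \<eta>
  proof -
    have "cmod (\<Sum>p. exp (- (of_nat p * \<eta>)) * c p) \<le> (\<Sum>p. C * (B * exp (- Re \<eta>)) ^ p)"
      by (rule order_trans[OF summable_norm[OF ns[OF that]] suminf_le[OF le ns[OF that] sums_summable[OF geo[OF that]]]])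
    thus ?thesis using sums_unique[OF geo[OF that]] by simp
  qed
  \<comment> \<open>In the variable \<open>y = exp (- \<eta>)\<close> the series is a power series
    of radius at least \<open>1 / B\<close>.\<close>
  define g where "g y = (\<Sum>p. c p * y ^ p)" for y
  have e: "exp (- (of_nat p * \<eta>)) = exp (- \<eta>) ^ p" for p and \<eta> :: complex
    by (simp flip: exp_of_nat_mult)
  have sub: "(\<lambda>\<eta>. exp (- \<eta>)) ` {\<eta>. ln B < Re \<eta>} \<subseteq> ball 0 (1 / B)"
    using lt B by (auto simp: field_simps)
  have "g holomorphic_on ball 0 (1 / B)"
  proof (rule power_series_holomorphic)
    fix y :: complex assume y: "y \<in> ball 0 (1 / B)"
    have "summable (\<lambda>p. c p * y ^ p)"
    proof (cases "y = 0")
      case False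
      have 1: "ln B < Re (- Ln y)"
      proof -
        have "cmod y * B < 1" using y B by (simp add: field_simps)
        hence "ln (cmod y * B) < ln 1" using False B by (subst ln_less_cancel_iff) auto
        thus ?thesis using False B by (simp add: ln_mult)
      qed
      have "exp (- (of_nat p * - Ln y)) = y ^ p" for p unfolding e using False by simp
      thus ?thesis using s[OF 1] by (simp add: mult.commute)
    qed (rule summable_finite[of "{0}"], auto)
    thus "(\<lambda>n. c n * (y - 0) ^ n) sums g y" unfolding g_def by (simp add: summable_sums)
  qed
  hence "(g \<circ> (\<lambda>\<eta>. exp (- \<eta>))) holomorphic_on {\<eta>. ln B < Re \<eta>}"
    by (intro holomorphic_on_compose_gen[OF _ _ sub] holomorphic_intros)
  moreover have "g \<circ> (\<lambda>\<eta>. exp (- \<eta>)) = (\<lambda>\<eta>. \<Sum>p. exp (- (of_nat p * \<eta>)) * c p)"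
    by (simp only: fun_eq_iff g_def o_def e mult.commute[of "c _"]) simp
  ultimately show "(\<lambda>\<eta>. \<Sum>p. exp (- (of_nat p * \<eta>)) * c p) holomorphic_on {\<eta>. ln B < Re \<eta>}"
    by simp
qed

context kernel_setup
begin

text \<open>For \<open>q \<ge> 1\<close> the substitution \<open>t = exp x\<close> turns
  \<open>t ^ (q - 1) * e t dt\<close> into \<open>weight q x dx\<close>, so that the integral over
  the line is the moment \<open>\<mu> q\<close>.\<close>

definition weight :: "nat \<Rightarrow> real \<Rightarrow> complex" where
  "weight q x = exp (of_nat q * of_real x) * e (exp (of_real x))"

lemma weight_continuous: "continuous_on UNIV (weight q)"
  using integrand_continuous(2)[of 0 q] a_bounds by (simp add: weight_def[abs_def] complex_of_real_def)

lemma weight_bound: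
  obtains C B where "C > 0" "B \<ge> 1" "\<And>q x. q \<ge> 1 \<Longrightarrow> cmod (weight q x) \<le> C * B ^ q * N q * exp (- \<bar>x\<bar>)"
proof -
  have a0: "a * pi / 2 > 0" using a_bounds by simp
  obtain C B where CB: "C > 0" "B \<ge> 1" "\<And>\<xi> k. k \<ge> 1 \<Longrightarrow> \<bar>Im \<xi>\<bar> \<le> a * pi / 2 - a * pi / 2 \<Longrightarrow>
       cmod (exp (of_nat k * \<xi>) * e (exp \<xi>)) \<le> C * B ^ k * N k * exp (- \<bar>Re \<xi>\<bar>)"
    by (rule e_weight_bound[OF a0], rule that)
  show ?thesis
    by (rule that[OF CB(1,2)]) (use CB(3)[of _ "of_real _"] in \<open>simp add: weight_def\<close>)
qed

lemma integrable_lborel_exp_abs: "integrable lborel (\<lambda>x::real. exp (- \<bar>x\<bar>))"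
proof -
  have "(\<lambda>x::real. exp (- (1 * \<bar>x\<bar>))) absolutely_integrable_on UNIV"
    by (intro nonnegative_absolutely_integrable_1 integrable_exp_abs) auto
  hence "integrable lebesgue (\<lambda>x::real. exp (- \<bar>x\<bar>))" by (simp add: set_integrable_def)
  moreover have "(\<lambda>x::real. exp (- \<bar>x\<bar>)) \<in> borel_measurable lborel" by measurable
  ultimately show ?thesis using integrable_completion by blast
qed

lemma weight_integrable: "q \<ge> 1 \<Longrightarrow> integrable lborel (weight q)"
  and weight_integral_norm:
    "\<exists>C>0. \<exists>B\<ge>1. \<forall>q\<ge>1. (LINT x|lborel. cmod (weight q x)) \<le> C * B ^ q * N q"
proof -
  obtain C B where CB: "C > 0" "B \<ge> 1" "\<And>q x. q \<ge> 1 \<Longrightarrow> cmod (weight q x) \<le> C * B ^ q * N q * exp (- \<bar>x\<bar>)"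
    by (rule weight_bound, rule that)
  have int: "integrable lborel (\<lambda>x. C * B ^ q * N q * exp (- \<bar>x\<bar>))" for q
    by (intro integrable_mult_right integrable_lborel_exp_abs)
  show i: "integrable lborel (weight q)" if "q \<ge> 1" for q
  proof (rule Bochner_Integration.integrable_bound[OF int])
    show "weight q \<in> borel_measurable lborel"
      using weight_continuous borel_measurable_continuous_onI by auto
    show "AE x in lborel. cmod (weight q x) \<le> norm (C * B ^ q * N q * exp (- \<bar>x\<bar>))"
    proof (intro AE_I2)
      fix x
      have "C * B ^ q * N q * exp (- \<bar>x\<bar>) \<le> norm (C * B ^ q * N q * exp (- \<bar>x\<bar>))" by simp
      thus "cmod (weight q x) \<le> norm (C * B ^ q * N q * exp (- \<bar>x\<bar>))" using CB(3)[OF that] order_trans by blast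
    qed
  qed
  define I where "I = (LINT x|lborel. exp (- \<bar>x::real\<bar>))"
  have I: "I \<ge> 0" unfolding I_def by (rule Bochner_Integration.integral_nonneg) simp
  have "(LINT x|lborel. cmod (weight q x)) \<le> (C * (I + 1)) * B ^ q * N q" if q: "q \<ge> 1" for q
  proof -
    have "(LINT x|lborel. cmod (weight q x)) \<le> (LINT x|lborel. C * B ^ q * N q * exp (- \<bar>x\<bar>))"
      by (rule integral_mono[OF integrable_norm[OF i[OF q]] int CB(3)[OF q]])
    also have "\<dots> = (C * I) * (B ^ q * N q)" by (simp add: I_def)
    also have "\<dots> \<le> (C * (I + 1)) * (B ^ q * N q)"
      using CB(1,2) strongly_regular_pos[OF N, of q] by (intro mult_right_mono) auto
    finally show ?thesis by (simp add: mult_ac)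
  qed
  thus "\<exists>C>0. \<exists>B\<ge>1. \<forall>q\<ge>1. (LINT x|lborel. cmod (weight q x)) \<le> C * B ^ q * N q"
    using CB(1,2) I by (intro exI[of _ "C * (I + 1)"] conjI exI[of _ B]) auto
qed

lemma moment_eq_integral:
  assumes q: "q \<ge> 1"
  shows "\<mu> q = (LINT x|lborel. weight q x)"
proof -
  define F where "F t = complex_of_real t ^ (q - 1) * e (complex_of_real t)" for t
  have \<mu>: "\<mu> q = (LINT t:{0<..}|lborel. F t)"
    unfolding \<mu>_def kernel_moment_def
  proof (rule set_lebesgue_integral_cong)
    show "\<forall>t. t \<in> {0<..} \<longrightarrow> complex_of_real t powr (of_nat q - 1) * e (complex_of_real t) = F t"
    proof (intro allI impI)
      fix t :: real assume "t \<in> {0<..}"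
      moreover have "of_nat q - 1 = (of_nat (q - 1) :: complex)" using q by (simp add: of_nat_diff)
      ultimately show "complex_of_real t powr (of_nat q - 1) * e (complex_of_real t) = F t"
        unfolding F_def by (simp add: powr_nat')
    qed
  qed simp
  have Fexp: "of_real (exp x) * F (exp x) = weight q x" for x
  proof -
    have "of_real (exp x) * complex_of_real (exp x) ^ (q - 1) = exp (of_nat q * of_real x)"
      using q by (simp add: exp_of_nat_mult exp_of_real flip: power_Suc)
    thus ?thesis unfolding F_def weight_def by (simp add: exp_of_real mult.assoc[symmetric])
  qed
  have img: "exp ` (UNIV::real set) = {0<..}"
    by (auto simp: image_iff) (metis exp_ln)
  have contF: "continuous_on {0<..} F"
    unfolding F_def
  proof (intro continuous_intros continuous_on_compose2[OF holomorphic_on_imp_continuous_on[OF pair_facts(1)]])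
    show "complex_of_real ` {0<..} \<subseteq> csector 0 (omega N * pi)"
    proof
      fix z assume "z \<in> complex_of_real ` {0<..}"
      then obtain t where "t > 0" "z = of_real t" by auto
      hence "z = exp (of_real (ln t))" by (simp add: exp_of_real)
      thus "z \<in> csector 0 (omega N * pi)"
        unfolding csector_def sector_def using a_bounds by (intro image_eqI) (auto simp: a_def)
    qed
  qed
  \<comment> \<open>The change of variables is made for real-valued functions; \<open>c\<close>
    stands for \<open>Re\<close> and \<open>Im\<close>. Continuity of \<open>F\<close> gives Borel
    measurability, through which integrability passes from the Lebesgue to the Borel
    measure.\<close>
  have part: "set_integrable lborel {0<..} (\<lambda>t. c (F t)) \<and>
      (LINT t:{0<..}|lborel. c (F t)) = (LINT x|lborel. c (weight q x))"
    if c: "bounded_linear c" for c :: "complex \<Rightarrow> real"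
  proof -
    have ci: "integrable lborel (\<lambda>x. c (weight q x))"
      by (rule integrable_bounded_linear[OF c weight_integrable[OF q]])
    hence "integrable lebesgue (\<lambda>x. c (weight q x))"
      using integrable_completion[of "\<lambda>x. c (weight q x)" lborel] borel_measurable_integrable by blast
    hence ai: "(\<lambda>x. c (weight q x)) absolutely_integrable_on UNIV" by (simp add: set_integrable_def)
    have cexp: "\<bar>exp x\<bar> * c (F (exp x)) = c (weight q x)" for x
      using linear_scale[OF bounded_linear.linear[OF c], of "exp x" "F (exp x)"]
      by (simp add: Fexp[symmetric] scaleR_conv_of_real)
    have "(\<lambda>t. c (F t)) absolutely_integrable_on (exp ` UNIV) \<and>
        integral (exp ` UNIV) (\<lambda>t. c (F t)) = integral UNIV (\<lambda>x. c (weight q x))"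
      by (subst has_absolute_integral_change_of_variables_1'[of UNIV exp exp "\<lambda>t. c (F t)", symmetric])
        (use ai in \<open>auto simp: cexp[simplified] inj_on_def intro!: derivative_eq_intros\<close>)
    hence 1: "(\<lambda>t. c (F t)) absolutely_integrable_on {0<..}"
      and 2: "integral {0<..} (\<lambda>t. c (F t)) = integral UNIV (\<lambda>x. c (weight q x))"
      unfolding img by auto
    have "(\<lambda>t. indicator {0<..} t *\<^sub>R c (F t)) \<in> borel_measurable lborel"
      using borel_measurable_continuous_on_indicator[of "{0<..}" "\<lambda>t. c (F t)"]
        bounded_linear.continuous_on[OF c contF] by simp
    hence si: "set_integrable lborel {0<..} (\<lambda>t. c (F t))"
      using 1 integrable_completion[of "\<lambda>t. indicator {0<..} t *\<^sub>R c (F t)" lborel]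
      by (simp add: set_integrable_def)
    show ?thesis
      using si set_borel_integral_eq_integral(2)[OF si] 2 integral_lborel[OF ci] by simp
  qed
  note R = part[OF bounded_linear_Re] and I = part[OF bounded_linear_Im]
  have Fi: "set_integrable lborel {0<..} F"
  proof -
    have "integrable lborel (\<lambda>t. of_real (indicator {0<..} t *\<^sub>R Re (F t)) + \<i> * of_real (indicator {0<..} t *\<^sub>R Im (F t)))"
      using R I unfolding set_integrable_def by (intro Bochner_Integration.integrable_add integrable_mult_right integrable_of_real) auto
    moreover have "of_real (indicator {0<..} t *\<^sub>R Re (F t)) + \<i> * of_real (indicator {0<..} t *\<^sub>R Im (F t))
        = indicator {0<..} t *\<^sub>R F t" for t
      by (simp add: complex_eq_iff)
    ultimately show ?thesis unfolding set_integrable_def by simp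
  qed
  have "Re (\<mu> q) = (LINT t:{0<..}|lborel. Re (F t))" "Im (\<mu> q) = (LINT t:{0<..}|lborel. Im (F t))"
    unfolding \<mu> set_lebesgue_integral_def
    using integral_bounded_linear[OF bounded_linear_Re Fi[unfolded set_integrable_def]]
      integral_bounded_linear[OF bounded_linear_Im Fi[unfolded set_integrable_def]] by auto
  moreover have "Re (LINT x|lborel. weight q x) = (LINT x|lborel. Re (weight q x))"
    "Im (LINT x|lborel. weight q x) = (LINT x|lborel. Im (weight q x))"
    using integral_bounded_linear[OF bounded_linear_Re weight_integrable[OF q]]
      integral_bounded_linear[OF bounded_linear_Im weight_integrable[OF q]] by auto
  ultimately show ?thesis using R I by (simp add: complex_eq_iff)
qed

text \<open>For fixed \<open>k\<close>, moderate growth splits \<open>N (p + k)\<close> and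
  \<open>N p\<close> is traded for \<open>\<mu> p\<close>; what remains is geometric in
  \<open>p\<close>. The kernel series therefore converges for large \<open>Re \<eta>\<close>, which
  suffices to identify it with \<kappa>.\<close>

lemma moment_quotient_bound:
  assumes k: "k \<ge> 1"
  obtains C B where "C > 0" "B > 0" "\<And>p. (LINT x|lborel. cmod (weight (p + k) x)) / cmod (\<mu> p) \<le> C * B ^ p"
    "\<And>p. cmod (\<mu> (p + k) / \<mu> p) \<le> C * B ^ p"
proof -
  note pos = strongly_regular_pos[OF N]
  obtain C B where CB: "C > 0" "B \<ge> 1" "\<And>q. q \<ge> 1 \<Longrightarrow> (LINT x|lborel. cmod (weight q x)) \<le> C * B ^ q * N q"
    using weight_integral_norm by blast
  obtain A where A: "A \<ge> 1" "\<And>p q. N (p + q) \<le> A ^ (p + q) * N p * N q"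
    by (rule strongly_regular_mg[OF N], rule that)
  obtain c b where cb: "c > 0" "b \<ge> 1" "\<And>p. N p \<le> c * b ^ p * cmod (\<mu> p)"
    by (rule N_le_moment, rule that)
  define C' where "C' = C * B ^ k * A ^ k * N k * c"
  define B' where "B' = B * A * b"
  have 1: "(LINT x|lborel. cmod (weight (p + k) x)) / cmod (\<mu> p) \<le> C' * B' ^ p" for p
  proof -
    have "(LINT x|lborel. cmod (weight (p + k) x)) \<le> C * B ^ (p + k) * N (p + k)" using CB(3)[of "p + k"] k by simp
    also have "\<dots> \<le> C * B ^ (p + k) * (A ^ (p + k) * N p * N k)" using CB(1,2) by (intro mult_left_mono A) auto
    also have "\<dots> \<le> C * B ^ (p + k) * (A ^ (p + k) * (c * b ^ p * cmod (\<mu> p)) * N k)"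
      using CB(1,2) A(1) pos[of k] by (intro mult_left_mono mult_right_mono cb) auto
    also have "\<dots> = C' * B' ^ p * cmod (\<mu> p)" by (simp add: C'_def B'_def power_add power_mult_distrib)
    finally show ?thesis using \<mu>_nonzero[of p] by (simp add: divide_le_eq)
  qed
  have 2: "cmod (\<mu> (p + k) / \<mu> p) \<le> C' * B' ^ p" for p
  proof -
    have "cmod (\<mu> (p + k)) \<le> (LINT x|lborel. cmod (weight (p + k) x))"
      using k by (simp add: moment_eq_integral)
    hence "cmod (\<mu> (p + k) / \<mu> p) \<le> (LINT x|lborel. cmod (weight (p + k) x)) / cmod (\<mu> p)"
      by (simp add: norm_divide divide_right_mono)
    thus ?thesis using 1 order_trans by blast
  qed
  have "C' > 0" "B' > 0" using CB(1,2) A(1) cb(1,2) pos[of k] by (auto simp: C'_def B'_def)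
  thus ?thesis using that 1 2 by blast
qed

text \<open>For \<open>Im \<eta> = pi\<close> the path of \<kappa> is the real axis, where the terms
  in the expansion of \<open>E\<close> integrate to moments. Sum and integral may be exchanged
  because the integrals of the absolute values are dominated by a geometric series.\<close>

lemma \<kappa>_series_line:
  assumes k: "k \<ge> 1" and Im: "Im \<eta> = pi" and B: "ln B < Re \<eta>" "B > 0"
    and C: "\<And>p. (LINT x|lborel. cmod (weight (p + k) x)) / cmod (\<mu> p) \<le> C * B ^ p"
  shows "(\<lambda>p. exp (- (of_nat p * \<eta>)) * (\<mu> (p + k) / \<mu> p)) sums \<kappa> k \<eta>"
proof -
  define f where "f p x = weight (p + k) x * (exp (- (of_nat p * \<eta>)) / \<mu> p)" for p x
  have fi: "integrable lborel (f p)" for p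
    unfolding f_def using k by (intro integrable_mult_left weight_integrable) auto
  have fz: "f p x = weight k x * (exp (of_real x - \<eta>) ^ p / \<mu> p)" for p x
    by (simp add: f_def weight_def algebra_simps flip: exp_of_nat_mult exp_add)
  have s1: "(\<lambda>p. f p x) sums integrand k \<eta> (Complex x 0)" for x
    unfolding fz integrand_def complex_of_real_def[symmetric] weight_def[symmetric]
    by (intro sums_mult E_sums)
  have s2: "summable (\<lambda>p. norm (f p x))" for x
  proof -
    have "summable (\<lambda>p. inverse (\<mu> p) * of_real (cmod (exp (of_real x - \<eta>)) + 1) ^ p)"
      using E_sums[of "of_real (cmod (exp (of_real x - \<eta>)) + 1)"] sums_summable by (simp add: field_simps)
    hence "summable (\<lambda>p. norm (inverse (\<mu> p) * exp (of_real x - \<eta>) ^ p))"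
      by (rule powser_insidea) simp
    hence "summable (\<lambda>p. norm (weight k x) * norm (inverse (\<mu> p) * exp (of_real x - \<eta>) ^ p))"
      by (rule summable_mult)
    thus ?thesis unfolding fz by (simp add: norm_mult norm_divide field_simps norm_inverse)
  qed
  have s3: "summable (\<lambda>p. LINT x|lborel. norm (f p x))"
  proof (rule summable_comparison_test')
    show "summable (\<lambda>p. C * (B * exp (- Re \<eta>)) ^ p)"
    proof (intro summable_mult summable_geometric)
      have "B * exp (- Re \<eta>) = exp (ln B - Re \<eta>)" using B(2) by (simp add: exp_diff exp_minus field_simps)
      thus "norm (B * exp (- Re \<eta>)) < 1" using B by simp
    qed
    fix p :: nat
    have "(LINT x|lborel. norm (f p x)) = (LINT x|lborel. cmod (weight (p + k) x)) / cmod (\<mu> p) * exp (- Re \<eta>) ^ p"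
      by (simp add: f_def norm_mult norm_divide flip: exp_of_nat_mult)
    also have "\<dots> \<le> C * B ^ p * exp (- Re \<eta>) ^ p" by (intro mult_right_mono C) simp
    finally show "norm (LINT x|lborel. norm (f p x)) \<le> C * (B * exp (- Re \<eta>)) ^ p"
      by (simp add: power_mult_distrib mult.assoc)
  qed
  have sf: "(\<Sum>p. f p x) = integrand k \<eta> (Complex x 0)" for x using s1[of x] by (simp add: sums_iff)
  have "(\<lambda>p. LINT x|lborel. f p x) sums (LINT x|lborel. (\<Sum>p. f p x))"
    by (rule sums_integral[OF fi AE_I2[OF s2] s3])
  moreover have "integrable lborel (\<lambda>x. (\<Sum>p. f p x))"
    by (rule integrable_suminf[OF fi AE_I2[OF s2] s3])
  hence "(LINT x|lborel. (\<Sum>p. f p x)) = \<kappa> k \<eta>"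
    using integral_lborel[of "\<lambda>x. integrand k \<eta> (Complex x 0)"] by (simp add: sf \<kappa>_def \<Phi>_def Im)
  moreover have "(LINT x|lborel. f p x) = exp (- (of_nat p * \<eta>)) * (\<mu> (p + k) / \<mu> p)" for p
    using k by (simp add: f_def moment_eq_integral)
  ultimately show ?thesis by simp
qed

lemma strip_open_connected:
  "open {\<eta>. R < Re \<eta> \<and> b < Im \<eta> \<and> Im \<eta> < c}" "connected {\<eta>. R < Re \<eta> \<and> b < Im \<eta> \<and> Im \<eta> < c}"
proof -
  have *: "{\<eta>. R < Re \<eta> \<and> b < Im \<eta> \<and> Im \<eta> < c} = {\<eta>. Re \<eta> > R} \<inter> ({\<eta>. Im \<eta> > b} \<inter> {\<eta>. Im \<eta> < c})" by auto
  show "open {\<eta>. R < Re \<eta> \<and> b < Im \<eta> \<and> Im \<eta> < c}"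
    unfolding * by (intro open_Int open_halfspace_Re_gt open_halfspace_Im_gt open_halfspace_Im_lt)
  show "connected {\<eta>. R < Re \<eta> \<and> b < Im \<eta> \<and> Im \<eta> < c}"
    unfolding * by (intro convex_connected convex_Int convex_halfspace_Re_gt convex_halfspace_Im_gt convex_halfspace_Im_lt)
qed

text \<open>Both sides are holomorphic on a half strip and agree on the line
  \<open>Im \<eta> = pi\<close>, so the identity theorem applies.\<close>

lemma \<kappa>_series:
  assumes k: "k \<ge> 1"
  obtains R where "\<And>\<eta>. R < Re \<eta> \<Longrightarrow> 0 < Im \<eta> \<Longrightarrow> Im \<eta> < 2 * pi \<Longrightarrow>
    (\<lambda>p. exp (- (of_nat p * \<eta>)) * (\<mu> (p + k) / \<mu> p)) sums \<kappa> k \<eta>"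
proof -
  obtain C B where CB: "C > 0" "B > 0" "\<And>p. (LINT x|lborel. cmod (weight (p + k) x)) / cmod (\<mu> p) \<le> C * B ^ p"
    "\<And>p. cmod (\<mu> (p + k) / \<mu> p) \<le> C * B ^ p"
    by (rule moment_quotient_bound[OF k], rule that)
  note P = exp_series_geometric[where c = "\<lambda>p. \<mu> (p + k) / \<mu> p", OF CB(4) CB(2)]
  define g where "g \<eta> = (\<Sum>p. exp (- (of_nat p * \<eta>)) * (\<mu> (p + k) / \<mu> p))" for \<eta>
  define S where "S = {\<eta>. ln B < Re \<eta> \<and> 0 < Im \<eta> \<and> Im \<eta> < 2 * pi}"
  define \<xi> where "\<xi> = Complex (ln B + 1) pi"
  have lim: "\<xi> islimpt {\<eta>. ln B < Re \<eta> \<and> Im \<eta> = pi}"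
    unfolding islimpt_approachable
  proof (intro allI impI)
    fix r :: real assume "r > 0"
    thus "\<exists>x'\<in>{\<eta>. ln B < Re \<eta> \<and> Im \<eta> = pi}. x' \<noteq> \<xi> \<and> dist x' \<xi> < r"
      by (intro bexI[of _ "\<xi> + of_real (r / 2)"]) (auto simp: \<xi>_def dist_norm)
  qed
  have "g \<eta> = \<kappa> k \<eta>" if "\<eta> \<in> S" for \<eta>
  proof -
    have "\<kappa> k \<eta> - g \<eta> = 0"
    proof (rule analytic_continuation[where f = "\<lambda>\<eta>. \<kappa> k \<eta> - g \<eta>" and w = \<eta>, OF _ _ _ _ _ lim])
      show "(\<lambda>\<eta>. \<kappa> k \<eta> - g \<eta>) holomorphic_on S"
        unfolding g_def by (intro holomorphic_intros holomorphic_on_subset[OF \<kappa>_holo[OF k]] holomorphic_on_subset[OF P(3)])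
          (auto simp: S_def)
      show "open S" "connected S" unfolding S_def by (rule strip_open_connected)+
      show "{\<eta>. ln B < Re \<eta> \<and> Im \<eta> = pi} \<subseteq> S" "\<xi> \<in> S" "\<eta> \<in> S" using that by (auto simp: S_def \<xi>_def)
      fix z assume "z \<in> {\<eta>. ln B < Re \<eta> \<and> Im \<eta> = pi}"
      hence "(\<lambda>p. exp (- (of_nat p * z)) * (\<mu> (p + k) / \<mu> p)) sums \<kappa> k z"
        using \<kappa>_series_line[OF k _ _ CB(2,3)] by auto
      thus "\<kappa> k z - g z = 0" by (simp add: g_def sums_iff)
    qed
    thus ?thesis by simp
  qed
  thus ?thesis using that[of "ln B"] P(1) by (auto simp: S_def g_def sums_iff)
qed

end

section \<open>Ramification of the kernel\<close>

lemma sum_roots_of_unity_powers: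
  assumes s: "s \<ge> 1"
  shows "(\<Sum>j<s. exp (- (of_nat p * (2 * of_real pi * \<i> * of_nat j / of_nat s)))) =
    (if s dvd p then of_nat s else (0::complex))"
proof -
  define \<zeta> where "\<zeta> = exp (- (of_nat p * (2 * of_real pi * \<i> / of_nat s)))"
  have e: "exp (- (of_nat p * (2 * of_real pi * \<i> * of_nat j / of_nat s))) = \<zeta> ^ j" for j
    by (simp add: \<zeta>_def mult_ac flip: exp_of_nat_mult)
  have s1: "\<zeta> ^ s = 1"
  proof -
    have "\<zeta> ^ s = exp (- (2 * of_real pi * \<i>)) ^ p"
      using s unfolding \<zeta>_def exp_of_nat_mult[symmetric] by (simp add: field_simps)
    thus ?thesis by (simp add: exp_minus)
  qed
  show ?thesis
  proof (cases "s dvd p")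
    case True
    then obtain r where r: "p = s * r" by auto
    have "\<zeta> = exp (- (2 * of_real pi * \<i>)) ^ r"
      using s unfolding \<zeta>_def r exp_of_nat_mult[symmetric] by (simp add: field_simps)
    hence "\<zeta> = 1" by (simp add: exp_minus)
    thus ?thesis using True unfolding e by simp
  next
    case False
    have "\<zeta> \<noteq> 1"
    proof
      assume "\<zeta> = 1"
      then obtain n :: int where "- (real p * (2 * pi / real s)) = of_int (2 * n) * pi"
        unfolding \<zeta>_def exp_eq_1 by auto
      hence "pi * (- real p) = pi * (of_int n * real s)" using s by (simp add: field_simps)
      hence "- real p = of_int n * real s" by (subst (asm) mult_left_cancel) auto
      hence "of_int (- int p) = (of_int (n * int s) :: real)" by simp
      hence "- int p = n * int s" by (simp only: of_int_eq_iff)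
      hence "int s dvd int p" by (metis dvd_minus_iff dvd_triv_right)
      thus False using False by simp
    qed
    hence "(\<Sum>j<s. \<zeta> ^ j) = 0" using geometric_sum[of \<zeta> s] s1 by simp
    thus ?thesis using False unfolding e by simp
  qed
qed

context kernel_setup
begin

text \<open>
  Ramification of order \<open>s\<close> keeps every \<open>s\<close>-th coefficient of the kernel series, that is, it
  averages over the \<open>s\<close> roots of \<open>exp \<eta>\<close>.
\<close>

definition ramified :: "nat \<Rightarrow> nat \<Rightarrow> complex \<Rightarrow> complex" where
  "ramified s k \<eta> = (\<Sum>j<s. \<kappa> k ((\<eta> + 2 * of_real pi * \<i> * of_nat j) / of_nat s)) / of_nat s"

text \<open>Division by \<open>s\<close> sends the strips shifted by \<open>2 * pi * j\<close>, for
  \<open>j < s\<close>, onto consecutive pieces of the strip of width \<open>2 * pi\<close>; a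
  margin \<delta> shrinks to \<open>\<delta> / s\<close>.\<close>

lemma Im_ramified:
  assumes s: "s \<ge> 1" and j: "j < s" and d: "0 \<le> \<delta>"
  shows "\<delta> < Im \<eta> \<Longrightarrow> Im \<eta> < 2 * pi - \<delta> \<Longrightarrow>
      \<delta> / s < Im ((\<eta> + 2 * of_real pi * \<i> * of_nat j) / of_nat s) \<and>
      Im ((\<eta> + 2 * of_real pi * \<i> * of_nat j) / of_nat s) < 2 * pi - \<delta> / s"
    "\<delta> \<le> Im \<eta> \<Longrightarrow> Im \<eta> \<le> 2 * pi - \<delta> \<Longrightarrow>
      \<delta> / s \<le> Im ((\<eta> + 2 * of_real pi * \<i> * of_nat j) / of_nat s) \<and>
      Im ((\<eta> + 2 * of_real pi * \<i> * of_nat j) / of_nat s) \<le> 2 * pi - \<delta> / s"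
proof -
  have im: "Im ((\<eta> + 2 * of_real pi * \<i> * of_nat j) / of_nat s) = (Im \<eta> + 2 * pi * real j) / real s"
    by (simp add: Im_divide_of_nat)
  have sp: "0 < real s" using s by simp
  have 0: "0 \<le> 2 * pi * real j" by simp
  have "2 * pi * (real j + 1) \<le> 2 * pi * real s" using j by (intro mult_left_mono) auto
  hence 1: "2 * pi * real j \<le> 2 * pi * real s - 2 * pi" by (simp add: algebra_simps)
  have 2: "2 * pi - \<delta> / s = (2 * pi * real s - \<delta>) / s" using s by (simp add: field_simps)
  show "\<delta> < Im \<eta> \<Longrightarrow> Im \<eta> < 2 * pi - \<delta> \<Longrightarrow>
      \<delta> / s < Im ((\<eta> + 2 * of_real pi * \<i> * of_nat j) / of_nat s) \<and>
      Im ((\<eta> + 2 * of_real pi * \<i> * of_nat j) / of_nat s) < 2 * pi - \<delta> / s"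
    unfolding im 2 using sp 0 1 by (intro conjI divide_strict_right_mono) linarith+
  show "\<delta> \<le> Im \<eta> \<Longrightarrow> Im \<eta> \<le> 2 * pi - \<delta> \<Longrightarrow>
      \<delta> / s \<le> Im ((\<eta> + 2 * of_real pi * \<i> * of_nat j) / of_nat s) \<and>
      Im ((\<eta> + 2 * of_real pi * \<i> * of_nat j) / of_nat s) \<le> 2 * pi - \<delta> / s"
    unfolding im 2 using sp 0 1 by (intro conjI divide_right_mono) linarith+
qed

lemma Re_ramified: "Re ((\<eta> + 2 * of_real pi * \<i> * of_nat j) / of_nat s) = Re \<eta> / real s"
  by (simp add: Re_divide_of_nat)

lemma ramified_holo:
  assumes s: "s \<ge> 1" and k: "k \<ge> 1"
  shows "ramified s k holomorphic_on {\<eta>. 0 < Im \<eta> \<and> Im \<eta> < 2 * pi}"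
proof -
  have "(\<kappa> k \<circ> (\<lambda>\<eta>. (\<eta> + 2 * of_real pi * \<i> * of_nat j) / of_nat s)) holomorphic_on {\<eta>. 0 < Im \<eta> \<and> Im \<eta> < 2 * pi}"
    if "j < s" for j
  proof (rule holomorphic_on_compose_gen[OF _ \<kappa>_holo[OF k]])
    show "(\<lambda>\<eta>. (\<eta> + 2 * of_real pi * \<i> * of_nat j) / of_nat s) holomorphic_on {\<eta>. 0 < Im \<eta> \<and> Im \<eta> < 2 * pi}"
      using s by (intro holomorphic_intros) auto
    show "(\<lambda>\<eta>. (\<eta> + 2 * of_real pi * \<i> * of_nat j) / of_nat s) ` {\<eta>. 0 < Im \<eta> \<and> Im \<eta> < 2 * pi}
        \<subseteq> {\<eta>. 0 < Im \<eta> \<and> Im \<eta> < 2 * pi}"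
      using Im_ramified(1)[OF s that, of 0] by auto
  qed
  thus ?thesis
    unfolding ramified_def[abs_def] o_def using s by (intro holomorphic_intros) auto
qed

text \<open>The summands are bounded through \<open>N (s * n)\<close>, which is at most a geometric
  factor times the moment \<open>\<mu> (s * n)\<close>; the latter will be \<open>m n\<close>. The
  decay exponent becomes \<open>\<beta> / s\<close>.\<close>

lemma ramified_bound:
  assumes s: "s \<ge> 1" and \<delta>: "\<delta> > 0"
  obtains \<gamma> C B where "\<gamma> > 0" "C > 0" "B \<ge> 1"
    "\<And>n \<eta>. n \<ge> 1 \<Longrightarrow> \<delta> \<le> Im \<eta> \<Longrightarrow> Im \<eta> \<le> 2 * pi - \<delta> \<Longrightarrow>
       cmod (ramified s (s * n) \<eta>) \<le> C * B ^ n * cmod (\<mu> (s * n)) * exp (\<gamma> * Re \<eta>)"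
proof -
  obtain \<beta> where \<beta>: "0 < \<beta>" "\<And>\<delta>. \<delta> > 0 \<Longrightarrow> \<exists>C>0. \<exists>B\<ge>1. \<forall>k\<ge>1. \<forall>\<eta>. \<delta> \<le> Im \<eta> \<and> Im \<eta> \<le> 2 * pi - \<delta> \<longrightarrow>
       cmod (\<kappa> k \<eta>) \<le> C * B ^ k * N k * exp (\<beta> * Re \<eta>)"
    by (rule \<kappa>_bound, rule that)
  have "\<delta> / s > 0" using s \<delta> by simp
  from \<beta>(2)[OF this] obtain C B where CB: "C > 0" "B \<ge> 1"
    "\<And>k \<eta>. k \<ge> 1 \<Longrightarrow> \<delta> / s \<le> Im \<eta> \<Longrightarrow> Im \<eta> \<le> 2 * pi - \<delta> / s \<Longrightarrow>
       cmod (\<kappa> k \<eta>) \<le> C * B ^ k * N k * exp (\<beta> * Re \<eta>)" by blast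
  obtain c b where cb: "c > 0" "b \<ge> 1" "\<And>p. N p \<le> c * b ^ p * cmod (\<mu> p)"
    by (rule N_le_moment, rule that)
  have "cmod (ramified s (s * n) \<eta>) \<le> (C * c) * ((B * b) ^ s) ^ n * cmod (\<mu> (s * n)) * exp (\<beta> / s * Re \<eta>)"
    if n: "n \<ge> 1" and \<eta>: "\<delta> \<le> Im \<eta>" "Im \<eta> \<le> 2 * pi - \<delta>" for n \<eta>
  proof -
    define K where "K = C * B ^ (s * n) * N (s * n) * exp (\<beta> / s * Re \<eta>)"
    have "cmod (\<kappa> (s * n) ((\<eta> + 2 * of_real pi * \<i> * of_nat j) / of_nat s)) \<le> K" if "j < s" for j
    proof -
      have "s * n \<ge> 1" using s n by (cases s; cases n) auto
      from CB(3)[OF this, of "(\<eta> + 2 * of_real pi * \<i> * of_nat j) / of_nat s"]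
      show ?thesis using Im_ramified(2)[OF s that _ \<eta>] \<delta> unfolding Re_ramified K_def by simp
    qed
    hence "cmod (\<Sum>j<s. \<kappa> (s * n) ((\<eta> + 2 * of_real pi * \<i> * of_nat j) / of_nat s)) \<le> of_nat (card {..<s}) * K"
      by (intro sum_norm_bound) auto
    hence "cmod (ramified s (s * n) \<eta>) \<le> K"
      unfolding ramified_def norm_divide using s by (simp add: divide_le_eq mult.commute)
    also have "K \<le> C * B ^ (s * n) * (c * b ^ (s * n) * cmod (\<mu> (s * n))) * exp (\<beta> / s * Re \<eta>)"
      unfolding K_def using CB(1,2) by (intro mult_right_mono mult_left_mono cb) auto
    also have "\<dots> = (C * c) * ((B * b) ^ s) ^ n * cmod (\<mu> (s * n)) * exp (\<beta> / s * Re \<eta>)"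
      by (simp add: power_mult power_mult_distrib)
    finally show ?thesis .
  qed
  moreover have "1 * 1 \<le> B * b" using CB(2) cb(2) by (intro mult_mono) auto
  hence "(B * b) ^ s \<ge> 1" by (simp add: one_le_power)
  moreover have "\<beta> / s > 0" using \<beta>(1) s by simp
  ultimately show ?thesis using that[of "\<beta> / s" "C * c"] CB(1) cb(1) by simp
qed

lemma ramified_series:
  assumes s: "s \<ge> 1" and n: "n \<ge> 1"
  obtains R where "\<And>\<eta>. R < Re \<eta> \<Longrightarrow> 0 < Im \<eta> \<Longrightarrow> Im \<eta> < 2 * pi \<Longrightarrow>
    (\<lambda>q. exp (- (of_nat q * \<eta>)) * (\<mu> (s * (q + n)) / \<mu> (s * q))) sums ramified s (s * n) \<eta>"
proof -
  define k where "k = s * n"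
  have k: "k \<ge> 1" using s n unfolding k_def by (cases s; cases n) auto
  obtain R where R: "\<And>\<eta>. R < Re \<eta> \<Longrightarrow> 0 < Im \<eta> \<Longrightarrow> Im \<eta> < 2 * pi \<Longrightarrow>
    (\<lambda>p. exp (- (of_nat p * \<eta>)) * (\<mu> (p + k) / \<mu> p)) sums \<kappa> k \<eta>"
    by (rule \<kappa>_series[OF k], rule that)
  have "(\<lambda>q. exp (- (of_nat q * \<eta>)) * (\<mu> (s * (q + n)) / \<mu> (s * q))) sums ramified s (s * n) \<eta>"
    if \<eta>: "s * R < Re \<eta>" "0 < Im \<eta>" "Im \<eta> < 2 * pi" for \<eta>
  proof -
    define \<eta>' where "\<eta>' j = (\<eta> + 2 * of_real pi * \<i> * of_nat j) / of_nat s" for j :: nat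
    define c where "c p = \<mu> (p + k) / \<mu> p" for p
    have "(\<lambda>p. exp (- (of_nat p * \<eta>' j)) * c p) sums \<kappa> k (\<eta>' j)" if "j < s" for j
      unfolding c_def \<eta>'_def
      by (rule R) (use Im_ramified(1)[OF s that, of 0 \<eta>] \<eta> s in \<open>auto simp: Re_ramified field_simps\<close>)
    hence "(\<lambda>p. (\<Sum>j<s. exp (- (of_nat p * \<eta>' j)) * c p)) sums (\<Sum>j<s. \<kappa> k (\<eta>' j))"
      by (intro sums_sum) auto
    hence "(\<lambda>p. (\<Sum>j<s. exp (- (of_nat p * \<eta>' j)) * c p) / of_nat s) sums ramified s k \<eta>"
      unfolding ramified_def \<eta>'_def by (rule sums_divide)
    moreover have "(\<Sum>j<s. exp (- (of_nat p * \<eta>' j)) * c p) / of_nat s =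
        (if s dvd p then exp (- (of_nat p * \<eta> / of_nat s)) * c p else 0)" for p
    proof -
      have "exp (- (of_nat p * \<eta>' j)) = exp (- (of_nat p * \<eta> / of_nat s)) *
          exp (- (of_nat p * (2 * of_real pi * \<i> * of_nat j / of_nat s)))" for j
        unfolding \<eta>'_def exp_add[symmetric] by (rule arg_cong[of _ _ exp]) (simp add: add_divide_distrib algebra_simps)
      hence "(\<Sum>j<s. exp (- (of_nat p * \<eta>' j)) * c p) = exp (- (of_nat p * \<eta> / of_nat s)) * c p *
          (\<Sum>j<s. exp (- (of_nat p * (2 * of_real pi * \<i> * of_nat j / of_nat s))))"
        by (simp add: sum_distrib_left mult_ac)
      thus ?thesis unfolding sum_roots_of_unity_powers[OF s] using s by simp
    qed
    ultimately have "(\<lambda>p. if s dvd p then exp (- (of_nat p * \<eta> / of_nat s)) * c p else 0) sums ramified s k \<eta>"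
      by simp
    \<comment> \<open>Only multiples of \<open>s\<close> survive the averaging, and the series is
      reindexed by them.\<close>
    moreover have "strict_mono (\<lambda>q. s * q)" using s by (simp add: strict_mono_def)
    ultimately have "(\<lambda>q. if s dvd s * q then exp (- (of_nat (s * q) * \<eta> / of_nat s)) * c (s * q) else 0) sums ramified s k \<eta>"
      by (subst sums_mono_reindex[where g = "\<lambda>q. s * q"]) auto
    thus ?thesis using s by (simp add: c_def k_def algebra_simps)
  qed
  thus ?thesis using that by blast
qed

end

section \<open>Kernel weights on the boundary of the half strip\<close>

lemma power_series_integral:
  fixes c :: "nat \<Rightarrow> complex"
  assumes c: "\<And>p. cmod (c p) \<le> C * exp (\<delta>' * real p)" and \<delta>: "\<delta>' < \<delta>"
  shows "integral {b..b + 2 * pi} (\<lambda>y. exp (of_nat j * Complex \<delta> y) * (\<Sum>p. exp (- (of_nat p * Complex \<delta> y)) * c p))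
    = 2 * of_real pi * c j"
proof -
  define f where "f p y = exp (of_nat j * Complex \<delta> y) * (exp (- (of_nat p * Complex \<delta> y)) * c p)" for p y
  have cont: "continuous_on A (f p)" for A p
    unfolding f_def Complex_eq by (intro continuous_intros)
  have fe: "f p y = exp (of_real ((real j - real p) * \<delta>)) * c p * exp (\<i> * of_int (int j - int p) * of_real y)" for p y
  proof -
    have "exp (of_nat j * Complex \<delta> y) * exp (- (of_nat p * Complex \<delta> y)) =
        exp (of_real ((real j - real p) * \<delta>)) * exp (\<i> * of_int (int j - int p) * of_real y)"
      unfolding exp_add[symmetric] by (rule arg_cong[of _ _ exp]) (simp add: complex_eq_iff algebra_simps)
    thus ?thesis by (simp add: f_def mult_ac)
  qed
  \<comment> \<open>Orthogonality of the exponentials over a period: only the term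
    \<open>p = j\<close> has a nonzero integral.\<close>
  have int: "(f p has_integral (if p = j then 2 * of_real pi * c j else 0)) {b..b + 2 * pi}" for p
  proof (cases "p = j")
    case True
    have "((\<lambda>y. c j) has_integral (b + 2 * pi - b) *\<^sub>R c j) {b..b + 2 * pi}"
      using has_integral_const_real[of "c j" b "b + 2 * pi"] by simp
    moreover have "f p = (\<lambda>y. c j)" unfolding fe using True by (simp add: fun_eq_iff)
    ultimately show ?thesis using True by (simp add: scaleR_conv_of_real)
  next
    case False
    define l where "l = \<i> * of_int (int j - int p)"
    have l: "l \<noteq> 0" using False by (simp add: l_def)
    have "((\<lambda>y. exp (l * of_real y)) has_integral (exp (l * of_real (b + 2 * pi)) / l - exp (l * of_real b) / l)) {b..b + 2 * pi}"
    proof (rule fundamental_theorem_of_calculus)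
      fix y assume "y \<in> {b..b + 2 * pi}"
      have "((\<lambda>z. exp (l * z) / l) has_field_derivative exp (l * of_real y)) (at (of_real y))"
        using l by (auto intro!: derivative_eq_intros)
      thus "((\<lambda>y. exp (l * of_real y) / l) has_vector_derivative exp (l * of_real y)) (at y within {b..b + 2 * pi})"
        using has_vector_derivative_real_field has_vector_derivative_at_within by fastforce
    qed simp
    moreover have "exp (l * of_real (b + 2 * pi)) = exp (l * of_real b)"
    proof -
      have "exp (l * of_real (b + 2 * pi)) = exp (l * of_real b) * exp (2 * of_int (int j - int p) * of_real pi * \<i>)"
        unfolding exp_add[symmetric] by (rule arg_cong[of _ _ exp]) (simp add: l_def algebra_simps)
      thus ?thesis using exp_integer_2pi[of "of_int (int j - int p)"] by (simp add: mult_ac)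
    qed
    ultimately have "((\<lambda>y. exp (l * of_real y)) has_integral 0) {b..b + 2 * pi}" by simp
    from has_integral_mult_right[OF this, of "exp (of_real ((real j - real p) * \<delta>)) * c p"]
    show ?thesis using False unfolding fe[abs_def] l_def by simp
  qed
  have bound: "cmod (f p y) \<le> exp (real j * \<delta>) * C * exp (\<delta>' - \<delta>) ^ p" for p y
  proof -
    have "cmod (f p y) = exp ((real j - real p) * \<delta>) * cmod (c p)"
      unfolding fe by (simp add: norm_mult norm_exp_eq_Re)
    also have "\<dots> \<le> exp ((real j - real p) * \<delta>) * (C * exp (\<delta>' * real p))" by (intro mult_left_mono c) simp
    also have "\<dots> = exp (real j * \<delta>) * C * exp (\<delta>' - \<delta>) ^ p"
      by (simp add: algebra_simps flip: exp_add exp_of_nat_mult)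
    finally show ?thesis .
  qed
  have sm: "summable (\<lambda>p. exp (real j * \<delta>) * C * exp (\<delta>' - \<delta>) ^ p)"
    by (intro summable_mult summable_geometric) (use \<delta> in simp)
  \<comment> \<open>On the line of real part \<delta> the terms are dominated by powers of
    \<open>exp (\<delta>' - \<delta>) < 1\<close>, so sum and integral are exchanged by uniform
    convergence.\<close>
  have ul: "uniform_limit {b..b + 2 * pi} (\<lambda>n y. \<Sum>p<n. f p y) (\<lambda>y. \<Sum>p. f p y) sequentially"
    by (rule Weierstrass_m_test[OF bound sm])
  obtain I J where IJ: "\<And>n. ((\<lambda>y. \<Sum>p<n. f p y) has_integral I n) {b..b + 2 * pi}"
    "((\<lambda>y. \<Sum>p. f p y) has_integral J) {b..b + 2 * pi}" "I \<longlonglongrightarrow> J"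
    by (rule uniform_limit_integral[OF ul]) (auto intro!: continuous_intros cont)
  have "((\<lambda>y. \<Sum>p<n. f p y) has_integral (\<Sum>p<n. if p = j then 2 * of_real pi * c j else 0)) {b..b + 2 * pi}" for n
    by (intro has_integral_sum int) auto
  hence I: "I n = (\<Sum>p<n. if p = j then 2 * of_real pi * c j else 0)" for n
    using IJ(1) has_integral_unique by blast
  have "\<forall>\<^sub>F n in sequentially. I n = 2 * of_real pi * c j"
    using eventually_gt_at_top[of j] by eventually_elim (simp add: I)
  hence "J = 2 * of_real pi * c j"
    by (intro LIMSEQ_unique[OF IJ(3)] tendsto_eventually)
  moreover have "(\<Sum>p. f p y) = exp (of_nat j * Complex \<delta> y) * (\<Sum>p. exp (- (of_nat p * Complex \<delta> y)) * c p)" for y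
  proof -
    have "cmod (c p) \<le> C * exp \<delta>' ^ p" for p using c[of p] by (simp add: mult.commute flip: exp_of_nat_mult)
    hence "summable (\<lambda>p. exp (- (of_nat p * Complex \<delta> y)) * c p)"
      using exp_series_geometric(1)[of c C "exp \<delta>'" "Complex \<delta> y"] \<delta> by simp
    thus ?thesis unfolding f_def by (rule suminf_mult)
  qed
  ultimately show ?thesis using IJ(2) by (simp add: integral_unique)
qed

text \<open>Integrating \<open>exp (j * \<eta>)\<close> times the kernel series over a period on
  \<open>Re \<eta> = \<delta>\<close> extracts the coefficient \<open>j\<close>. The piece from
  \<delta> to \<open>2 * pi - \<delta>\<close> is moved by Cauchy's theorem onto the rays at these
  two heights, where the continued kernel gives \<open>k3\<close> and \<open>k1\<close>; periodicity
  of \<open>exp (j * \<eta>)\<close> lets the upper ray be read at height \<open>- \<delta>\<close>.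
  The rest of the period is the right side of the half strip, with weight \<open>k2\<close>.\<close>

lemma kernel_weights:
  assumes m: "moment_sequence m" and \<delta>: "0 < \<delta>" "\<delta> < pi"
  obtains \<gamma> C B where "\<gamma> > 0" "C > 0" "B \<ge> 1"
    "\<And>n. n \<ge> 1 \<Longrightarrow> \<exists>k1 k2 k3 :: real \<Rightarrow> complex.
       continuous_on {..\<delta>} k1 \<and> continuous_on {-\<delta>..\<delta>} k2 \<and> continuous_on {..\<delta>} k3 \<and>
       (\<forall>x\<le>\<delta>. cmod (k1 x) \<le> C * B ^ n * m n * exp (\<gamma> * x)) \<and>
       (\<forall>y\<in>{-\<delta>..\<delta>}. cmod (k2 y) \<le> C * B ^ n * m n) \<and>
       (\<forall>x\<le>\<delta>. cmod (k3 x) \<le> C * B ^ n * m n * exp (\<gamma> * x)) \<and>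
       (\<forall>j. integral {..\<delta>} (\<lambda>x. k1 x * exp (of_nat j * Complex x (- \<delta>)))
          + integral {-\<delta>..\<delta>} (\<lambda>y. k2 y * exp (of_nat j * Complex \<delta> y))
          + integral {..\<delta>} (\<lambda>x. k3 x * exp (of_nat j * Complex x \<delta>)) = of_real (m (j + n) / m j))"
proof -
  obtain N e E s where s: "1 \<le> (s::nat)" and N: "strongly_regular N" "omega N < 2" "kernel_pair N e E"
    and mm: "\<And>p. complex_of_real (m p) = kernel_moment e (of_nat (s * p))" and sr: "strongly_regular m"
    using m unfolding moment_sequence_def by blast
  interpret kernel_setup N e E by unfold_locales (fact N)+
  have m\<mu>: "\<mu> (s * p) = of_real (m p)" for p by (simp add: \<mu>_def mm)
  note pos = strongly_regular_pos[OF sr]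
  obtain \<gamma> C B where gCB: "\<gamma> > 0" "C > 0" "B \<ge> 1"
    "\<And>n \<eta>. n \<ge> 1 \<Longrightarrow> \<delta> \<le> Im \<eta> \<Longrightarrow> Im \<eta> \<le> 2 * pi - \<delta> \<Longrightarrow>
       cmod (ramified s (s * n) \<eta>) \<le> C * B ^ n * cmod (\<mu> (s * n)) * exp (\<gamma> * Re \<eta>)"
    by (rule ramified_bound[OF s \<delta>(1)], rule that)
  \<comment> \<open>Growth of the coefficients at rate \<open>\<delta> / 2\<close> makes their
    series converge on \<open>Re \<eta> = \<delta>\<close>, with a bound of the form
    \<open>C2 ^ n * m n\<close> up to a constant.\<close>
  have "\<delta> / 2 > 0" using \<delta> by simp
  then obtain C2 where C2: "C2 \<ge> 1" "\<And>p n. m (p + n) / m p \<le> C2 ^ n * exp (\<delta> / 2 * real p) * m n"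
    using strongly_regular_quotient_le[OF sr] by metis
  define D where "D = 1 / (1 - exp (\<delta> / 2) * exp (- \<delta>))"
  have "exp (\<delta> / 2) * exp (- \<delta>) < 1" using \<delta> by (simp flip: exp_add)
  hence D: "D > 0" by (simp add: D_def)
  define C' where "C' = C + D"
  define B' where "B' = max B C2"
  have C': "C' > 0" "B' \<ge> 1" using gCB D by (auto simp: C'_def B'_def)
  have "\<exists>k1 k2 k3 :: real \<Rightarrow> complex.
       continuous_on {..\<delta>} k1 \<and> continuous_on {-\<delta>..\<delta>} k2 \<and> continuous_on {..\<delta>} k3 \<and>
       (\<forall>x\<le>\<delta>. cmod (k1 x) \<le> C' * B' ^ n * m n * exp (\<gamma> * x)) \<and>
       (\<forall>y\<in>{-\<delta>..\<delta>}. cmod (k2 y) \<le> C' * B' ^ n * m n) \<and>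
       (\<forall>x\<le>\<delta>. cmod (k3 x) \<le> C' * B' ^ n * m n * exp (\<gamma> * x)) \<and>
       (\<forall>j. integral {..\<delta>} (\<lambda>x. k1 x * exp (of_nat j * Complex x (- \<delta>)))
          + integral {-\<delta>..\<delta>} (\<lambda>y. k2 y * exp (of_nat j * Complex \<delta> y))
          + integral {..\<delta>} (\<lambda>x. k3 x * exp (of_nat j * Complex x \<delta>)) = of_real (m (j + n) / m j))"
    if n: "n \<ge> 1" for n
  proof -
    define K where "K = ramified s (s * n)"
    define c where "c p = complex_of_real (m (p + n) / m p)" for p
    define Q where "Q \<eta> = (\<Sum>p. exp (- (of_nat p * \<eta>)) * c p)" for \<eta>
    define W where "W = {\<eta>. 0 < Im \<eta> \<and> Im \<eta> < 2 * pi}"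
    have W: "open W" "convex W"
    proof -
      have *: "W = {\<eta>. Im \<eta> > 0} \<inter> {\<eta>. Im \<eta> < 2 * pi}" by (auto simp: W_def)
      show "open W" "convex W" unfolding *
        by (intro open_Int open_halfspace_Im_gt open_halfspace_Im_lt convex_Int convex_halfspace_Im_gt convex_halfspace_Im_lt)+
    qed
    have "s * n \<ge> 1" using s n by (cases s; cases n) auto
    hence Kh: "K holomorphic_on W" unfolding K_def W_def by (rule ramified_holo[OF s])
    \<comment> \<open>Every positive rate is possible once \<open>n\<close> is fixed, which makes
      the series \<open>Q\<close> holomorphic on the whole right half plane.\<close>
    have cb: "\<exists>C\<ge>0. \<forall>p. cmod (c p) \<le> C * exp \<delta>' ^ p" if "\<delta>' > 0" for \<delta>'
    proof -
      obtain C where "C \<ge> 1" "\<And>p n. m (p + n) / m p \<le> C ^ n * exp (\<delta>' * real p) * m n"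
        using strongly_regular_quotient_le[OF sr \<open>\<delta>' > 0\<close>] by metis
      moreover have "exp (\<delta>' * real p) = exp \<delta>' ^ p" for p by (simp add: mult.commute flip: exp_of_nat_mult)
      ultimately show ?thesis
        using pos by (intro exI[of _ "C ^ n * m n"]) (auto simp: c_def norm_divide less_imp_le mult_ac)
    qed
    have Qh: "Q holomorphic_on {\<eta>. 0 < Re \<eta>}"
    proof -
      have "Q holomorphic_on (\<Union>\<delta>'\<in>{0<..}. {\<eta>. \<delta>' < Re \<eta>})"
      proof (rule holomorphic_on_UN_open)
        fix \<delta>' :: real assume d: "\<delta>' \<in> {0<..}"
        then obtain C where "\<And>p. cmod (c p) \<le> C * exp \<delta>' ^ p" using cb by auto
        from exp_series_geometric(3)[of c C "exp \<delta>'", OF this]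
        show "Q holomorphic_on {\<eta>. \<delta>' < Re \<eta>}" unfolding Q_def by simp
      qed (rule open_halfspace_Re_gt)
      moreover have "(\<Union>\<delta>'\<in>{0<..}. {\<eta>. \<delta>' < Re \<eta>}) = {\<eta>. 0 < Re \<eta>}"
      proof (intro set_eqI iffI)
        fix \<eta> :: complex assume "\<eta> \<in> {\<eta>. 0 < Re \<eta>}"
        thus "\<eta> \<in> (\<Union>\<delta>'\<in>{0<..}. {\<eta>. \<delta>' < Re \<eta>})" by (intro UN_I[of "Re \<eta> / 2"]) auto
      qed auto
      ultimately show ?thesis by simp
    qed
    obtain R where R: "\<And>\<eta>. R < Re \<eta> \<Longrightarrow> 0 < Im \<eta> \<Longrightarrow> Im \<eta> < 2 * pi \<Longrightarrow>
      (\<lambda>q. exp (- (of_nat q * \<eta>)) * (\<mu> (s * (q + n)) / \<mu> (s * q))) sums K \<eta>"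
      by (rule ramified_series[OF s n, folded K_def], rule that)
    \<comment> \<open>The series is known to represent \<open>K\<close> only for large real parts;
      the identity theorem extends this to all positive ones, in particular to \<delta>.\<close>
    have KQ: "K \<eta> = Q \<eta>" if \<eta>: "0 < Re \<eta>" "0 < Im \<eta>" "Im \<eta> < 2 * pi" for \<eta>
    proof (rule analytic_continuation_open[where f = K and g = Q and z = \<eta> and
          s = "{\<eta>. max R 0 < Re \<eta> \<and> 0 < Im \<eta> \<and> Im \<eta> < 2 * pi}" and
          s' = "{\<eta>. 0 < Re \<eta> \<and> 0 < Im \<eta> \<and> Im \<eta> < 2 * pi}"])
      show "open {\<eta>. max R 0 < Re \<eta> \<and> 0 < Im \<eta> \<and> Im \<eta> < 2 * pi}"
        "open {\<eta>. 0 < Re \<eta> \<and> 0 < Im \<eta> \<and> Im \<eta> < 2 * pi}"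
        "connected {\<eta>. 0 < Re \<eta> \<and> 0 < Im \<eta> \<and> Im \<eta> < 2 * pi}"
        by (rule strip_open_connected)+
      have "Complex (max R 0 + 1) pi \<in> {\<eta>. max R 0 < Re \<eta> \<and> 0 < Im \<eta> \<and> Im \<eta> < 2 * pi}" by (simp add: max_def)
      thus "{\<eta>. max R 0 < Re \<eta> \<and> 0 < Im \<eta> \<and> Im \<eta> < 2 * pi} \<noteq> {}" by blast
      show "K holomorphic_on {\<eta>. 0 < Re \<eta> \<and> 0 < Im \<eta> \<and> Im \<eta> < 2 * pi}"
        by (rule holomorphic_on_subset[OF Kh]) (auto simp: W_def)
      show "Q holomorphic_on {\<eta>. 0 < Re \<eta> \<and> 0 < Im \<eta> \<and> Im \<eta> < 2 * pi}"
        by (rule holomorphic_on_subset[OF Qh]) auto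
      show "K z = Q z" if "z \<in> {\<eta>. max R 0 < Re \<eta> \<and> 0 < Im \<eta> \<and> Im \<eta> < 2 * pi}" for z
        using R[of z] that by (simp add: Q_def c_def m\<mu> sums_iff)
    qed (use \<eta> in auto)
    define k1 where "k1 x = K (Complex x (2 * pi - \<delta>)) / (2 * of_real pi * \<i>)" for x
    define k2 where "k2 y = Q (Complex \<delta> y) / (2 * of_real pi)" for y
    define k3 where "k3 x = - K (Complex x \<delta>) / (2 * of_real pi * \<i>)" for x
    have cC: "continuous_on A (\<lambda>x. Complex x y)" "continuous_on A (\<lambda>y. Complex x y)" for A x y
      unfolding Complex_eq by (intro continuous_intros)+
    have Kc: "continuous_on A (\<lambda>x. K (Complex x y))" if "0 < y" "y < 2 * pi" for A y
      by (rule continuous_on_compose2[OF holomorphic_on_imp_continuous_on[OF Kh] cC(1)]) (use that in \<open>auto simp: W_def\<close>)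
    have Qc: "continuous_on A (\<lambda>y. Q (Complex \<delta> y))" for A
      by (rule continuous_on_compose2[OF holomorphic_on_imp_continuous_on[OF Qh] cC(2)]) (use \<delta> in auto)
    have Kb: "cmod (K (Complex x y)) \<le> C * B ^ n * m n * exp (\<gamma> * x)" if "\<delta> \<le> y" "y \<le> 2 * pi - \<delta>" for x y
      using gCB(4)[OF n, of "Complex x y"] that pos[of n] unfolding K_def m\<mu> by simp
    have CBn: "C * B ^ n * m n \<le> C' * B' ^ n * m n"
      using gCB(2,3) D pos[of n] by (intro mult_right_mono mult_mono power_mono) (auto simp: C'_def B'_def)
    have two_pi: "z / (2 * pi) \<le> z" if "z \<ge> 0" for z :: real
      using that pi_gt3 by (simp add: divide_le_eq mult_le_cancel_left1)
    have kb: "cmod (K (Complex x y) / (2 * of_real pi * \<i>)) \<le> C' * B' ^ n * m n * exp (\<gamma> * x)"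
      if "\<delta> \<le> y" "y \<le> 2 * pi - \<delta>" for x y
    proof -
      have "cmod (K (Complex x y) / (2 * of_real pi * \<i>)) \<le> cmod (K (Complex x y))"
        using two_pi by (simp add: norm_divide norm_mult)
      also have "\<dots> \<le> C' * B' ^ n * m n * exp (\<gamma> * x)"
        using Kb[OF that, of x] mult_right_mono[OF CBn, of "exp (\<gamma> * x)"] by simp
      finally show ?thesis .
    qed
    have ident: "integral {..\<delta>} (\<lambda>x. k1 x * exp (of_nat j * Complex x (- \<delta>)))
          + integral {-\<delta>..\<delta>} (\<lambda>y. k2 y * exp (of_nat j * Complex \<delta> y))
          + integral {..\<delta>} (\<lambda>x. k3 x * exp (of_nat j * Complex x \<delta>)) = of_real (m (j + n) / m j)" for j
    proof -
      define f where "f \<eta> = exp (of_nat j * \<eta>) * K \<eta>" for \<eta>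
      have fh: "f holomorphic_on W" unfolding f_def by (intro holomorphic_intros Kh)
      have fb: "cmod (f (Complex x y)) \<le> (exp (real j * \<delta>) * (C * B ^ n * m n)) * exp (\<gamma> * x)"
        if "x \<le> \<delta>" "\<delta> \<le> y" "y \<le> 2 * pi - \<delta>" for x y
      proof -
        have "cmod (f (Complex x y)) = exp (real j * x) * cmod (K (Complex x y))"
          by (simp add: f_def norm_mult)
        also have "\<dots> \<le> exp (real j * \<delta>) * (C * B ^ n * m n * exp (\<gamma> * x))"
          by (intro mult_mono Kb) (use that in \<open>auto intro: mult_left_mono\<close>)
        finally show ?thesis by (simp add: mult_ac)
      qed
      have fi: "(\<lambda>x. f (Complex x y)) integrable_on {..\<delta>}" if "\<delta> \<le> y" "y \<le> 2 * pi - \<delta>" for y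
      proof (rule integrable_dominated_continuous)
        show "continuous_on {..\<delta>} (\<lambda>x. f (Complex x y))"
          unfolding f_def using that \<delta> by (intro continuous_intros cC Kc) auto
        show "(\<lambda>x. (exp (real j * \<delta>) * (C * B ^ n * m n)) * exp (\<gamma> * x)) integrable_on {..\<delta>}"
          by (intro integrable_on_mult_right integrable_exp_atMost gCB)
      qed (use fb that in \<open>auto simp: is_interval_ic\<close>)
      have strip: "integral {..\<delta>} (\<lambda>x. f (Complex x (2 * pi - \<delta>))) - integral {..\<delta>} (\<lambda>x. f (Complex x \<delta>))
          = \<i> * integral {\<delta>..2 * pi - \<delta>} (\<lambda>y. f (Complex \<delta> y))"
        by (rule Cauchy_half_strip[OF W fh _ gCB(1) _ fb]) (use \<delta> fi in \<open>auto simp: W_def\<close>)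
      define g where "g y = exp (of_nat j * Complex \<delta> y) * Q (Complex \<delta> y)" for y
      have gi: "g integrable_on {a..b}" for a b
        unfolding g_def by (intro integrable_continuous_interval continuous_intros cC Qc)
      have J1: "integral {..\<delta>} (\<lambda>x. k1 x * exp (of_nat j * Complex x (- \<delta>))) =
          integral {..\<delta>} (\<lambda>x. f (Complex x (2 * pi - \<delta>))) / (2 * of_real pi * \<i>)"
      proof -
        have "k1 x * exp (of_nat j * Complex x (- \<delta>)) = f (Complex x (2 * pi - \<delta>)) / (2 * of_real pi * \<i>)" for x
        proof -
          have "exp (of_nat j * Complex x (2 * pi - \<delta>)) = exp (of_nat j * Complex x (- \<delta>)) * exp (2 * of_nat j * of_real pi * \<i>)"
            unfolding exp_add[symmetric] by (rule arg_cong[of _ _ exp]) (simp add: complex_eq_iff algebra_simps)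
          hence "exp (of_nat j * Complex x (2 * pi - \<delta>)) = exp (of_nat j * Complex x (- \<delta>))"
            using exp_integer_2pi[of "of_nat j"] by (simp add: mult_ac)
          thus ?thesis by (simp add: k1_def f_def)
        qed
        thus ?thesis by simp
      qed
      have J3: "integral {..\<delta>} (\<lambda>x. k3 x * exp (of_nat j * Complex x \<delta>)) =
          - integral {..\<delta>} (\<lambda>x. f (Complex x \<delta>)) / (2 * of_real pi * \<i>)"
      proof -
        have "k3 x * exp (of_nat j * Complex x \<delta>) = - (f (Complex x \<delta>) / (2 * of_real pi * \<i>))" for x
          by (simp add: k3_def f_def)
        thus ?thesis by simp
      qed
      have J2: "integral {-\<delta>..\<delta>} (\<lambda>y. k2 y * exp (of_nat j * Complex \<delta> y)) = integral {-\<delta>..\<delta>} g / (2 * of_real pi)"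
      proof -
        have "k2 y * exp (of_nat j * Complex \<delta> y) = g y / (2 * of_real pi)" for y
          by (simp add: k2_def g_def)
        thus ?thesis by simp
      qed
      have fg: "integral {\<delta>..2 * pi - \<delta>} (\<lambda>y. f (Complex \<delta> y)) = integral {\<delta>..2 * pi - \<delta>} g"
        by (rule Henstock_Kurzweil_Integration.integral_cong) (use KQ \<delta> in \<open>simp add: f_def g_def\<close>)
      have "integral {-\<delta>..\<delta>} g + integral {\<delta>..2 * pi - \<delta>} g = integral {-\<delta>..2 * pi - \<delta>} g"
        by (rule Henstock_Kurzweil_Integration.integral_combine) (use \<delta> gi in auto)
      also have "\<dots> = integral {-\<delta>..-\<delta> + 2 * pi} g" by (simp add: algebra_simps)
      also have "\<dots> = 2 * of_real pi * c j"
        unfolding g_def Q_def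
      proof (rule power_series_integral)
        show "cmod (c p) \<le> (C2 ^ n * m n) * exp (\<delta> / 2 * real p)" for p
          using C2(2)[of p n] pos by (simp add: c_def norm_divide less_imp_le mult_ac)
      qed (use \<delta> in simp)
      finally have 1: "integral {-\<delta>..\<delta>} g + integral {\<delta>..2 * pi - \<delta>} g = 2 * of_real pi * c j" .
      have 2: "integral {..\<delta>} (\<lambda>x. f (Complex x (2 * pi - \<delta>))) / (2 * of_real pi * \<i>)
          + - integral {..\<delta>} (\<lambda>x. f (Complex x \<delta>)) / (2 * of_real pi * \<i>)
          = integral {\<delta>..2 * pi - \<delta>} g / (2 * of_real pi)"
        using strip unfolding fg by (simp add: field_simps)
      have "integral {..\<delta>} (\<lambda>x. f (Complex x (2 * pi - \<delta>))) / (2 * of_real pi * \<i>)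
          + integral {-\<delta>..\<delta>} g / (2 * of_real pi) + - integral {..\<delta>} (\<lambda>x. f (Complex x \<delta>)) / (2 * of_real pi * \<i>)
          = integral {-\<delta>..\<delta>} g / (2 * of_real pi) + integral {\<delta>..2 * pi - \<delta>} g / (2 * of_real pi)"
        unfolding 2[symmetric] by simp
      also have "\<dots> = (2 * of_real pi * c j) / (2 * of_real pi)"
        unfolding 1[symmetric] by (rule add_divide_distrib[symmetric])
      finally show ?thesis unfolding J1 J2 J3 by (simp add: c_def)
    qed
    have Qb: "cmod (Q (Complex \<delta> y)) \<le> C' * B' ^ n * m n" for y
    proof -
      have "cmod (c p) \<le> (C2 ^ n * m n) * exp (\<delta> / 2) ^ p" for p
        using C2(2)[of p n] pos by (simp add: c_def norm_divide less_imp_le mult_ac flip: exp_of_nat_mult)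
      from exp_series_geometric(2)[of c, OF this, of "Complex \<delta> y"] \<delta>
      have "cmod (Q (Complex \<delta> y)) \<le> (C2 ^ n * m n) * D" by (simp add: Q_def D_def)
      also have "\<dots> \<le> C' * B' ^ n * m n"
      proof -
        have "D * C2 ^ n * m n \<le> C' * B' ^ n * m n"
          using gCB(2) C2(1) D pos[of n] by (intro mult_right_mono mult_mono power_mono) (auto simp: C'_def B'_def)
        thus ?thesis by (simp add: mult_ac)
      qed
      finally show ?thesis .
    qed
    show ?thesis
    proof (rule exI[of _ k1], rule exI[of _ k2], rule exI[of _ k3], intro conjI allI ballI impI ident)
      show "continuous_on {..\<delta>} k1" "continuous_on {..\<delta>} k3" "continuous_on {-\<delta>..\<delta>} k2"
        unfolding k1_def k2_def k3_def using \<delta> by (intro continuous_intros Kc Qc; simp)+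
      show "cmod (k1 x) \<le> C' * B' ^ n * m n * exp (\<gamma> * x)" for x unfolding k1_def by (rule kb) (use \<delta> in auto)
      show "cmod (k3 x) \<le> C' * B' ^ n * m n * exp (\<gamma> * x)" for x
        unfolding k3_def using kb[of \<delta> x] \<delta> by (simp add: norm_divide)
      show "cmod (k2 y) \<le> C' * B' ^ n * m n" for y
        unfolding k2_def using order_trans[OF two_pi Qb[of y]] by (simp add: norm_divide norm_mult)
    qed
  qed
  thus ?thesis using that[of \<gamma> C' B'] gCB(1) C' by blast
qed

section \<open>Uniqueness of sums\<close>

text \<open>The quotient differs from \<sigma> by a bounded multiple of \<open>1 / ln t\<close>, so
  the upper limit in \<open>rho\<close> is a limit. Watson's lemma relies on this, since it needs a
  lower bound for the associated function at all large arguments and not merely along a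
  sequence.\<close>

lemma proximate_order_limit:
  assumes "admits_nonzero_proximate_order M"
  obtains l where "l > 0" "((\<lambda>t. ln (assoc_fun M t) / ln t) \<longlongrightarrow> l) at_top" "omega M = 1 / l"
proof -
  obtain \<sigma> l A B where l: "l > 0" "(\<sigma> \<longlongrightarrow> l) at_top" and
    AB: "\<forall>\<^sub>F t in at_top. A \<le> ln t * (\<sigma> t - ln (assoc_fun M t) / ln t) \<and>
           ln t * (\<sigma> t - ln (assoc_fun M t) / ln t) \<le> B"
    using assms unfolding admits_nonzero_proximate_order_def by blast
  define q where "q t = ln (assoc_fun M t) / ln t" for t
  have "((\<lambda>t. \<sigma> t - q t) \<longlongrightarrow> 0) at_top"
  proof (rule Lim_null_comparison)
    show "((\<lambda>t::real. (\<bar>A\<bar> + \<bar>B\<bar>) / ln t) \<longlongrightarrow> 0) at_top"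
      by (rule tendsto_divide_0[OF tendsto_const filterlim_at_top_imp_at_infinity[OF ln_at_top]])
    show "\<forall>\<^sub>F t in at_top. norm (\<sigma> t - q t) \<le> (\<bar>A\<bar> + \<bar>B\<bar>) / ln t"
      using AB eventually_gt_at_top[of 1]
    proof eventually_elim
      case (elim t)
      have t: "ln t > 0" using elim by simp
      have "\<bar>ln t * (\<sigma> t - q t)\<bar> \<le> \<bar>A\<bar> + \<bar>B\<bar>" using elim unfolding q_def by (simp add: abs_le_iff) linarith
      thus ?case using t by (simp add: abs_mult le_divide_eq mult.commute)
    qed
  qed
  from tendsto_diff[OF l(2) this] have q: "(q \<longlongrightarrow> l) at_top" by simp
  have "rho M = ereal l"
    unfolding rho_def
  proof (rule lim_imp_Limsup)
    have "((\<lambda>t. max 0 (q t)) \<longlongrightarrow> max 0 l) at_top" by (intro tendsto_max q tendsto_const)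
    thus "((\<lambda>t. ereal (max 0 (ln (assoc_fun M t) / ln t))) \<longlongrightarrow> ereal l) at_top"
      using l(1) by (simp add: q_def max_absorb2 del: ereal_max)
  qed simp
  thus ?thesis using that[of l] l(1) q by (simp add: omega_def q_def[abs_def])
qed

lemma rdisc_eq: "r > 0 \<Longrightarrow> rdisc r = {w. Re w < ln r}"
  unfolding rdisc_def using exp_less_cancel_iff[of _ "ln r"] by simp

lemma sector_Int_rdisc:
  assumes "r > 0"
  shows "sector d \<theta> \<inter> rdisc r = {w. d - \<theta> / 2 < Im w} \<inter> {w. Im w < d + \<theta> / 2} \<inter> {w. Re w < ln r}"
proof -
  have "\<bar>Im w - d\<bar> < \<theta> / 2 \<longleftrightarrow> d - \<theta> / 2 < Im w \<and> Im w < d + \<theta> / 2" for w by linarith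
  thus ?thesis unfolding rdisc_eq[OF assms] sector_def by auto
qed

text \<open>
  In the chart, the sector of opening \<open>\<theta>0\<close> is a strip, on which \<open>exp (- (\<rho> * (w - \<i> * d)))\<close>
  with \<open>\<rho> = pi / \<theta>0\<close> has positive real part.  Multiplying \<open>D\<close> by
  \<open>exp (t * exp (- (\<rho> * (w - \<i> * d))))\<close> costs nothing on the horizontal sides and is absorbed by the
  decay of \<open>D\<close> at \<open>Re w \<longlonglongrightarrow> - \<infinity>\<close>, because \<open>\<rho>\<close> is less than the order of \<open>M\<close>.
\<close>

lemma Watson:
  fixes D :: "complex \<Rightarrow> complex"
  assumes M: "strongly_regular M" and prox: "admits_nonzero_proximate_order M"
    and \<theta>: "omega M * pi < \<theta>" and r: "r > 0"
    and D: "D holomorphic_on sector d \<theta> \<inter> rdisc r" and CA: "C > 0" "A > 0"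
    and le: "\<And>n w. n \<ge> 1 \<Longrightarrow> w \<in> sector d \<theta> \<inter> rdisc r \<Longrightarrow> cmod (D w) \<le> C * A ^ n * M n * exp (Re w) ^ n"
    and w: "w \<in> sector d \<theta> \<inter> rdisc r"
  shows "D w = 0"
proof -
  note pos = strongly_regular_pos[OF M]
  obtain l where l: "l > 0" "((\<lambda>t. ln (assoc_fun M t) / ln t) \<longlongrightarrow> l) at_top" "omega M = 1 / l"
    by (rule proximate_order_limit[OF prox], rule that)
  have "pi / l < \<theta>" using \<theta> l by simp
  \<comment> \<open>The opening \<theta>0 is strictly smaller than \<theta> but still above
    \<open>pi / l\<close>, so that \<open>\<rho> = pi / \<theta>0\<close> stays below the order
    \<open>l\<close>; \<rho>' keeps a gap on both sides.\<close>
  then obtain \<theta>0 where \<theta>0: "pi / l < \<theta>0" "\<theta>0 < \<theta>" using dense by blast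
  have "\<theta>0 > 0" using \<theta>0(1) l(1) by (meson divide_pos_pos less_trans pi_gt_zero)
  define \<rho> where "\<rho> = pi / \<theta>0"
  have \<rho>: "\<rho> > 0" "\<rho> < l" using \<open>\<theta>0 > 0\<close> \<theta>0(1) l(1) by (auto simp: \<rho>_def field_simps)
  obtain \<rho>' where \<rho>': "\<rho> < \<rho>'" "\<rho>' < l" using dense \<rho>(2) by blast
  define S where "S = sector d \<theta> \<inter> rdisc r"
  have S: "S = {w. d - \<theta> / 2 < Im w} \<inter> {w. Im w < d + \<theta> / 2} \<inter> {w. Re w < ln r}"
    unfolding S_def by (rule sector_Int_rdisc[OF r])
  have S_open: "open S" "connected S"
    unfolding S by (intro open_Int open_halfspace_Im_gt open_halfspace_Im_lt open_halfspace_Re_lt convex_connected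
        convex_Int convex_halfspace_Im_gt convex_halfspace_Im_lt convex_halfspace_Re_lt)+
  define x0 where "x0 = ln r - 1"
  \<comment> \<open>The second entry comes from \<open>n = 1\<close> and covers
    \<open>n = 0\<close>, for which no bound is assumed.\<close>
  define C' where "C' = max C (C * A * M 1 * r)"
  have C': "C' > 0" "C \<le> C'" using CA by (auto simp: C'_def)
  have small: "cmod (D w) \<le> C'" if "w \<in> S" for w
  proof -
    have "cmod (D w) \<le> C * A * M 1 * exp (Re w)" using le[of 1 w] that by (simp add: S_def)
    also have "\<dots> \<le> C * A * M 1 * r"
      using that CA pos[of 1] by (intro mult_left_mono) (auto simp: S_def rdisc_def)
    finally show ?thesis by (simp add: C'_def)
  qed
  have decay: "cmod (D w) \<le> C' * exp (- assoc_fun M (1 / (A * exp (Re w))))" if wS: "w \<in> S" for w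
  proof (cases "D w = 0")
    case False
    define t where "t = 1 / (A * exp (Re w))"
    have t: "t > 0" using CA by (simp add: t_def)
    have "t ^ n / M n \<le> C' / cmod (D w)" for n
    proof (cases "n \<ge> 1")
      case True
      have "cmod (D w) \<le> C * (A * exp (Re w)) ^ n * M n"
        using le[OF True, of w] wS by (simp add: S_def power_mult_distrib mult_ac)
      also have "\<dots> \<le> C' * (A * exp (Re w)) ^ n * M n"
        using C' CA pos[of n] by (intro mult_right_mono) auto
      finally have "cmod (D w) * t ^ n \<le> C' * M n"
        using CA by (simp add: t_def power_divide divide_le_eq power_mult_distrib mult_ac)
      thus ?thesis using False pos[of n] by (simp add: field_simps)
    next
      case n: False
      hence "n = 0" by simp
      thus ?thesis using small[OF wS] False by (simp add: strongly_regular_0[OF M] field_simps)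
    qed
    hence "exp (assoc_fun M t) \<le> C' / cmod (D w)" by (rule assoc_fun_props(3)[OF M t])
    thus ?thesis using False by (simp add: t_def exp_minus field_simps)
  qed (use C' in simp)
  have ev: "\<forall>\<^sub>F t in at_top. t powr \<rho>' \<le> assoc_fun M t"
    using order_tendstoD(1)[OF l(2) \<rho>'(2)] eventually_gt_at_top[of 1]
  proof eventually_elim
    case (elim t)
    have "ln t > 0" using elim by simp
    hence 1: "\<rho>' * ln t < ln (assoc_fun M t)" using elim by (simp add: less_divide_eq)
    have "0 \<le> \<rho>' * ln t" using \<rho> \<rho>' \<open>ln t > 0\<close> by simp
    hence "assoc_fun M t \<noteq> 0" using 1 by auto
    hence "assoc_fun M t > 0" using assoc_fun_props(2)[OF M, of t] elim by simp
    hence "exp (\<rho>' * ln t) < assoc_fun M t" using 1 by (metis exp_less_cancel_iff exp_ln)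
    thus ?case using elim by (simp add: powr_def)
  qed
  \<comment> \<open>\<open>C'\<close> and \<open>x0\<close> do not depend on \<open>a\<close>, so
    that \<open>a\<close> can tend to infinity afterwards.\<close>
  have bound: "cmod (D w) \<le> C' * exp (- (a * (exp (- (\<rho> * Re w)) - exp (- (\<rho> * x0)))))"
    if a: "a > 0" and w: "Im w = d" "Re w < x0" for a w
  proof -
    define \<phi> where "\<phi> v = exp (- (of_real \<rho> * (v - \<i> * of_real d)))" for v
    have Re\<phi>: "Re (\<phi> v) = exp (- (\<rho> * Re v)) * cos (\<rho> * (Im v - d))" for v
      by (simp add: \<phi>_def Re_exp)
    have "\<forall>\<^sub>F x in at_top. (exp x / A) powr \<rho>' \<le> assoc_fun M (exp x / A)"
    proof (rule eventually_compose_filterlim[OF ev])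
      have "filterlim (\<lambda>x::real. (1 / A) * exp x) at_top at_top"
        by (rule filterlim_tendsto_pos_mult_at_top[OF tendsto_const _ exp_at_top]) (use CA in simp)
      thus "filterlim (\<lambda>x::real. exp x / A) at_top at_top" by simp
    qed
    moreover have "\<forall>\<^sub>F x in at_top. a * A powr \<rho>' \<le> exp ((\<rho>' - \<rho>) * x)"
    proof -
      have "filterlim (\<lambda>x::real. exp ((\<rho>' - \<rho>) * x)) at_top at_top"
        by (rule filterlim_compose[OF exp_at_top], rule filterlim_tendsto_pos_mult_at_top[OF tendsto_const _ filterlim_ident])
          (use \<rho>' in simp)
      thus ?thesis by (simp add: filterlim_at_top)
    qed
    moreover have "\<forall>\<^sub>F x in at_top. - Re w < x \<and> - x0 < x"
      using eventually_gt_at_top[of "- Re w"] eventually_gt_at_top[of "- x0"] by eventually_elim simp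
    ultimately have "\<forall>\<^sub>F x in at_top. (exp x / A) powr \<rho>' \<le> assoc_fun M (exp x / A) \<and>
        a * A powr \<rho>' \<le> exp ((\<rho>' - \<rho>) * x) \<and> - Re w < x \<and> - x0 < x" by eventually_elim simp
    \<comment> \<open>\<open>X\<close> is chosen after \<open>a\<close>: on the side
      \<open>Re v = - X\<close> the decay of \<open>D\<close> has to outweigh
      \<open>exp (a * exp (\<rho> * X))\<close>, which \<open>\<rho> < \<rho>'\<close> makes
      possible.\<close>
    from eventually_happens'[OF trivial_limit_at_top_linorder this] obtain X where X: "(exp X / A) powr \<rho>' \<le> assoc_fun M (exp X / A)"
      "a * A powr \<rho>' \<le> exp ((\<rho>' - \<rho>) * X)" "- Re w < X" "- x0 < X"
      by blast
    have XM: "a * exp (\<rho> * X) \<le> assoc_fun M (exp X / A)"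
    proof -
      have "a * A powr \<rho>' * exp (\<rho> * X) \<le> exp ((\<rho>' - \<rho>) * X) * exp (\<rho> * X)"
        by (rule mult_right_mono[OF X(2)]) simp
      also have "\<dots> = exp X powr \<rho>'" by (simp add: powr_def algebra_simps flip: exp_add)
      finally have "a * exp (\<rho> * X) \<le> exp X powr \<rho>' / A powr \<rho>'"
        using CA by (simp add: le_divide_eq mult_ac)
      also have "\<dots> = (exp X / A) powr \<rho>'" using CA by (simp add: powr_divide)
      finally show ?thesis using X(1) by simp
    qed
    define R where "R = cbox (Complex (- X) (d - \<theta>0 / 2)) (Complex x0 (d + \<theta>0 / 2))"
    have R: "v \<in> R \<longleftrightarrow> - X \<le> Re v \<and> Re v \<le> x0 \<and> d - \<theta>0 / 2 \<le> Im v \<and> Im v \<le> d + \<theta>0 / 2" for v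
      by (auto simp: R_def in_cbox_complex_iff)
    have RS: "R \<subseteq> S" unfolding S using \<theta>0(2) by (auto simp: R x0_def)
    define h where "h v = D v * exp (of_real a * \<phi> v)" for v
    have "h holomorphic_on S"
      unfolding h_def \<phi>_def using D unfolding S_def[symmetric] by (intro holomorphic_intros)
    hence hR: "h holomorphic_on R" using RS holomorphic_on_subset by blast
    have nh: "cmod (h v) = cmod (D v) * exp (a * (exp (- (\<rho> * Re v)) * cos (\<rho> * (Im v - d))))" for v
      by (simp add: h_def norm_mult Re\<phi>)
    have "cmod (h w) \<le> C' * exp (a * exp (- (\<rho> * x0)))"
    proof (rule maximum_modulus_frontier[where f = h and S = R and \<xi> = w])
      show "h holomorphic_on interior R" by (rule holomorphic_on_subset[OF hR interior_subset])
      show "continuous_on (closure R) h"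
        using hR by (simp add: R_def holomorphic_on_imp_continuous_on closure_closed)
      show "bounded R" by (simp add: R_def)
      show "w \<in> R" unfolding R using w X \<open>\<theta>0 > 0\<close> by simp
      fix v assume "v \<in> frontier R"
      hence vR: "v \<in> R" and v: "Re v = - X \<or> Re v = x0 \<or> Im v = d - \<theta>0 / 2 \<or> Im v = d + \<theta>0 / 2"
        unfolding R_def frontier_cbox by (auto simp: in_cbox_complex_iff in_box_complex_iff)
      hence vS: "v \<in> S" using RS by blast
      have e1: "1 \<le> exp (a * exp (- (\<rho> * x0)))" using a by simp
      consider "Re v = - X" | "Re v = x0" | "\<bar>Im v - d\<bar> = \<theta>0 / 2"
        using v \<open>\<theta>0 > 0\<close> by (auto simp: abs_if)
      thus "cmod (h v) \<le> C' * exp (a * exp (- (\<rho> * x0)))"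
      proof cases
        case 1
        have "cmod (h v) \<le> (C' * exp (- assoc_fun M (exp X / A))) * exp (a * exp (\<rho> * X))"
          unfolding nh
        proof (intro mult_mono)
          show "cmod (D v) \<le> C' * exp (- assoc_fun M (exp X / A))"
            using decay[OF vS] 1 by (simp add: exp_minus field_simps)
          have "exp (- (\<rho> * Re v)) = exp (\<rho> * X)" using 1 by simp
          hence "exp (- (\<rho> * Re v)) * cos (\<rho> * (Im v - d)) \<le> exp (\<rho> * X) * 1"
            by (simp only:) (intro mult_left_mono; simp)
          thus "exp (a * (exp (- (\<rho> * Re v)) * cos (\<rho> * (Im v - d)))) \<le> exp (a * exp (\<rho> * X))"
            using a by simp
        qed (use C' in auto)
        also have "\<dots> = C' * exp (a * exp (\<rho> * X) - assoc_fun M (exp X / A))"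
          by (simp add: exp_diff exp_minus field_simps)
        also have "\<dots> \<le> C' * 1" using XM C' by (intro mult_left_mono) auto
        also have "\<dots> \<le> C' * exp (a * exp (- (\<rho> * x0)))" using e1 C' by (intro mult_left_mono) auto
        finally show ?thesis .
      next
        case 2
        have "exp (- (\<rho> * x0)) * cos (\<rho> * (Im v - d)) \<le> exp (- (\<rho> * x0)) * 1"
          by (intro mult_left_mono) auto
        thus ?thesis
          unfolding nh 2 using small[OF vS] C' a by (intro mult_mono) auto
      next
        case 3
        have "cos (\<rho> * (Im v - d)) = cos \<bar>\<rho> * (Im v - d)\<bar>" by simp
        also have "\<bar>\<rho> * (Im v - d)\<bar> = pi / 2" unfolding abs_mult 3 using \<open>\<theta>0 > 0\<close> by (simp add: \<rho>_def)
        finally have "cmod (h v) = cmod (D v)" unfolding nh by simp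
        also have "\<dots> \<le> C' * 1" using small[OF vS] by simp
        also have "\<dots> \<le> C' * exp (a * exp (- (\<rho> * x0)))" using e1 C' by (intro mult_left_mono) auto
        finally show ?thesis .
      qed
    qed
    hence "cmod (D w) * exp (a * exp (- (\<rho> * Re w))) \<le> C' * exp (a * exp (- (\<rho> * x0)))"
      unfolding nh using w(1) by simp
    hence "cmod (D w) \<le> C' * exp (a * exp (- (\<rho> * x0))) / exp (a * exp (- (\<rho> * Re w)))"
      by (simp add: le_divide_eq)
    also have "\<dots> = C' * exp (- (a * (exp (- (\<rho> * Re w)) - exp (- (\<rho> * x0)))))"
      by (simp only: right_diff_distrib minus_diff_eq exp_diff times_divide_eq_right)
    finally show ?thesis .
  qed
  have zero: "D w = 0" if w: "Im w = d" "Re w < x0" for w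
  proof -
    define b where "b = exp (- (\<rho> * Re w)) - exp (- (\<rho> * x0))"
    have b: "b > 0" using w \<rho>(1) by (simp add: b_def)
    have "((\<lambda>a. C' * exp (- (a * b))) \<longlongrightarrow> 0) at_top"
    proof (rule tendsto_mult_right_zero, rule filterlim_compose[OF exp_at_bot])
      have "filterlim (\<lambda>a. a * b) at_top at_top"
        by (rule filterlim_at_top_mult_tendsto_pos[OF tendsto_const b filterlim_ident])
      thus "filterlim (\<lambda>a. - (a * b)) at_bot at_top" by (simp add: filterlim_uminus_at_bot)
    qed
    moreover have "\<forall>\<^sub>F a in at_top. cmod (D w) \<le> C' * exp (- (a * b))"
      using eventually_gt_at_top[of 0] by eventually_elim (use bound w in \<open>simp add: b_def\<close>)
    ultimately have "cmod (D w) \<le> 0"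
      using tendsto_le[OF trivial_limit_at_top_linorder _ tendsto_const] by blast
    thus ?thesis by simp
  qed
  define \<xi> where "\<xi> = Complex (x0 - 1) d"
  have "\<theta> > 0" using \<theta>0(2) \<open>\<theta>0 > 0\<close> by simp
  show ?thesis
  proof (rule analytic_continuation[where f = D and w = w and S = S and U = "{w. Im w = d \<and> Re w < x0}" and \<xi> = \<xi>])
    show "D holomorphic_on S" using D by (simp add: S_def)
    show "w \<in> S" using w by (simp add: S_def)
    show "{w. Im w = d \<and> Re w < x0} \<subseteq> S" "\<xi> \<in> S" unfolding S using \<open>\<theta> > 0\<close> by (auto simp: x0_def \<xi>_def)
    show "\<xi> islimpt {w. Im w = d \<and> Re w < x0}"
      unfolding islimpt_approachable
    proof (intro allI impI)
      fix \<epsilon> :: real assume "\<epsilon> > 0"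
      thus "\<exists>x'\<in>{w. Im w = d \<and> Re w < x0}. x' \<noteq> \<xi> \<and> dist x' \<xi> < \<epsilon>"
        by (intro bexI[of _ "\<xi> - of_real (\<epsilon> / 2)"]) (auto simp: \<xi>_def dist_norm)
    qed
  qed (use S_open zero in auto)
qed

lemma sectorial_region_sector:
  assumes "sectorial_region d \<theta> G" "0 < \<theta>'" "\<theta>' < \<theta>"
  obtains r where "r > 0" "sector d \<theta>' \<inter> rdisc r \<subseteq> G"
  using assms unfolding sectorial_region_def by blast

text \<open>The difference of two sums of the same series satisfies the hypothesis of Watson's lemma
  on a common sector near the vertex; the identity theorem carries its vanishing to the whole
  connected set \<open>G'\<close>.\<close>

lemma msum_unique:
  assumes M: "strongly_regular M" and prox: "admits_nonzero_proximate_order M"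
    and v1: "is_msum M d f \<theta>1 G1 v1" and v2: "is_msum M d f \<theta>2 G2 v2"
    and G': "sectorial_region d' \<theta>' G'" "G' \<subseteq> G1" "G' \<subseteq> G2" and z: "z \<in> G'"
  shows "v1 z = v2 z"
proof -
  have r1: "sectorial_region d \<theta>1 G1" "omega M * pi < \<theta>1" "holo_on v1 G1"
    and b1: "\<And>\<theta>' r'. 0 < \<theta>' \<Longrightarrow> \<theta>' < \<theta>1 \<Longrightarrow> 0 < r' \<Longrightarrow> sector d \<theta>' \<inter> rdisc r' \<subseteq> G1 \<Longrightarrow>
        (\<exists>C>0. \<exists>A>0. \<forall>N\<ge>1. \<forall>w\<in>sector d \<theta>' \<inter> rdisc r'.
           norm (v1 w - (\<Sum>p<N. (exp w) ^ p *\<^sub>C fps_nth f p)) \<le> C * A ^ N * M N * exp (Re w) ^ N)"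
    using v1 unfolding is_msum_def by blast+
  have r2: "sectorial_region d \<theta>2 G2" "omega M * pi < \<theta>2" "holo_on v2 G2"
    and b2: "\<And>\<theta>' r'. 0 < \<theta>' \<Longrightarrow> \<theta>' < \<theta>2 \<Longrightarrow> 0 < r' \<Longrightarrow> sector d \<theta>' \<inter> rdisc r' \<subseteq> G2 \<Longrightarrow>
        (\<exists>C>0. \<exists>A>0. \<forall>N\<ge>1. \<forall>w\<in>sector d \<theta>' \<inter> rdisc r'.
           norm (v2 w - (\<Sum>p<N. (exp w) ^ p *\<^sub>C fps_nth f p)) \<le> C * A ^ N * M N * exp (Re w) ^ N)"
    using v2 unfolding is_msum_def by blast+
  have opens: "open G1" "open G2" "open G'" "connected G'"
    using r1(1) r2(1) G'(1) by (auto simp: sectorial_region_def)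
  have "0 < \<theta>'" using G'(1) by (simp add: sectorial_region_def)
  obtain r' where r': "r' > 0" "sector d' (\<theta>' / 2) \<inter> rdisc r' \<subseteq> G'"
    by (rule sectorial_region_sector[OF G'(1), of "\<theta>' / 2"]) (use \<open>0 < \<theta>'\<close> in auto)
  have low: "Complex x d' \<in> G'" if "x < ln r'" for x
  proof -
    have "exp x < r'" using that r'(1) by (metis exp_less_cancel_iff exp_ln)
    thus ?thesis using r'(2) \<open>0 < \<theta>'\<close> by (auto simp: sector_def rdisc_def subset_eq)
  qed
  have "Complex (ln r' - 1) d' \<in> sector d \<theta>1" "Complex (ln r' - 1) d' \<in> sector d \<theta>2"
    using low[of "ln r' - 1"] G'(2,3) r1(1) r2(1) unfolding sectorial_region_def by auto
  hence dd: "2 * \<bar>d' - d\<bar> < min \<theta>1 \<theta>2" by (simp add: sector_def)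
  \<comment> \<open>\<open>G'\<close> may point in another direction. The common opening must exceed
    \<open>omega M * pi\<close> for Watson's lemma and \<open>2 * \<bar>d' - d\<bar>\<close> in
    order that its sector contains the direction \<open>d'\<close>, along which it meets
    \<open>G'\<close>.\<close>
  have "max (omega M * pi) (max 0 (2 * \<bar>d' - d\<bar>)) < min \<theta>1 \<theta>2"
    using dd r1(1,2) r2(1,2) by (auto simp: sectorial_region_def)
  from dense[OF this] obtain \<theta>0 where "max (omega M * pi) (max 0 (2 * \<bar>d' - d\<bar>)) < \<theta>0" "\<theta>0 < min \<theta>1 \<theta>2"
    by blast
  hence \<theta>0: "omega M * pi < \<theta>0" "0 < \<theta>0" "2 * \<bar>d' - d\<bar> < \<theta>0" "\<theta>0 < \<theta>1" "\<theta>0 < \<theta>2"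
    by linarith+
  obtain s1 where s1: "s1 > 0" "sector d \<theta>0 \<inter> rdisc s1 \<subseteq> G1"
    by (rule sectorial_region_sector[OF r1(1) \<theta>0(2,4)])
  obtain s2 where s2: "s2 > 0" "sector d \<theta>0 \<inter> rdisc s2 \<subseteq> G2"
    by (rule sectorial_region_sector[OF r2(1) \<theta>0(2,5)])
  define s where "s = min s1 s2"
  define T where "T = sector d \<theta>0 \<inter> rdisc s"
  have s: "s > 0" "T \<subseteq> G1" "T \<subseteq> G2" using s1 s2 by (auto simp: s_def T_def rdisc_def)
  obtain C1 A1 where 1: "C1 > 0" "A1 > 0" "\<And>N w. N \<ge> 1 \<Longrightarrow> w \<in> T \<Longrightarrow>
      norm (v1 w - (\<Sum>p<N. (exp w) ^ p *\<^sub>C fps_nth f p)) \<le> C1 * A1 ^ N * M N * exp (Re w) ^ N"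
    using b1[OF \<theta>0(2,4) s(1)] s(2) unfolding T_def by blast
  obtain C2 A2 where 2: "C2 > 0" "A2 > 0" "\<And>N w. N \<ge> 1 \<Longrightarrow> w \<in> T \<Longrightarrow>
      norm (v2 w - (\<Sum>p<N. (exp w) ^ p *\<^sub>C fps_nth f p)) \<le> C2 * A2 ^ N * M N * exp (Re w) ^ N"
    using b2[OF \<theta>0(2,5) s(1)] s(3) unfolding T_def by blast
  have T_open: "open T"
  proof -
    have "T = {w. d - \<theta>0 / 2 < Im w} \<inter> {w. Im w < d + \<theta>0 / 2} \<inter> {w. Re w < ln s}"
      unfolding T_def by (rule sector_Int_rdisc[OF s(1)])
    thus ?thesis by (simp add: open_Int open_halfspace_Im_gt open_halfspace_Im_lt open_halfspace_Re_lt)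
  qed
  have "norm (v1 z - v2 z) \<le> 0"
  proof (rule norm_le_functionalI)
    fix \<phi> :: "'a \<Rightarrow> complex" assume \<phi>: "cfunctional \<phi>"
    note lin = bounded_linear.linear[OF cfunctional_bounded_linear[OF \<phi>]]
    define D where "D w = \<phi> (v1 w) - \<phi> (v2 w)" for w
    have D: "D w = \<phi> (v1 w - v2 w)" for w using linear_diff[OF lin] by (simp add: D_def)
    have hol: "D holomorphic_on A" if "A \<subseteq> G1" "A \<subseteq> G2" for A
      unfolding D_def using that
      by (intro holomorphic_on_diff holomorphic_on_subset[OF holo_on_functional[OF r1(3) \<phi> opens(1)]]
          holomorphic_on_subset[OF holo_on_functional[OF r2(3) \<phi> opens(2)]])
    have DT: "D w = 0" if "w \<in> T" for w
    proof (rule Watson[OF M prox \<theta>0(1) s(1) _ _ _ _ that[unfolded T_def]])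
      show "D holomorphic_on sector d \<theta>0 \<inter> rdisc s" using hol[OF s(2,3)] by (simp add: T_def)
      show "C1 + C2 > 0" "max A1 A2 > 0" using 1 2 by (auto simp: less_max_iff_disj)
      fix N w assume N: "(N::nat) \<ge> 1" and w: "w \<in> sector d \<theta>0 \<inter> rdisc s"
      define P where "P = (\<Sum>p<N. (exp w) ^ p *\<^sub>C fps_nth f p)"
      have wT: "w \<in> T" using w by (simp add: T_def)
      have "cmod (D w) \<le> norm (v1 w - v2 w)" unfolding D using \<phi> by (simp add: cfunctional_def)
      also have "\<dots> = norm ((v1 w - P) - (v2 w - P))" by simp
      also have "\<dots> \<le> norm (v1 w - P) + norm (v2 w - P)" by (rule norm_triangle_ineq4)
      also have "\<dots> \<le> C1 * A1 ^ N * M N * exp (Re w) ^ N + C2 * A2 ^ N * M N * exp (Re w) ^ N"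
        unfolding P_def by (intro add_mono 1 2 N wT)
      also have "\<dots> \<le> C1 * max A1 A2 ^ N * M N * exp (Re w) ^ N + C2 * max A1 A2 ^ N * M N * exp (Re w) ^ N"
        using 1 2 strongly_regular_pos[OF M, of N]
        by (intro add_mono mult_right_mono mult_left_mono power_mono) auto
      finally show "cmod (D w) \<le> (C1 + C2) * max A1 A2 ^ N * M N * exp (Re w) ^ N"
        by (simp add: algebra_simps)
    qed
    have "D z = 0"
    proof (rule analytic_continuation_open[of "T \<inter> G'" G' D "\<lambda>_. 0"])
      have "Complex (min (ln r') (ln s) - 1) d' \<in> T \<inter> G'"
      proof
        have "exp (min (ln r') (ln s) - 1) < exp (ln s)" by (subst exp_less_cancel_iff) auto
        thus "Complex (min (ln r') (ln s) - 1) d' \<in> T"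
          using \<theta>0(3) s(1) by (simp add: T_def sector_def rdisc_def)
        show "Complex (min (ln r') (ln s) - 1) d' \<in> G'" by (rule low) auto
      qed
      thus "T \<inter> G' \<noteq> {}" by blast
    qed (use opens T_open hol[OF G'(2,3)] DT z in auto)
    thus "cmod (\<phi> (v1 z - v2 z)) \<le> 0" by (simp add: D)
  qed
  thus ?thesis by simp
qed

section \<open>Remainders of asymptotic expansions\<close>

lemma moment_diff_power_nth:
  assumes "\<And>p. m p > 0"
  shows "fps_nth ((moment_diff m ^^ n) f) p = (m (p + n) / m p) *\<^sub>R fps_nth f (p + n)"
proof (induction n arbitrary: p)
  case (Suc n)
  have nth: "fps_nth (moment_diff m g) p = (1 / m p) *\<^sub>R (m (p + 1) *\<^sub>R fps_nth g (p + 1))" for g :: "'a fps"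
    by (simp add: moment_diff_def)
  have "(moment_diff m ^^ Suc n) f = moment_diff m ((moment_diff m ^^ n) f)" by simp
  thus ?case using assms[of "p + 1"] by (simp only: nth Suc scaleR_scaleR) simp
next
  case 0
  thus ?case using assms[of p] by simp
qed

lemma holo_on_scaleC:
  assumes "a holomorphic_on S" "holo_on f S"
  shows "holo_on (\<lambda>w. a w *\<^sub>C f w) S"
  unfolding holo_on_def
proof
  fix w assume w: "w \<in> S"
  obtain D where D: "(f has_derivative (\<lambda>h. h *\<^sub>C D)) (at w within S)"
    using assms(2) w by (auto simp: holo_on_def)
  obtain a' where a': "(a has_field_derivative a') (at w within S)"
    using assms(1) w by (auto simp: holomorphic_on_def field_differentiable_def)
  have "((\<lambda>w. a w *\<^sub>C f w) has_derivative (\<lambda>h. a w *\<^sub>C h *\<^sub>C D + (a' * h) *\<^sub>C f w)) (at w within S)"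
    by (rule scaleC.FDERIV[OF a'[unfolded has_field_derivative_def] D])
  moreover have "(\<lambda>h. a w *\<^sub>C h *\<^sub>C D + (a' * h) *\<^sub>C f w) = (\<lambda>h. h *\<^sub>C (a w *\<^sub>C D + a' *\<^sub>C f w))"
    by (simp add: fun_eq_iff scaleC_add_right scaleC_scaleC mult.commute)
  ultimately show "\<exists>D. ((\<lambda>w. a w *\<^sub>C f w) has_derivative (\<lambda>h. h *\<^sub>C D)) (at w within S)"
    by auto
qed

lemma holo_on_const: "holo_on (\<lambda>_. c) S"
  unfolding holo_on_def by (intro ballI exI[of _ 0]) (simp add: scaleC.zero_right)

lemma holo_on_diff:
  assumes "holo_on f S" "holo_on g S"
  shows "holo_on (\<lambda>w. f w - g w) S"
  unfolding holo_on_def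
proof
  fix w assume w: "w \<in> S"
  obtain D D' where "(f has_derivative (\<lambda>h. h *\<^sub>C D)) (at w within S)" "(g has_derivative (\<lambda>h. h *\<^sub>C D')) (at w within S)"
    using assms w unfolding holo_on_def by blast
  from has_derivative_diff[OF this]
  show "\<exists>D. ((\<lambda>w. f w - g w) has_derivative (\<lambda>h. h *\<^sub>C D)) (at w within S)"
    by (auto simp: scaleC.diff_right[symmetric])
qed

lemma holo_on_sum:
  assumes "\<And>i. i \<in> I \<Longrightarrow> holo_on (f i) S"
  shows "holo_on (\<lambda>w. \<Sum>i\<in>I. f i w) S"
  unfolding holo_on_def
proof
  fix w assume w: "w \<in> S"
  have "\<forall>i\<in>I. \<exists>D. (f i has_derivative (\<lambda>h. h *\<^sub>C D)) (at w within S)"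
    using assms w unfolding holo_on_def by blast
  then obtain D where "\<And>i. i \<in> I \<Longrightarrow> (f i has_derivative (\<lambda>h. h *\<^sub>C D i)) (at w within S)" by metis
  hence "((\<lambda>w. \<Sum>i\<in>I. f i w) has_derivative (\<lambda>h. \<Sum>i\<in>I. h *\<^sub>C D i)) (at w within S)"
    by (rule has_derivative_sum)
  thus "\<exists>D. ((\<lambda>w. \<Sum>i\<in>I. f i w) has_derivative (\<lambda>h. h *\<^sub>C D)) (at w within S)"
    by (auto simp: scaleC.sum_right[symmetric])
qed

text \<open>Formally this is the series with coefficients \<open>fps_nth f (n + j)\<close>, as
  dividing by \<open>z ^ n\<close> shifts the expansion. In this normalisation the bound in
  \<open>is_msum\<close> becomes \<open>C * A ^ n * M n\<close>, free of the variable.\<close>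

definition remainder :: "'e::complex_banach fps \<Rightarrow> (complex \<Rightarrow> 'e) \<Rightarrow> nat \<Rightarrow> complex \<Rightarrow> 'e" where
  "remainder f u n w = exp (- (of_nat n * w)) *\<^sub>C (u w - (\<Sum>p<n. (exp w) ^ p *\<^sub>C fps_nth f p))"

lemma remainder_step: "remainder f u n w = fps_nth f n + exp w *\<^sub>C remainder f u (Suc n) w"
proof -
  have e: "exp (- (of_nat n * w)) * exp w ^ n = 1" "exp w * exp (- (of_nat (Suc n) * w)) = exp (- (of_nat n * w))"
    by (simp_all add: algebra_simps flip: exp_of_nat_mult exp_add)
  have "exp w *\<^sub>C remainder f u (Suc n) w =
      exp (- (of_nat n * w)) *\<^sub>C (u w - (\<Sum>p<n. (exp w) ^ p *\<^sub>C fps_nth f p) - (exp w) ^ n *\<^sub>C fps_nth f n)"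
    unfolding remainder_def scaleC_scaleC e by (simp add: diff_diff_eq)
  also have "\<dots> = remainder f u n w - fps_nth f n"
    unfolding scaleC.diff_right scaleC_scaleC e remainder_def by simp
  finally show ?thesis by simp
qed

text \<open>Iterating the one-step relation, the expansion of a normalised remainder to order
  \<open>N\<close> ends with the remainder of order \<open>n + N\<close>. Integrals over remainders
  thereby inherit an asymptotic expansion.\<close>

lemma remainder_split:
  "remainder f u n w = (\<Sum>j<N. exp (of_nat j * w) *\<^sub>C fps_nth f (n + j)) + exp (of_nat N * w) *\<^sub>C remainder f u (n + N) w"
proof (induction N)
  case (Suc N)
  have "exp (of_nat N * w) * exp w = exp (of_nat (Suc N) * w)"
    by (simp add: algebra_simps flip: exp_add)
  hence "exp (of_nat N * w) *\<^sub>C remainder f u (n + N) w =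
      exp (of_nat N * w) *\<^sub>C fps_nth f (n + N) + exp (of_nat (Suc N) * w) *\<^sub>C remainder f u (n + Suc N) w"
    by (subst remainder_step) (simp add: scaleC_add_right scaleC_scaleC)
  thus ?case using Suc by (simp add: add.assoc)
qed simp

lemma remainder_0: "remainder f u 0 = u"
  by (simp add: remainder_def fun_eq_iff)

lemma norm_remainder:
  "norm (remainder f u n w) = norm (u w - (\<Sum>p<n. (exp w) ^ p *\<^sub>C fps_nth f p)) / exp (Re w) ^ n"
proof -
  have "cmod (exp (- (of_nat n * w))) = inverse (exp (Re w) ^ n)"
    by (simp add: norm_exp_eq_Re exp_minus norm_inverse flip: exp_of_nat_mult)
  thus ?thesis by (simp add: remainder_def norm_scaleC divide_inverse mult.commute)
qed

lemma remainder_holo: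
  assumes "holo_on u G"
  shows "holo_on (remainder f u n) G"
  unfolding remainder_def[abs_def]
  by (intro holo_on_scaleC holo_on_diff holo_on_sum holo_on_const assms holomorphic_intros)

lemma is_msum_remainder_bound:
  assumes u: "is_msum M d f \<theta> G u" and "0 < \<theta>'" "\<theta>' < \<theta>" "0 < r" "sector d \<theta>' \<inter> rdisc r \<subseteq> G"
  obtains C A where "C > 0" "A > 0"
    "\<And>n w. n \<ge> 1 \<Longrightarrow> w \<in> sector d \<theta>' \<inter> rdisc r \<Longrightarrow> norm (remainder f u n w) \<le> C * A ^ n * M n"
proof -
  from u[unfolded is_msum_def, THEN conjunct2, THEN conjunct2, THEN conjunct2, THEN spec, THEN spec, THEN mp,
      OF conjI[OF assms(2) conjI[OF assms(3) conjI[OF assms(4,5)]]]]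
  obtain C A where CA: "C > 0" "A > 0" and b: "\<And>n w. n \<ge> 1 \<Longrightarrow> w \<in> sector d \<theta>' \<inter> rdisc r \<Longrightarrow>
      norm (u w - (\<Sum>p<n. (exp w) ^ p *\<^sub>C fps_nth f p)) \<le> C * A ^ n * M n * exp (Re w) ^ n"
    by blast
  show ?thesis
    by (rule that[OF CA]) (use b in \<open>simp add: norm_remainder divide_le_eq\<close>)
qed

lemma is_msum_sectorial: "is_msum M d f \<theta> G u \<Longrightarrow> sectorial_region d \<theta> G"
  and is_msum_holo: "is_msum M d f \<theta> G u \<Longrightarrow> holo_on u G"
  by (simp_all add: is_msum_def)

text \<open>At one fixed point each coefficient is the difference of two consecutive normalised
  remainders, up to the factor \<open>exp w\<close>. Index 0, where the remainder bounds do not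
  apply, goes into the constant.\<close>

lemma is_msum_coeff_bound:
  assumes M: "strongly_regular M" and u: "is_msum M d f \<theta> G u"
  obtains C A where "C > 0" "A \<ge> 1" "\<And>p. norm (fps_nth f p) \<le> C * A ^ p * M p"
proof -
  note pos = strongly_regular_pos[OF M]
  have \<theta>: "0 < \<theta>" using is_msum_sectorial[OF u] by (simp add: sectorial_region_def)
  obtain r where r: "r > 0" "sector d (\<theta> / 2) \<inter> rdisc r \<subseteq> G"
    by (rule sectorial_region_sector[OF is_msum_sectorial[OF u], of "\<theta> / 2"]) (use \<theta> in auto)
  obtain C A where CA: "C > 0" "A > 0"
    "\<And>n w. n \<ge> 1 \<Longrightarrow> w \<in> sector d (\<theta> / 2) \<inter> rdisc r \<Longrightarrow> norm (remainder f u n w) \<le> C * A ^ n * M n"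
    by (rule is_msum_remainder_bound[OF u _ _ r]) (use \<theta> in auto)
  obtain A0 where A0: "A0 \<ge> 1" "\<And>p q. M (p + q) \<le> A0 ^ (p + q) * M p * M q"
    by (rule strongly_regular_mg[OF M], rule that)
  \<comment> \<open>\<open>Re w \<le> - 1\<close> keeps the factor \<open>exp (Re w)\<close> below
    1.\<close>
  define x where "x = min 0 (ln r) - 1"
  define w where "w = Complex x d"
  have w: "w \<in> sector d (\<theta> / 2) \<inter> rdisc r"
    unfolding rdisc_eq[OF r(1)] using \<theta> by (simp add: w_def x_def sector_def)
  define K where "K = norm (fps_nth f 0) + C + C * A * A0 * M 1"
  have K: "norm (fps_nth f 0) \<le> K" "C + C * A * A0 * M 1 \<le> K" "K > 0"
    using CA A0 pos[of 1] by (auto simp: K_def add_nonneg_pos add_pos_pos)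
  define B where "B = max 1 A * A0"
  have "1 * 1 \<le> max 1 A * A0" using A0(1) by (intro mult_mono) auto
  hence B: "B \<ge> 1" by (simp add: B_def)
  have "A * 1 \<le> max 1 A * A0" using A0(1) CA by (intro mult_mono) auto
  hence AB: "A \<le> B" "A * A0 \<le> B" using A0(1) by (auto simp: B_def)
  have "norm (fps_nth f p) \<le> K * B ^ p * M p" for p
  proof (cases "p \<ge> 1")
    case False
    hence "p = 0" by simp
    thus ?thesis using K(1) by (simp add: strongly_regular_0[OF M])
  next
    case True
    have "norm (fps_nth f p) = norm (remainder f u p w - exp w *\<^sub>C remainder f u (Suc p) w)"
      by (subst remainder_step) simp
    also have "\<dots> \<le> norm (remainder f u p w) + exp (Re w) * norm (remainder f u (Suc p) w)"
      by (rule order_trans[OF norm_triangle_ineq4]) (simp add: norm_scaleC)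
    also have "\<dots> \<le> C * A ^ p * M p + 1 * (C * A ^ Suc p * M (Suc p))"
      by (intro add_mono mult_mono CA(3) True w) (auto simp: w_def x_def)
    also have "\<dots> \<le> C * A ^ p * M p + 1 * (C * A ^ Suc p * (A0 ^ Suc p * M p * M 1))"
      using CA A0(2)[of p 1] by (intro add_mono mult_left_mono) auto
    also have "\<dots> = C * A ^ p * M p + (C * A * A0 * M 1) * (A * A0) ^ p * M p"
      by (simp add: power_mult_distrib mult_ac)
    also have "\<dots> \<le> C * B ^ p * M p + (C * A * A0 * M 1) * B ^ p * M p"
      using CA A0(1) AB pos by (intro add_mono mult_right_mono mult_left_mono power_mono) (auto simp: less_imp_le)
    also have "\<dots> = (C + C * A * A0 * M 1) * B ^ p * M p" by (simp add: algebra_simps)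
    also have "\<dots> \<le> K * B ^ p * M p"
      using K(2) B pos[of p] by (intro mult_right_mono) auto
    finally show ?thesis .
  qed
  thus ?thesis using that[OF K(3) B] by blast
qed

text \<open>
  Near the vertex the bound is the asymptotic expansion; away from it \<open>Q\<close> stays in a compact set,
  where \<open>u\<close> is bounded and the Taylor polynomials are estimated term by term.
\<close>

lemma remainder_bound_near:
  assumes M: "strongly_regular M" and u: "is_msum M d f \<theta> G u"
    and Q: "Q \<subseteq> sector d \<theta>1" "0 < \<theta>1" "\<theta>1 < \<theta>"
    and K: "\<And>R. \<exists>K. compact K \<and> K \<subseteq> G \<and> Q \<inter> {w. - R \<le> Re w} \<subseteq> K"
  obtains r C A where "r > 0" "C > 0" "A \<ge> 1" "\<And>w0. w0 \<in> Q \<Longrightarrow> ball w0 r \<subseteq> G"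
    "\<And>w0 w n. w0 \<in> Q \<Longrightarrow> w \<in> ball w0 r \<Longrightarrow> norm (remainder f u n w) \<le> C * A ^ n * M n"
proof -
  note pos = strongly_regular_pos[OF M]
  have G: "open G" using is_msum_sectorial[OF u] by (simp add: sectorial_region_def)
  define \<theta>2 where "\<theta>2 = (\<theta>1 + \<theta>) / 2"
  have \<theta>2: "0 < \<theta>2" "\<theta>1 < \<theta>2" "\<theta>2 < \<theta>" using Q by (auto simp: \<theta>2_def)
  obtain s where s: "s > 0" "sector d \<theta>2 \<inter> rdisc s \<subseteq> G"
    by (rule sectorial_region_sector[OF is_msum_sectorial[OF u] \<theta>2(1,3)])
  obtain C1 A1 where CA1: "C1 > 0" "A1 > 0"
    "\<And>n w. n \<ge> 1 \<Longrightarrow> w \<in> sector d \<theta>2 \<inter> rdisc s \<Longrightarrow> norm (remainder f u n w) \<le> C1 * A1 ^ n * M n"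
    by (rule is_msum_remainder_bound[OF u \<theta>2(1,3) s], rule that)
  obtain C2 A2 where CA2: "C2 > 0" "A2 \<ge> 1" "\<And>p. norm (fps_nth f p) \<le> C2 * A2 ^ p * M p"
    by (rule is_msum_coeff_bound[OF M u], rule that)
  obtain c where c: "c \<ge> 1" "\<And>p n. p \<le> n \<Longrightarrow> M p \<le> c ^ n * M n"
    by (rule strongly_regular_le_geometric[OF M], rule that)
  \<comment> \<open>Around a point to the left of \<open>- R\<close>, discs of radius at most 1 stay
    in \<open>Re w < ln s\<close>, where the asymptotic bound holds.\<close>
  define R where "R = 1 - ln s"
  obtain K0 where K0: "compact K0" "K0 \<subseteq> G" "Q \<inter> {w. - R \<le> Re w} \<subseteq> K0" using K by blast
  obtain e where e: "e > 0" "{x + y |x y. x \<in> K0 \<and> y \<in> cball 0 e} \<subseteq> G"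
  proof -
    obtain e where e: "e > 0" "(\<Union>x\<in>K0. cball x e) \<subseteq> G"
      using compact_subset_open_imp_cball_epsilon_subset[OF K0(1) G K0(2)] by blast
    have "{x + y |x y. x \<in> K0 \<and> y \<in> cball 0 e} \<subseteq> (\<Union>x\<in>K0. cball x e)"
      by (auto simp: dist_norm)
    from order_trans[OF this e(2)] show ?thesis by (rule that[OF e(1)])
  qed
  define K1 where "K1 = {x + y |x y. x \<in> K0 \<and> y \<in> cball 0 e}"
  have K1: "compact K1" "K1 \<subseteq> G"
    unfolding K1_def by (rule compact_sums[OF K0(1) compact_cball], rule e(2))
  have "compact (u ` K1)"
    by (rule compact_continuous_image[OF continuous_on_subset[OF holo_on_continuous_on[OF is_msum_holo[OF u]] K1(2)] K1(1)])
  then obtain b where b: "b > 0" "\<And>w. w \<in> K1 \<Longrightarrow> norm (u w) \<le> b"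
    using compact_imp_bounded[of "u ` K1"] unfolding bounded_pos by blast
  obtain L where L: "L > 0" "\<And>w. w \<in> K1 \<Longrightarrow> cmod w \<le> L"
    using compact_imp_bounded[OF K1(1)] unfolding bounded_pos by blast
  define r where "r = min e (min 1 ((\<theta>2 - \<theta>1) / 2))"
  have "r \<le> (\<theta>2 - \<theta>1) / 2" unfolding r_def by (intro min.coboundedI2 order_refl)
  moreover have "r > 0" "r \<le> e" "r \<le> 1" using e(1) \<theta>2 by (auto simp: r_def)
  ultimately have r: "r > 0" "r \<le> e" "r \<le> 1" "r \<le> (\<theta>2 - \<theta>1) / 2" by blast+
  have cover: "w \<in> K1 \<or> w \<in> sector d \<theta>2 \<inter> rdisc s" if w0: "w0 \<in> Q" and w: "w \<in> ball w0 r" for w0 w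
  proof (cases "- R \<le> Re w0")
    case True
    hence "w0 \<in> K0" using K0 w0 by blast
    moreover have "w - w0 \<in> cball 0 e" using w r by (simp add: dist_norm norm_minus_commute)
    moreover have "w = w0 + (w - w0)" by simp
    ultimately have "w \<in> K1" unfolding K1_def mem_Collect_eq by (intro exI conjI)
    thus ?thesis ..
  next
    case False
    have "cmod (w - w0) < r" using w by (simp add: dist_norm norm_minus_commute)
    hence n: "\<bar>Re w - Re w0\<bar> < r" "\<bar>Im w - Im w0\<bar> < r"
      using abs_Re_le_cmod[of "w - w0"] abs_Im_le_cmod[of "w - w0"] by auto
    have "Re w < ln s" using False n r by (simp add: R_def)
    moreover have "\<bar>Im w0 - d\<bar> < \<theta>1 / 2" using Q(1) w0 by (auto simp: sector_def)
    hence "\<bar>Im w - d\<bar> < \<theta>1 / 2 + r" using n(2) by linarith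
    hence "\<bar>Im w - d\<bar> < \<theta>2 / 2" using r(4) by (simp add: field_simps)
    ultimately show ?thesis unfolding rdisc_eq[OF s(1)] by (simp add: sector_def)
  qed
  \<comment> \<open>The \<open>n\<close>-th power has to pay for the number of terms (2), for
    \<open>exp w ^ p\<close> and for the division by \<open>exp w ^ n\<close> (\<open>exp L\<close>
    each), for the coefficients (\<open>A2\<close>) and for replacing \<open>M p\<close> by
    \<open>M n\<close> (\<open>c\<close>).\<close>
  define A where "A = max (max A1 1) (2 * exp (2 * L) * A2 * c)"
  define C where "C = C1 + b + C2 + C1 * A1 * M 1 * s + norm (fps_nth f 0)"
  have C: "C > 0" using CA1 CA2 b pos[of 1] s by (auto simp: C_def intro!: add_pos_nonneg)
  have A: "A \<ge> 1" "A \<ge> A1" "A \<ge> 2 * exp (2 * L) * A2 * c" by (auto simp: A_def)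
  have near: "norm (remainder f u n w) \<le> C * A ^ n * M n" if w: "w \<in> sector d \<theta>2 \<inter> rdisc s" for w n
  proof (cases "n \<ge> 1")
    case True
    have "norm (remainder f u n w) \<le> C1 * A1 ^ n * M n" by (rule CA1(3)[OF True w])
    also have "\<dots> \<le> C * A ^ n * M n"
      using CA1 CA2 b pos[of n] pos[of 1] s A C by (intro mult_right_mono mult_mono power_mono) (auto simp: C_def)
    finally show ?thesis .
  next
    case False
    hence n: "n = 0" by simp
    have "norm (u w) = norm (fps_nth f 0 + exp w *\<^sub>C remainder f u 1 w)"
      using remainder_step[of f u 0 w] by (simp add: remainder_0)
    also have "\<dots> \<le> norm (fps_nth f 0) + exp (Re w) * norm (remainder f u 1 w)"
      by (rule order_trans[OF norm_triangle_ineq]) (simp add: norm_scaleC)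
    also have "\<dots> \<le> norm (fps_nth f 0) + s * (C1 * A1 * M 1)"
      using CA1(3)[of 1 w] w s(1) by (intro add_left_mono mult_mono) (auto simp: rdisc_def)
    also have "\<dots> \<le> C" using CA1 CA2 b by (simp add: C_def)
    finally show ?thesis unfolding n by (simp add: remainder_0 strongly_regular_0[OF M])
  qed
  have far: "norm (remainder f u n w) \<le> C * A ^ n * M n" if w: "w \<in> K1" for w n
  proof -
    have ReL: "Re w \<le> L" "- Re w \<le> L" using L(2)[OF w] abs_Re_le_cmod[of w] by auto
    have cM: "1 \<le> c ^ n * M n" using c(2)[of 0 n] by (simp add: strongly_regular_0[OF M])
    have term_le: "norm ((exp w) ^ p *\<^sub>C fps_nth f p) \<le> exp L ^ n * (C2 * A2 ^ n * (c ^ n * M n))" if p: "p < n" for p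
    proof -
      have "norm ((exp w) ^ p *\<^sub>C fps_nth f p) = exp (Re w) ^ p * norm (fps_nth f p)"
        by (simp add: norm_scaleC norm_power)
      also have "\<dots> \<le> exp L ^ n * (C2 * A2 ^ n * (c ^ n * M n))"
      proof (intro mult_mono)
        have "exp (Re w) ^ p \<le> exp L ^ p" using ReL by (intro power_mono) auto
        also have "\<dots> \<le> exp L ^ n" using L(1) p by (intro power_increasing) auto
        finally show "exp (Re w) ^ p \<le> exp L ^ n" .
        have "norm (fps_nth f p) \<le> C2 * A2 ^ p * M p" by (rule CA2)
        also have "\<dots> \<le> C2 * A2 ^ n * (c ^ n * M n)"
          using CA2 c(2)[of p n] p pos[of p] by (intro mult_mono power_increasing) auto
        finally show "norm (fps_nth f p) \<le> C2 * A2 ^ n * (c ^ n * M n)" .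
      qed auto
      finally show ?thesis .
    qed
    have "norm (\<Sum>p<n. (exp w) ^ p *\<^sub>C fps_nth f p) \<le> of_nat (card {..<n}) * (exp L ^ n * (C2 * A2 ^ n * (c ^ n * M n)))"
      by (rule sum_norm_bound) (use term_le in auto)
    hence S: "norm (\<Sum>p<n. (exp w) ^ p *\<^sub>C fps_nth f p) \<le> real n * (exp L ^ n * (C2 * A2 ^ n * (c ^ n * M n)))" by simp
    have n2: "real n \<le> 2 ^ n" "1 \<le> (2::real) ^ n" using of_nat_less_two_power[of n] by (auto simp: less_imp_le)
    define P where "P = 2 ^ n * (exp L ^ n * (A2 ^ n * (c ^ n * M n)))"
    have P1: "1 \<le> P"
    proof -
      have "1 \<le> A2 ^ n * (c ^ n * M n)" using mult_mono[OF one_le_power[OF CA2(2), of n] cM] CA2(2) by simp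
      hence "1 \<le> exp L ^ n * (A2 ^ n * (c ^ n * M n))"
        using mult_mono[of 1 "exp L ^ n" 1 "A2 ^ n * (c ^ n * M n)"] L(1) by (simp add: one_le_power)
      thus ?thesis using mult_mono[OF n2(2), of 1 "exp L ^ n * (A2 ^ n * (c ^ n * M n))"] by (simp add: P_def)
    qed
    have "norm (u w - (\<Sum>p<n. (exp w) ^ p *\<^sub>C fps_nth f p)) \<le> b + real n * (exp L ^ n * (C2 * A2 ^ n * (c ^ n * M n)))"
      using norm_triangle_ineq4[of "u w" "\<Sum>p<n. (exp w) ^ p *\<^sub>C fps_nth f p"] b(2)[OF w] S by linarith
    also have "\<dots> \<le> b * P + C2 * P"
    proof (intro add_mono)
      show "b \<le> b * P" using b(1) P1 by simp
      have "real n * (exp L ^ n * (C2 * A2 ^ n * (c ^ n * M n))) \<le> 2 ^ n * (exp L ^ n * (C2 * A2 ^ n * (c ^ n * M n)))"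
        using CA2 c(1) pos[of n] by (intro mult_right_mono n2) auto
      thus "real n * (exp L ^ n * (C2 * A2 ^ n * (c ^ n * M n))) \<le> C2 * P" by (simp add: P_def mult_ac)
    qed
    finally have N: "norm (u w - (\<Sum>p<n. (exp w) ^ p *\<^sub>C fps_nth f p)) \<le> (b + C2) * P" by (simp add: algebra_simps)
    have "norm (remainder f u n w) = exp (- Re w) ^ n * norm (u w - (\<Sum>p<n. (exp w) ^ p *\<^sub>C fps_nth f p))"
      by (simp add: norm_remainder exp_minus divide_inverse power_inverse mult.commute)
    also have "\<dots> \<le> exp L ^ n * ((b + C2) * P)"
      using ReL N by (intro mult_mono power_mono) auto
    also have "\<dots> = (b + C2) * ((2 * exp (2 * L) * A2 * c) ^ n * M n)"
    proof -
      have e: "exp (2 * L) ^ n = exp L ^ n * exp L ^ n" unfolding mult_2 exp_add power_mult_distrib ..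
      show ?thesis by (simp only: P_def power_mult_distrib e) (simp only: mult_ac)
    qed
    also have "\<dots> \<le> C * (A ^ n * M n)"
    proof (intro mult_mono mult_right_mono power_mono)
      show "b + C2 \<le> C" using CA1 s pos[of 1] by (simp add: C_def)
    qed (use A CA2 c C b pos[of n] in auto)
    finally show ?thesis by (simp add: mult.assoc)
  qed
  show ?thesis
  proof (rule that[OF r(1) C A(1)])
    show "ball w0 r \<subseteq> G" if "w0 \<in> Q" for w0 using cover[OF that] K1(2) s(2) by blast
    show "norm (remainder f u n w) \<le> C * A ^ n * M n" if "w0 \<in> Q" "w \<in> ball w0 r" for w0 w n
      using cover[OF that] near far by blast
  qed
qed

section \<open>Moment derivatives of sums\<close>

text \<open>The half strip around the segment from the vertex (\<open>Re \<omega> = - \<infinity>\<close>) to \<open>0\<close>.\<close>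

definition half_strip :: "real \<Rightarrow> complex set" where
  "half_strip \<delta> = {\<omega>. Re \<omega> \<le> \<delta> \<and> \<bar>Im \<omega>\<bar> \<le> \<delta>}"

lemma Complex_in_half_strip:
  "\<delta> \<ge> 0 \<Longrightarrow> x \<le> \<delta> \<Longrightarrow> Complex x (- \<delta>) \<in> half_strip \<delta>"
  "\<delta> \<ge> 0 \<Longrightarrow> x \<le> \<delta> \<Longrightarrow> Complex x \<delta> \<in> half_strip \<delta>"
  "y \<in> {-\<delta>..\<delta>} \<Longrightarrow> Complex \<delta> y \<in> half_strip \<delta>"
  by (auto simp: half_strip_def)

section \<open>Integration along the boundary of the half strip\<close>

locale boundary_weights =
  fixes \<delta> \<gamma> b :: real and k1 k2 k3 :: "real \<Rightarrow> complex"
  assumes \<delta>_pos: "0 < \<delta>" and \<gamma>_pos: "0 < \<gamma>"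
    and k_cont: "continuous_on {..\<delta>} k1" "continuous_on {-\<delta>..\<delta>} k2" "continuous_on {..\<delta>} k3"
    and k1_le: "\<And>x. x \<le> \<delta> \<Longrightarrow> cmod (k1 x) \<le> b * exp (\<gamma> * x)"
    and k2_le: "\<And>y. y \<in> {-\<delta>..\<delta>} \<Longrightarrow> cmod (k2 y) \<le> b"
    and k3_le: "\<And>x. x \<le> \<delta> \<Longrightarrow> cmod (k3 x) \<le> b * exp (\<gamma> * x)"
begin

text \<open>The orientation and the factor \<open>1 / (2 * pi * \<i>)\<close> of the contour
  integral are contained in the weights.\<close>

definition bdry :: "(complex \<Rightarrow> 'e::complex_banach) \<Rightarrow> 'e" where
  "bdry F = integral {..\<delta>} (\<lambda>x. k1 x *\<^sub>C F (Complex x (- \<delta>)))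
     + integral {-\<delta>..\<delta>} (\<lambda>y. k2 y *\<^sub>C F (Complex \<delta> y))
     + integral {..\<delta>} (\<lambda>x. k3 x *\<^sub>C F (Complex x \<delta>))"

definition admissible :: "(complex \<Rightarrow> 'e::complex_banach) \<Rightarrow> bool" where
  "admissible F \<longleftrightarrow> continuous_on (half_strip \<delta>) F \<and> bounded (F ` half_strip \<delta>)"

text \<open>What remains of the three sides once \<open>b\<close> and a bound for \<open>F\<close>
  are factored out. It involves only \<delta> and \<gamma>, so in the application all growth in
  \<open>n\<close> sits in the two bounds.\<close>

definition "mass = 2 * integral {..\<delta>} (\<lambda>x. exp (\<gamma> * x)) + 2 * \<delta>"

lemma weight_g_integrable: "(\<lambda>x. b * exp (\<gamma> * x)) integrable_on {..\<delta>}" "(\<lambda>_. b) integrable_on {-\<delta>..\<delta>}"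
  using integrable_exp_atMost[OF \<gamma>_pos, of \<delta>] by (auto intro!: integrable_on_mult_right)

lemma bdry_integrable:
  assumes "admissible F"
  shows "(\<lambda>x. k1 x *\<^sub>C F (Complex x (- \<delta>))) integrable_on {..\<delta>}"
    "(\<lambda>y. k2 y *\<^sub>C F (Complex \<delta> y)) integrable_on {-\<delta>..\<delta>}"
    "(\<lambda>x. k3 x *\<^sub>C F (Complex x \<delta>)) integrable_on {..\<delta>}"
proof -
  obtain B where B: "\<And>w. w \<in> half_strip \<delta> \<Longrightarrow> norm (F w) \<le> B"
    using assms by (auto simp: admissible_def bounded_iff)
  have cont: "continuous_on S (\<lambda>x. F (p x))"
    if "continuous_on S p" "p ` S \<subseteq> half_strip \<delta>" for S and p :: "real \<Rightarrow> complex"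
    using assms continuous_on_compose2 that unfolding admissible_def by blast
  have cC: "continuous_on A (\<lambda>x. Complex x y)" "continuous_on A (\<lambda>y. Complex x y)" for A x y
    unfolding Complex_eq by (intro continuous_intros)+
  have le: "norm (k *\<^sub>C F w) \<le> g * B" if "cmod k \<le> g" "w \<in> half_strip \<delta>" for k g w
    unfolding norm_scaleC using that B[OF that(2)] order_trans[OF norm_ge_zero that(1)] by (intro mult_mono) auto
  show "(\<lambda>x. k1 x *\<^sub>C F (Complex x (- \<delta>))) integrable_on {..\<delta>}"
  proof (rule integrable_dominated_continuous)
    show "continuous_on {..\<delta>} (\<lambda>x. k1 x *\<^sub>C F (Complex x (- \<delta>)))"
      using \<delta>_pos by (intro scaleC.continuous_on k_cont cont cC) (auto simp: half_strip_def)
    show "(\<lambda>x. b * exp (\<gamma> * x) * B) integrable_on {..\<delta>}" by (intro integrable_on_mult_left weight_g_integrable)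
    show "norm (k1 x *\<^sub>C F (Complex x (- \<delta>))) \<le> b * exp (\<gamma> * x) * B" if "x \<in> {..\<delta>}" for x
      using that \<delta>_pos by (intro le k1_le Complex_in_half_strip) auto
  qed (auto simp: is_interval_ic)
  show "(\<lambda>x. k3 x *\<^sub>C F (Complex x \<delta>)) integrable_on {..\<delta>}"
  proof (rule integrable_dominated_continuous)
    show "continuous_on {..\<delta>} (\<lambda>x. k3 x *\<^sub>C F (Complex x \<delta>))"
      using \<delta>_pos by (intro scaleC.continuous_on k_cont cont cC) (auto simp: half_strip_def)
    show "(\<lambda>x. b * exp (\<gamma> * x) * B) integrable_on {..\<delta>}" by (intro integrable_on_mult_left weight_g_integrable)
    show "norm (k3 x *\<^sub>C F (Complex x \<delta>)) \<le> b * exp (\<gamma> * x) * B" if "x \<in> {..\<delta>}" for x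
      using that \<delta>_pos by (intro le k3_le Complex_in_half_strip) auto
  qed (auto simp: is_interval_ic)
  show "(\<lambda>y. k2 y *\<^sub>C F (Complex \<delta> y)) integrable_on {-\<delta>..\<delta>}"
    using \<delta>_pos by (intro integrable_continuous_interval scaleC.continuous_on k_cont cont cC) (auto simp: half_strip_def)
qed

lemma bdry_bound:
  assumes F: "admissible F" and B: "\<And>w. w \<in> half_strip \<delta> \<Longrightarrow> norm (F w) \<le> B"
  shows "norm (bdry F) \<le> B * b * mass"
proof -
  have le: "norm (k *\<^sub>C F w) \<le> g * B" if "cmod k \<le> g" "w \<in> half_strip \<delta>" for k g w
    unfolding norm_scaleC using that B[OF that(2)] order_trans[OF norm_ge_zero that(1)] by (intro mult_mono) auto
  note I = bdry_integrable[OF F]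
  have 1: "norm (integral {..\<delta>} (\<lambda>x. k1 x *\<^sub>C F (Complex x (- \<delta>)))) \<le> integral {..\<delta>} (\<lambda>x. b * exp (\<gamma> * x) * B)"
    by (rule integral_norm_bound_integral[OF I(1)])
      (use \<delta>_pos in \<open>auto intro!: le k1_le Complex_in_half_strip integrable_on_mult_left weight_g_integrable\<close>)
  have 2: "norm (integral {-\<delta>..\<delta>} (\<lambda>y. k2 y *\<^sub>C F (Complex \<delta> y))) \<le> integral {-\<delta>..\<delta>} (\<lambda>_. b * B)"
    by (rule integral_norm_bound_integral[OF I(2)])
      (use \<delta>_pos in \<open>auto intro!: le k2_le Complex_in_half_strip\<close>)
  have 3: "norm (integral {..\<delta>} (\<lambda>x. k3 x *\<^sub>C F (Complex x \<delta>))) \<le> integral {..\<delta>} (\<lambda>x. b * exp (\<gamma> * x) * B)"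
    by (rule integral_norm_bound_integral[OF I(3)])
      (use \<delta>_pos in \<open>auto intro!: le k3_le Complex_in_half_strip integrable_on_mult_left weight_g_integrable\<close>)
  have "norm (bdry F) \<le> integral {..\<delta>} (\<lambda>x. b * exp (\<gamma> * x) * B) + integral {-\<delta>..\<delta>} (\<lambda>_. b * B)
      + integral {..\<delta>} (\<lambda>x. b * exp (\<gamma> * x) * B)"
    unfolding bdry_def by (intro order_trans[OF norm_triangle_ineq] add_mono 1 2 3)
  also have "\<dots> = B * b * mass"
    using \<delta>_pos by (simp add: mass_def algebra_simps)
  finally show ?thesis .
qed

lemma bdry_add:
  assumes F: "admissible F" and G: "admissible G"
  shows "bdry (\<lambda>w. F w + G w) = bdry F + bdry G"
  unfolding bdry_def scaleC_add_right
  by (simp add: Henstock_Kurzweil_Integration.integral_add bdry_integrable[OF F] bdry_integrable[OF G])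

lemma admissible_add: "admissible F \<Longrightarrow> admissible G \<Longrightarrow> admissible (\<lambda>w. F w + G w)"
  by (auto simp: admissible_def intro!: continuous_on_add bounded_plus_comp)

lemma bounded_exp_half_strip: "w \<in> half_strip \<delta> \<Longrightarrow> cmod (exp (of_nat j * w)) \<le> exp (real j * \<delta>)"
  by (auto simp: half_strip_def intro!: mult_left_mono)

lemma admissible_exp_mult:
  assumes "admissible F"
  shows "admissible (\<lambda>w. exp (of_nat j * w) *\<^sub>C F w)"
proof -
  obtain B where B: "\<And>w. w \<in> half_strip \<delta> \<Longrightarrow> norm (F w) \<le> B"
    using assms by (auto simp: admissible_def bounded_iff)
  have "norm (exp (of_nat j * w) *\<^sub>C F w) \<le> exp (real j * \<delta>) * B" if "w \<in> half_strip \<delta>" for w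
    unfolding norm_scaleC by (intro mult_mono bounded_exp_half_strip B that) auto
  thus ?thesis using assms unfolding admissible_def bounded_iff
    by (auto intro!: scaleC.continuous_on continuous_intros)
qed

lemma admissible_scaleC:
  assumes "admissible F"
  shows "admissible (\<lambda>w. c *\<^sub>C F w)"
proof -
  have "bounded ((\<lambda>v. c *\<^sub>C v) ` F ` half_strip \<delta>)"
    by (rule bounded_linear_image[OF _ scaleC.bounded_linear_right]) (use assms in \<open>simp add: admissible_def\<close>)
  thus ?thesis
    using assms unfolding admissible_def image_image by (auto intro!: scaleC.continuous_on continuous_on_const)
qed

lemma admissible_const: "admissible (\<lambda>_. c)"
  by (auto simp: admissible_def bounded_iff)

lemma admissible_sum: "(\<And>i. i \<in> I \<Longrightarrow> admissible (F i)) \<Longrightarrow> admissible (\<lambda>w. \<Sum>i\<in>I. F i w)"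
  by (induction I rule: infinite_finite_induct) (auto intro: admissible_add admissible_const)

lemma bdry_sum: "(\<And>i. i \<in> I \<Longrightarrow> admissible (F i)) \<Longrightarrow> bdry (\<lambda>w. \<Sum>i\<in>I. F i w) = (\<Sum>i\<in>I. bdry (F i))"
proof (induction I rule: infinite_finite_induct)
  case (insert i I)
  thus ?case by (simp add: bdry_add admissible_sum)
qed (simp_all add: bdry_def scaleC.zero_right)

lemma bdry_exp:
  "bdry (\<lambda>w. exp (of_nat j * w) *\<^sub>C c) =
    (integral {..\<delta>} (\<lambda>x. k1 x * exp (of_nat j * Complex x (- \<delta>)))
     + integral {-\<delta>..\<delta>} (\<lambda>y. k2 y * exp (of_nat j * Complex \<delta> y))
     + integral {..\<delta>} (\<lambda>x. k3 x * exp (of_nat j * Complex x \<delta>))) *\<^sub>C c"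
proof -
  have 1: "integral S (\<lambda>x. k x *\<^sub>C f x *\<^sub>C c) = integral S (\<lambda>x. k x * f x) *\<^sub>C c"
    if "(\<lambda>x. k x * f x) integrable_on S" for S :: "real set" and k f :: "real \<Rightarrow> complex"
    using integral_linear[OF that scaleC.bounded_linear_left[of c]] by (simp add: o_def scaleC_scaleC)
  have "admissible (\<lambda>w. exp (of_nat j * w) *\<^sub>C (1::complex))" by (intro admissible_exp_mult admissible_const)
  from bdry_integrable[OF this] show ?thesis
    unfolding bdry_def by (simp add: scaleC_complex_def 1 scaleC_add_left)
qed

lemma bdry_holo:
  assumes U: "holo_on U W" "open W" and r: "r > 0"
    and sub: "\<And>\<omega>. \<omega> \<in> half_strip \<delta> \<Longrightarrow> ball (\<zeta> + \<omega>) r \<subseteq> W"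
    and B: "\<And>\<omega> w. \<omega> \<in> half_strip \<delta> \<Longrightarrow> w \<in> ball (\<zeta> + \<omega>) r \<Longrightarrow> norm (U w) \<le> B"
  shows "\<exists>D. ((\<lambda>\<zeta>. bdry (\<lambda>\<omega>. U (\<zeta> + \<omega>))) has_derivative (\<lambda>h. h *\<^sub>C D)) (at \<zeta>)"
proof -
  have cC: "continuous_on A (\<lambda>x. Complex x y)" "continuous_on A (\<lambda>y. Complex x y)" for A x y
    unfolding Complex_eq by (intro continuous_intros)+
  have gen: "\<exists>D. ((\<lambda>\<zeta>. integral S (\<lambda>x. k x *\<^sub>C U (\<zeta> + p x))) has_derivative (\<lambda>h. h *\<^sub>C D)) (at \<zeta>)"
    if h: "closed S" "is_interval S" "continuous_on S k" "continuous_on S p" "g integrable_on S"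
      "\<And>x. x \<in> S \<Longrightarrow> cmod (k x) \<le> g x" "\<And>x. x \<in> S \<Longrightarrow> p x \<in> half_strip \<delta>" for S :: "real set" and k p g
  proof (rule holo_on_integral_translates[OF h(1-6) U r])
    show "ball (\<zeta> + p x) r \<subseteq> W" if "x \<in> S" for x by (rule sub[OF h(7)[OF that]])
    show "norm (U w) \<le> B" if "x \<in> S" "w \<in> ball (\<zeta> + p x) r" for x w by (rule B[OF h(7)[OF that(1)] that(2)])
  qed
  obtain D1 where D1: "((\<lambda>\<zeta>. integral {..\<delta>} (\<lambda>x. k1 x *\<^sub>C U (\<zeta> + Complex x (- \<delta>)))) has_derivative (\<lambda>h. h *\<^sub>C D1)) (at \<zeta>)"
    using gen[OF closed_atMost is_interval_ic k_cont(1) cC(1) weight_g_integrable(1), of "- \<delta>"]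
      k1_le Complex_in_half_strip(1) \<delta>_pos by auto
  obtain D2 where D2: "((\<lambda>\<zeta>. integral {-\<delta>..\<delta>} (\<lambda>y. k2 y *\<^sub>C U (\<zeta> + Complex \<delta> y))) has_derivative (\<lambda>h. h *\<^sub>C D2)) (at \<zeta>)"
    using gen[OF closed_atLeastAtMost is_interval_cc k_cont(2) cC(2) weight_g_integrable(2), of \<delta>]
      k2_le Complex_in_half_strip(3) \<delta>_pos by auto
  obtain D3 where D3: "((\<lambda>\<zeta>. integral {..\<delta>} (\<lambda>x. k3 x *\<^sub>C U (\<zeta> + Complex x \<delta>))) has_derivative (\<lambda>h. h *\<^sub>C D3)) (at \<zeta>)"
    using gen[OF closed_atMost is_interval_ic k_cont(3) cC(1) weight_g_integrable(1), of \<delta>]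
      k3_le Complex_in_half_strip(2) \<delta>_pos by auto
  have "((\<lambda>\<zeta>. bdry (\<lambda>\<omega>. U (\<zeta> + \<omega>))) has_derivative (\<lambda>h. h *\<^sub>C D1 + h *\<^sub>C D2 + h *\<^sub>C D3)) (at \<zeta>)"
    unfolding bdry_def by (intro has_derivative_add D1 D2 D3)
  thus ?thesis unfolding scaleC_add_right[symmetric] by blast
qed

end

text \<open>The domain of the boundary integral, whose integrand is evaluated at all
  \<open>\<zeta> + \<omega>\<close>. Its opening is \<open>2 * \<delta>\<close> less than that of
  \<open>G\<close>, which for small \<delta> still exceeds \<open>omega M * pi\<close>.\<close>

definition shrunk :: "real \<Rightarrow> complex set \<Rightarrow> complex set" where
  "shrunk \<delta> G = {\<zeta>. \<forall>\<omega>\<in>half_strip \<delta>. \<zeta> + \<omega> \<in> G}"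

lemma sector_plus_half_strip:
  assumes "\<zeta> \<in> sector d \<theta> \<inter> rdisc r" "\<omega> \<in> half_strip \<delta>" "r > 0"
  shows "\<zeta> + \<omega> \<in> sector d (\<theta> + 2 * \<delta>) \<inter> rdisc (r * exp \<delta>)"
proof -
  have "exp (Re \<zeta> + Re \<omega>) = exp (Re \<zeta>) * exp (Re \<omega>)" by (rule exp_add)
  also have "\<dots> < r * exp \<delta>"
    using assms by (intro mult_less_le_imp_less) (auto simp: rdisc_def half_strip_def)
  finally have "exp (Re \<zeta> + Re \<omega>) < r * exp \<delta>" .
  moreover have "\<bar>Im \<zeta> - d\<bar> < \<theta> / 2" "\<bar>Im \<omega>\<bar> \<le> \<delta>" "(\<theta> + 2 * \<delta>) / 2 = \<theta> / 2 + \<delta>"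
    using assms by (simp_all add: sector_def half_strip_def)
  hence "\<bar>Im \<zeta> + Im \<omega> - d\<bar> < (\<theta> + 2 * \<delta>) / 2" by linarith
  ultimately show ?thesis by (simp add: sector_def rdisc_def)
qed

text \<open>Pulling \<open>Im w - d\<close> towards 0 by the factor \<open>q\<close> changes the
  height by at most \<delta>. Hence a sector inside \<open>shrunk \<delta> G\<close> comes from a
  wider one inside \<open>G\<close>, on which the remainder bounds are available.\<close>

lemma sector_decompose:
  assumes w: "w \<in> sector d (\<theta> + 2 * \<delta>) \<inter> rdisc (r * exp \<delta>)" and \<delta>: "\<delta> > 0" "\<theta> > 0" "r > 0"
  obtains \<zeta> \<omega> where "\<zeta> \<in> sector d \<theta> \<inter> rdisc r" "\<omega> \<in> half_strip \<delta>" "w = \<zeta> + \<omega>"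
proof -
  define q where "q = \<theta> / (\<theta> + 2 * \<delta>)"
  have q: "0 < q" "q < 1" "q * ((\<theta> + 2 * \<delta>) / 2) = \<theta> / 2" using \<delta> by (auto simp: q_def field_simps)
  define \<zeta> where "\<zeta> = Complex (Re w - \<delta>) (d + q * (Im w - d))"
  have im: "\<bar>Im w - d\<bar> < (\<theta> + 2 * \<delta>) / 2" using w by (simp add: sector_def)
  have "\<bar>q * (Im w - d)\<bar> < \<theta> / 2"
    unfolding abs_mult q(3)[symmetric] using q(1) im by simp
  moreover have "exp (Re w - \<delta>) < r" using w by (simp add: rdisc_def exp_diff divide_less_eq)
  ultimately have "\<zeta> \<in> sector d \<theta> \<inter> rdisc r" by (simp add: \<zeta>_def sector_def rdisc_def)
  moreover have "w - \<zeta> \<in> half_strip \<delta>"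
  proof -
    have "\<bar>Im w - (d + q * (Im w - d))\<bar> = (1 - q) * \<bar>Im w - d\<bar>"
    proof -
      have "Im w - (d + q * (Im w - d)) = (1 - q) * (Im w - d)" by (simp add: algebra_simps)
      thus ?thesis using q by (simp add: abs_mult)
    qed
    also have "\<dots> \<le> (1 - q) * ((\<theta> + 2 * \<delta>) / 2)" using q im by (intro mult_left_mono) auto
    also have "\<dots> = \<delta>" using q(3) by (simp add: algebra_simps)
    finally show ?thesis by (simp add: half_strip_def \<zeta>_def)
  qed
  ultimately show ?thesis using that[of \<zeta> "w - \<zeta>"] by simp
qed

text \<open>The heights \<open>Im \<zeta> + \<delta>\<close> and
  \<open>Im \<zeta> - \<delta>\<close> are attained inside the open sector of \<open>G\<close>, so
  the translated half strip fits into a sector of strictly smaller opening; away from the vertex it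
  lies in a closed rectangle contained in \<open>G\<close>.\<close>

lemma remainder_bound_shrunk:
  assumes M: "strongly_regular M" and u: "is_msum M d f \<theta> G u" and \<delta>: "\<delta> > 0" "2 * \<delta> < \<theta>"
    and \<zeta>: "\<zeta> \<in> shrunk \<delta> G"
  obtains r C A where "r > 0" "C > 0" "A \<ge> 1" "\<And>\<omega>. \<omega> \<in> half_strip \<delta> \<Longrightarrow> ball (\<zeta> + \<omega>) r \<subseteq> G"
    "\<And>\<omega> w n. \<omega> \<in> half_strip \<delta> \<Longrightarrow> w \<in> ball (\<zeta> + \<omega>) r \<Longrightarrow> norm (remainder f u n w) \<le> C * A ^ n * M n"
proof -
  define Q where "Q = (\<lambda>\<omega>. \<zeta> + \<omega>) ` half_strip \<delta>"
  have QG: "Q \<subseteq> G" using \<zeta> by (auto simp: Q_def shrunk_def)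
  have "G \<subseteq> sector d \<theta>" using is_msum_sectorial[OF u] by (auto simp: sectorial_region_def)
  moreover have "\<zeta> + Complex 0 \<delta> \<in> Q" "\<zeta> + Complex 0 (- \<delta>) \<in> Q" using \<delta> by (auto simp: Q_def half_strip_def)
  ultimately have "\<zeta> + Complex 0 \<delta> \<in> sector d \<theta>" "\<zeta> + Complex 0 (- \<delta>) \<in> sector d \<theta>" using QG by blast+
  hence "\<bar>Im \<zeta> + \<delta> - d\<bar> < \<theta> / 2" "\<bar>Im \<zeta> - \<delta> - d\<bar> < \<theta> / 2" by (simp_all add: sector_def)
  hence im: "\<bar>Im \<zeta> - d\<bar> + \<delta> < \<theta> / 2" by linarith
  define \<theta>1 where "\<theta>1 = (2 * (\<bar>Im \<zeta> - d\<bar> + \<delta>) + \<theta>) / 2"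
  have \<theta>1: "0 < \<theta>1" "\<theta>1 < \<theta>" "\<bar>Im \<zeta> - d\<bar> + \<delta> < \<theta>1 / 2"
  proof -
    have "0 \<le> \<bar>Im \<zeta> - d\<bar>" by simp
    hence "0 < 2 * (\<bar>Im \<zeta> - d\<bar> + \<delta>) + \<theta>" using \<delta> by (intro add_nonneg_pos) simp_all
    thus "0 < \<theta>1" by (simp add: \<theta>1_def)
  qed (use im in \<open>auto simp: \<theta>1_def field_simps\<close>)
  have Qs: "Q \<subseteq> sector d \<theta>1"
  proof
    fix w assume "w \<in> Q"
    then obtain \<omega> where "w = \<zeta> + \<omega>" "\<bar>Im \<omega>\<bar> \<le> \<delta>" by (auto simp: Q_def half_strip_def)
    hence "\<bar>Im w - d\<bar> \<le> \<bar>Im \<zeta> - d\<bar> + \<delta>" by simp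
    thus "w \<in> sector d \<theta>1" unfolding sector_def mem_Collect_eq using \<theta>1(3) by (rule le_less_trans)
  qed
  have QK: "\<exists>K. compact K \<and> K \<subseteq> G \<and> Q \<inter> {w. - R \<le> Re w} \<subseteq> K" for R
  proof (intro exI conjI)
    define K where "K = cbox (Complex (- R) (Im \<zeta> - \<delta>)) (Complex (Re \<zeta> + \<delta>) (Im \<zeta> + \<delta>))"
    show "compact K" unfolding K_def by (rule compact_cbox)
    show "K \<subseteq> G"
    proof
      fix w assume "w \<in> K"
      hence "w - \<zeta> \<in> half_strip \<delta>" by (auto simp: K_def in_cbox_complex_iff half_strip_def abs_le_iff)
      moreover have "w = \<zeta> + (w - \<zeta>)" by simp
      ultimately show "w \<in> G" using QG unfolding Q_def by blast
    qed
    show "Q \<inter> {w. - R \<le> Re w} \<subseteq> K" by (auto simp: Q_def K_def in_cbox_complex_iff half_strip_def abs_le_iff)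
  qed
  obtain r C A where r: "r > 0" "C > 0" "A \<ge> 1" and b: "\<And>w0. w0 \<in> Q \<Longrightarrow> ball w0 r \<subseteq> G"
    "\<And>w0 w n. w0 \<in> Q \<Longrightarrow> w \<in> ball w0 r \<Longrightarrow> norm (remainder f u n w) \<le> C * A ^ n * M n"
    by (rule remainder_bound_near[OF M u Qs \<theta>1(1,2) QK], rule that)
  show ?thesis
  proof (rule that[OF r])
    show "ball (\<zeta> + \<omega>) r \<subseteq> G" if "\<omega> \<in> half_strip \<delta>" for \<omega>
      by (rule b(1)) (use that in \<open>simp add: Q_def\<close>)
    show "norm (remainder f u n w) \<le> C * A ^ n * M n" if "\<omega> \<in> half_strip \<delta>" "w \<in> ball (\<zeta> + \<omega>) r" for \<omega> w n
      by (rule b(2)[OF _ that(2)]) (use that(1) in \<open>simp add: Q_def\<close>)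
  qed
qed

text \<open>Openness holds because one radius serves for all points of the translated half strip.
  For connectedness, moving to the left preserves membership, so every point is joined by a ray to a
  small sector inside the region.\<close>

lemma sectorial_region_shrunk:
  assumes M: "strongly_regular M" and u: "is_msum M d f \<theta> G u" and \<delta>: "\<delta> > 0" "2 * \<delta> < \<theta>"
  shows "sectorial_region d (\<theta> - 2 * \<delta>) (shrunk \<delta> G)" "shrunk \<delta> G \<subseteq> G"
proof -
  note reg = is_msum_sectorial[OF u]
  show sub: "shrunk \<delta> G \<subseteq> G"
  proof
    fix \<zeta> assume "\<zeta> \<in> shrunk \<delta> G"
    moreover have "0 \<in> half_strip \<delta>" using \<delta>(1) by (simp add: half_strip_def)
    ultimately have "\<zeta> + 0 \<in> G" unfolding shrunk_def by blast
    thus "\<zeta> \<in> G" by simp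
  qed
  obtain R where R: "R > 0" "G \<subseteq> sector d \<theta> \<inter> rdisc R"
    "\<And>\<theta>'. 0 < \<theta>' \<Longrightarrow> \<theta>' < \<theta> \<Longrightarrow> \<exists>r'. 0 < r' \<and> r' < R \<and> sector d \<theta>' \<inter> rdisc r' \<subseteq> G"
    using reg unfolding sectorial_region_def by blast
  have sect: "\<exists>r'. 0 < r' \<and> r' < R \<and> sector d \<theta>' \<inter> rdisc r' \<subseteq> shrunk \<delta> G"
    if \<theta>': "0 < \<theta>'" "\<theta>' < \<theta> - 2 * \<delta>" for \<theta>'
  proof -
    obtain r' where r': "0 < r'" "r' < R" "sector d (\<theta>' + 2 * \<delta>) \<inter> rdisc r' \<subseteq> G"
      using R(3)[of "\<theta>' + 2 * \<delta>"] \<theta>' \<delta> by auto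
    have "sector d \<theta>' \<inter> rdisc (r' * exp (- \<delta>)) \<subseteq> shrunk \<delta> G"
      unfolding shrunk_def
    proof (intro subsetI CollectI ballI)
      fix \<zeta> \<omega> assume "\<zeta> \<in> sector d \<theta>' \<inter> rdisc (r' * exp (- \<delta>))" "\<omega> \<in> half_strip \<delta>"
      from sector_plus_half_strip[OF this] r'(1)
      have "\<zeta> + \<omega> \<in> sector d (\<theta>' + 2 * \<delta>) \<inter> rdisc r'" by (simp add: mult.assoc flip: exp_add)
      thus "\<zeta> + \<omega> \<in> G" using r'(3) by blast
    qed
    moreover have "r' * exp (- \<delta>) < R"
    proof -
      have "r' * exp (- \<delta>) \<le> r' * 1" using r'(1) \<delta>(1) by (intro mult_left_mono) auto
      thus ?thesis using r'(2) by linarith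
    qed
    moreover have "0 < r' * exp (- \<delta>)" using r'(1) by simp
    ultimately show ?thesis by blast
  qed
  have "open (shrunk \<delta> G)"
    unfolding open_contains_ball
  proof
    fix \<zeta> assume "\<zeta> \<in> shrunk \<delta> G"
    hence \<zeta>: "\<zeta> \<in> shrunk \<delta> G" .
    obtain r C A where r: "r > 0" "C > 0" "A \<ge> 1" "\<And>\<omega>. \<omega> \<in> half_strip \<delta> \<Longrightarrow> ball (\<zeta> + \<omega>) r \<subseteq> G"
      "\<And>\<omega> w n. \<omega> \<in> half_strip \<delta> \<Longrightarrow> w \<in> ball (\<zeta> + \<omega>) r \<Longrightarrow> norm (remainder f u n w) \<le> C * A ^ n * M n"
      by (rule remainder_bound_shrunk[OF M u \<delta> \<zeta>], rule that)
    have "ball \<zeta> r \<subseteq> shrunk \<delta> G"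
    proof
      fix z assume z: "z \<in> ball \<zeta> r"
      have "z + \<omega> \<in> G" if "\<omega> \<in> half_strip \<delta>" for \<omega>
        using r(4)[OF that] z by (auto simp: dist_norm)
      thus "z \<in> shrunk \<delta> G" by (simp add: shrunk_def)
    qed
    thus "\<exists>e>0. ball \<zeta> e \<subseteq> shrunk \<delta> G" using r(1) by blast
  qed
  moreover have subs: "shrunk \<delta> G \<subseteq> sector d (\<theta> - 2 * \<delta>) \<inter> rdisc R"
  proof
    fix \<zeta> assume \<zeta>: "\<zeta> \<in> shrunk \<delta> G"
    hence "\<zeta> + Complex 0 \<delta> \<in> G" "\<zeta> + Complex 0 (- \<delta>) \<in> G" using \<delta>(1) by (auto simp: shrunk_def half_strip_def)
    hence "\<zeta> + Complex 0 \<delta> \<in> sector d \<theta>" "\<zeta> + Complex 0 (- \<delta>) \<in> sector d \<theta>" using R(2) by blast+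
    hence "\<bar>Im \<zeta> + \<delta> - d\<bar> < \<theta> / 2" "\<bar>Im \<zeta> - \<delta> - d\<bar> < \<theta> / 2" by (simp_all add: sector_def)
    moreover have "(\<theta> - 2 * \<delta>) / 2 = \<theta> / 2 - \<delta>" by simp
    ultimately have "\<bar>Im \<zeta> - d\<bar> < (\<theta> - 2 * \<delta>) / 2" by linarith
    thus "\<zeta> \<in> sector d (\<theta> - 2 * \<delta>) \<inter> rdisc R" using R(2) \<zeta> sub by (auto simp: sector_def)
  qed
  moreover have "connected (shrunk \<delta> G)"
    unfolding connected_iff_connected_component
  proof (intro ballI)
    fix \<zeta>1 \<zeta>2 assume \<zeta>: "\<zeta>1 \<in> shrunk \<delta> G" "\<zeta>2 \<in> shrunk \<delta> G"
    have im: "max 0 (max (2 * \<bar>Im \<zeta>1 - d\<bar>) (2 * \<bar>Im \<zeta>2 - d\<bar>)) < \<theta> - 2 * \<delta>"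
      using subs \<zeta> \<delta> by (auto simp: sector_def)
    from dense[OF im] obtain \<theta>' where \<theta>'0: "max 0 (max (2 * \<bar>Im \<zeta>1 - d\<bar>) (2 * \<bar>Im \<zeta>2 - d\<bar>)) < \<theta>'" "\<theta>' < \<theta> - 2 * \<delta>"
      by blast
    hence \<theta>': "0 < \<theta>'" "2 * \<bar>Im \<zeta>1 - d\<bar> < \<theta>'" "2 * \<bar>Im \<zeta>2 - d\<bar> < \<theta>'" by linarith+
    obtain r' where r': "0 < r'" "sector d \<theta>' \<inter> rdisc r' \<subseteq> shrunk \<delta> G" using sect[OF \<theta>'(1) \<theta>'0(2)] by blast
    define ray where "ray \<zeta> = (\<lambda>s. \<zeta> - complex_of_real s) ` {0..}" for \<zeta>
    have ray: "connected (ray \<zeta>)" "\<zeta> \<in> ray \<zeta>" for \<zeta>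
      unfolding ray_def by (auto intro!: connected_continuous_image continuous_intros)
    have ray_sub: "ray \<zeta> \<subseteq> shrunk \<delta> G" if "\<zeta> \<in> shrunk \<delta> G" for \<zeta>
    proof
      fix z assume "z \<in> ray \<zeta>"
      then obtain s where s: "s \<ge> 0" "z = \<zeta> - of_real s" by (auto simp: ray_def)
      have "z + \<omega> \<in> G" if \<omega>: "\<omega> \<in> half_strip \<delta>" for \<omega>
      proof -
        have "\<omega> - of_real s \<in> half_strip \<delta>" using \<omega> s(1) by (simp add: half_strip_def)
        hence "\<zeta> + (\<omega> - of_real s) \<in> G" using \<open>\<zeta> \<in> shrunk \<delta> G\<close> unfolding shrunk_def by blast
        thus ?thesis by (simp add: s(2) algebra_simps)
      qed
      thus "z \<in> shrunk \<delta> G" by (simp add: shrunk_def)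
    qed
    define H where "H = sector d \<theta>' \<inter> rdisc r'"
    have H: "connected H"
      unfolding H_def sector_Int_rdisc[OF r'(1)]
      by (intro convex_connected convex_Int convex_halfspace_Im_gt convex_halfspace_Im_lt convex_halfspace_Re_lt)
    have meet: "ray \<zeta> \<inter> H \<noteq> {}" if "2 * \<bar>Im \<zeta> - d\<bar> < \<theta>'" for \<zeta>
    proof -
      define s where "s = max 0 (Re \<zeta> - ln r' + 1)"
      have "\<zeta> - of_real s \<in> ray \<zeta>" by (auto simp: ray_def s_def)
      moreover have "Re \<zeta> - s < ln r'" by (simp add: s_def)
      hence "\<zeta> - of_real s \<in> H"
        unfolding H_def rdisc_eq[OF r'(1)] using that by (simp add: sector_def)
      ultimately show ?thesis by blast
    qed
    have "connected (ray \<zeta>1 \<union> H)" by (rule connected_Un[OF ray(1) H meet[OF \<theta>'(2)]])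
    hence "connected ((ray \<zeta>1 \<union> H) \<union> ray \<zeta>2)"
      by (rule connected_Un[OF _ ray(1)]) (use meet[OF \<theta>'(3)] in blast)
    moreover have "(ray \<zeta>1 \<union> H) \<union> ray \<zeta>2 \<subseteq> shrunk \<delta> G"
      using ray_sub[OF \<zeta>(1)] ray_sub[OF \<zeta>(2)] r'(2) by (simp add: H_def)
    ultimately show "connected_component (shrunk \<delta> G) \<zeta>1 \<zeta>2"
      unfolding connected_component_def using ray(2) by (intro exI[of _ "(ray \<zeta>1 \<union> H) \<union> ray \<zeta>2"]) auto
  qed
  ultimately show "sectorial_region d (\<theta> - 2 * \<delta>) (shrunk \<delta> G)"
    unfolding sectorial_region_def using \<delta>(2) R(1) sect by auto
qed

text \<open>The remainder is split at order \<open>N\<close> and integrated term by term: the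
  identity for the weights multiplies the coefficient \<open>n + j\<close> by
  \<open>m (j + n) / m j\<close>, which gives the derived series, and moderate growth of
  \<open>M\<close> bounds the last term. The constants may depend on \<open>n\<close> here; the
  bound uniform in \<open>n\<close> is a direct estimate of the boundary integral on
  \<open>G'\<close>.\<close>

lemma moment_derivative_msum:
  fixes f :: "'e::complex_banach fps"
  assumes m: "\<And>p. m p > 0" and M: "strongly_regular M" and u: "is_msum M d f \<theta> G u"
    and W: "boundary_weights \<delta> \<gamma> b k1 k2 k3" and \<delta>: "omega M * pi < \<theta> - 2 * \<delta>" "2 * \<delta> < \<theta>" and n: "n \<ge> 1"
    and ident: "\<And>j. integral {..\<delta>} (\<lambda>x. k1 x * exp (of_nat j * Complex x (- \<delta>)))
          + integral {-\<delta>..\<delta>} (\<lambda>y. k2 y * exp (of_nat j * Complex \<delta> y))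
          + integral {..\<delta>} (\<lambda>x. k3 x * exp (of_nat j * Complex x \<delta>)) = of_real (m (j + n) / m j)"
  shows "is_msum M d ((moment_diff m ^^ n) f) (\<theta> - 2 * \<delta>) (shrunk \<delta> G)
    (\<lambda>\<zeta>. boundary_weights.bdry \<delta> k1 k2 k3 (\<lambda>\<omega>. remainder f u n (\<zeta> + \<omega>)))"
proof -
  interpret boundary_weights \<delta> \<gamma> b k1 k2 k3 by (rule W)
  note pos = strongly_regular_pos[OF M]
  define v where "v = (\<lambda>\<zeta>. bdry (\<lambda>\<omega>. remainder f u n (\<zeta> + \<omega>)))"
  note hol = remainder_holo[OF is_msum_holo[OF u]]
  have G: "open G" using is_msum_sectorial[OF u] by (simp add: sectorial_region_def)
  have adm: "admissible (\<lambda>\<omega>. remainder f u k (\<zeta> + \<omega>))" if \<zeta>: "\<zeta> \<in> shrunk \<delta> G" for k \<zeta>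
  proof -
    obtain r C A where r0: "r > 0" "C > 0" "A \<ge> 1" "\<And>\<omega>. \<omega> \<in> half_strip \<delta> \<Longrightarrow> ball (\<zeta> + \<omega>) r \<subseteq> G"
      and r: "\<And>\<omega> w n. \<omega> \<in> half_strip \<delta> \<Longrightarrow> w \<in> ball (\<zeta> + \<omega>) r \<Longrightarrow>
        norm (remainder f u n w) \<le> C * A ^ n * M n"
      by (rule remainder_bound_shrunk[OF M u \<delta>_pos \<delta>(2) \<zeta>], rule that)
    have "norm (remainder f u k (\<zeta> + \<omega>)) \<le> C * A ^ k * M k" if "\<omega> \<in> half_strip \<delta>" for \<omega>
      by (rule r[OF that]) (use r0(1) in simp)
    moreover have "continuous_on (half_strip \<delta>) (\<lambda>\<omega>. remainder f u k (\<zeta> + \<omega>))"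
      by (rule continuous_on_compose2[OF holo_on_continuous_on[OF hol]])
        (use \<zeta> in \<open>auto intro!: continuous_intros simp: shrunk_def\<close>)
    ultimately show ?thesis unfolding admissible_def bounded_iff by blast
  qed
  have "holo_on v (shrunk \<delta> G)"
    unfolding holo_on_def
  proof
    fix \<zeta> assume \<zeta>: "\<zeta> \<in> shrunk \<delta> G"
    obtain r C A where r0: "C > 0" "A \<ge> 1" and r: "r > 0" "\<And>\<omega>. \<omega> \<in> half_strip \<delta> \<Longrightarrow> ball (\<zeta> + \<omega>) r \<subseteq> G"
      "\<And>\<omega> w n. \<omega> \<in> half_strip \<delta> \<Longrightarrow> w \<in> ball (\<zeta> + \<omega>) r \<Longrightarrow> norm (remainder f u n w) \<le> C * A ^ n * M n"
      by (rule remainder_bound_shrunk[OF M u \<delta>_pos \<delta>(2) \<zeta>], rule that)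
    have "\<exists>D. (v has_derivative (\<lambda>h. h *\<^sub>C D)) (at \<zeta>)"
      unfolding v_def by (rule bdry_holo[OF hol G r])
    thus "\<exists>D. (v has_derivative (\<lambda>h. h *\<^sub>C D)) (at \<zeta> within shrunk \<delta> G)"
      by (blast intro: has_derivative_at_withinI)
  qed
  moreover have "\<exists>C>0. \<exists>A>0. \<forall>N\<ge>1. \<forall>w\<in>sector d \<theta>' \<inter> rdisc r'.
      norm (v w - (\<Sum>p<N. (exp w) ^ p *\<^sub>C fps_nth ((moment_diff m ^^ n) f) p)) \<le> C * A ^ N * M N * exp (Re w) ^ N"
    if \<theta>': "0 < \<theta>'" "\<theta>' < \<theta> - 2 * \<delta>" and r': "0 < r'" and sub: "sector d \<theta>' \<inter> rdisc r' \<subseteq> shrunk \<delta> G" for \<theta>' r'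
  proof -
    have "sector d (\<theta>' + 2 * \<delta>) \<inter> rdisc (r' * exp \<delta>) \<subseteq> G"
    proof
      fix w assume "w \<in> sector d (\<theta>' + 2 * \<delta>) \<inter> rdisc (r' * exp \<delta>)"
      then obtain \<zeta> \<omega> where "\<zeta> \<in> sector d \<theta>' \<inter> rdisc r'" "\<omega> \<in> half_strip \<delta>" "w = \<zeta> + \<omega>"
        by (rule sector_decompose[OF _ \<delta>_pos \<theta>'(1) r'])
      thus "w \<in> G" using sub by (auto simp: shrunk_def)
    qed
    then obtain C A where CA: "C > 0" "A > 0" "\<And>k w. k \<ge> 1 \<Longrightarrow> w \<in> sector d (\<theta>' + 2 * \<delta>) \<inter> rdisc (r' * exp \<delta>) \<Longrightarrow>
        norm (remainder f u k w) \<le> C * A ^ k * M k"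
      using is_msum_remainder_bound[OF u, of "\<theta>' + 2 * \<delta>" "r' * exp \<delta>"] \<theta>' \<delta>_pos r' by auto
    obtain A0 where A0: "A0 \<ge> 1" "\<And>p q. M (p + q) \<le> A0 ^ (p + q) * M p * M q"
      by (rule strongly_regular_mg[OF M], rule that)
    have b: "b \<ge> 0" using order_trans[OF norm_ge_zero k2_le[of 0]] \<delta>_pos by simp
    have mass: "mass \<ge> 0"
      unfolding mass_def using \<delta>_pos integral_nonneg[OF integrable_exp_atMost[OF \<gamma>_pos, of \<delta>]] by simp
    define C' where "C' = C * (A * A0) ^ n * M n * b * mass + 1"
    define A' where "A' = exp \<delta> * A * A0"
    have "C' > 0" "A' > 0" using CA A0 b mass pos[of n] by (auto simp: C'_def A'_def intro!: add_nonneg_pos)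
    moreover have "norm (v \<zeta> - (\<Sum>p<N. (exp \<zeta>) ^ p *\<^sub>C fps_nth ((moment_diff m ^^ n) f) p)) \<le> C' * A' ^ N * M N * exp (Re \<zeta>) ^ N"
      if N: "N \<ge> 1" and \<zeta>: "\<zeta> \<in> sector d \<theta>' \<inter> rdisc r'" for N \<zeta>
    proof -
      have \<zeta>s: "\<zeta> \<in> shrunk \<delta> G" using \<zeta> sub by blast
      define F where "F \<omega> = remainder f u (n + N) (\<zeta> + \<omega>)" for \<omega>
      have F: "admissible F" unfolding F_def by (rule adm[OF \<zeta>s])
      have split: "remainder f u n (\<zeta> + \<omega>) =
          (\<Sum>j<N. exp (of_nat j * \<omega>) *\<^sub>C exp (of_nat j * \<zeta>) *\<^sub>C fps_nth f (n + j))
          + exp (of_nat N * \<omega>) *\<^sub>C exp (of_nat N * \<zeta>) *\<^sub>C F \<omega>" for \<omega>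
        unfolding F_def by (subst remainder_split[of f u n _ N])
          (simp add: scaleC_scaleC algebra_simps flip: exp_add)
      have Fe: "admissible (\<lambda>\<omega>. exp (of_nat N * \<zeta>) *\<^sub>C F \<omega>)"
        by (rule admissible_scaleC[OF F])
      have "v \<zeta> = (\<Sum>j<N. bdry (\<lambda>\<omega>. exp (of_nat j * \<omega>) *\<^sub>C exp (of_nat j * \<zeta>) *\<^sub>C fps_nth f (n + j)))
          + bdry (\<lambda>\<omega>. exp (of_nat N * \<omega>) *\<^sub>C exp (of_nat N * \<zeta>) *\<^sub>C F \<omega>)"
        unfolding v_def split
        by (subst bdry_add) (simp_all add: bdry_sum admissible_sum admissible_exp_mult admissible_const Fe)
      also have "(\<Sum>j<N. bdry (\<lambda>\<omega>. exp (of_nat j * \<omega>) *\<^sub>C exp (of_nat j * \<zeta>) *\<^sub>C fps_nth f (n + j)))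
          = (\<Sum>p<N. (exp \<zeta>) ^ p *\<^sub>C fps_nth ((moment_diff m ^^ n) f) p)"
      proof (rule sum.cong[OF refl])
        fix j
        have "bdry (\<lambda>\<omega>. exp (of_nat j * \<omega>) *\<^sub>C exp (of_nat j * \<zeta>) *\<^sub>C fps_nth f (n + j))
            = of_real (m (j + n) / m j) *\<^sub>C exp (of_nat j * \<zeta>) *\<^sub>C fps_nth f (n + j)"
          unfolding bdry_exp ident ..
        also have "\<dots> = (exp \<zeta>) ^ j *\<^sub>C fps_nth ((moment_diff m ^^ n) f) j"
          unfolding moment_diff_power_nth[OF m] scaleC_of_real scaleR_scaleC_right exp_of_nat_mult
          by (simp add: add.commute)
        finally show "bdry (\<lambda>\<omega>. exp (of_nat j * \<omega>) *\<^sub>C exp (of_nat j * \<zeta>) *\<^sub>C fps_nth f (n + j))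
            = (exp \<zeta>) ^ j *\<^sub>C fps_nth ((moment_diff m ^^ n) f) j" .
      qed
      finally have "norm (v \<zeta> - (\<Sum>p<N. (exp \<zeta>) ^ p *\<^sub>C fps_nth ((moment_diff m ^^ n) f) p))
          = norm (bdry (\<lambda>\<omega>. exp (of_nat N * \<omega>) *\<^sub>C exp (of_nat N * \<zeta>) *\<^sub>C F \<omega>))" by simp
      also have "\<dots> \<le> (exp (real N * \<delta>) * (exp (real N * Re \<zeta>) * (C * A ^ (n + N) * M (n + N)))) * b * mass"
      proof (rule bdry_bound[OF admissible_exp_mult[OF Fe]])
        fix \<omega> assume \<omega>: "\<omega> \<in> half_strip \<delta>"
        have "norm (F \<omega>) \<le> C * A ^ (n + N) * M (n + N)"
          unfolding F_def using sector_plus_half_strip[OF \<zeta> \<omega> r'] n by (intro CA(3)) auto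
        thus "norm (exp (of_nat N * \<omega>) *\<^sub>C exp (of_nat N * \<zeta>) *\<^sub>C F \<omega>)
            \<le> exp (real N * \<delta>) * (exp (real N * Re \<zeta>) * (C * A ^ (n + N) * M (n + N)))"
          unfolding norm_scaleC by (intro mult_mono bounded_exp_half_strip \<omega>) auto
      qed
      also have "\<dots> \<le> (exp (real N * \<delta>) * (exp (real N * Re \<zeta>) * (C * A ^ (n + N) * (A0 ^ (n + N) * M n * M N)))) * b * mass"
        using CA b mass by (intro mult_right_mono mult_left_mono A0) auto
      also have "\<dots> = (C * (A * A0) ^ n * M n * b * mass) * (A' ^ N * M N * exp (Re \<zeta>) ^ N)"
        by (simp only: A'_def power_mult_distrib power_add exp_of_nat_mult) (simp only: mult_ac)
      also have "\<dots> \<le> C' * (A' ^ N * M N * exp (Re \<zeta>) ^ N)"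
        using \<open>A' > 0\<close> pos[of N] by (intro mult_right_mono) (auto simp: C'_def)
      finally show ?thesis by (simp add: mult.assoc)
    qed
    ultimately show ?thesis by blast
  qed
  ultimately show ?thesis
    unfolding is_msum_def v_def[symmetric]
    using sectorial_region_shrunk(1)[OF M u \<delta>_pos \<delta>(2)] \<delta>(1) by blast
qed

section \<open>Uniform bounds on the subregion and the conclusion\<close>

lemma closure_sector_Im:
  assumes "0 < \<theta>'" "\<bar>y - d'\<bar> \<le> \<theta>' / 2"
  shows "Complex x y \<in> closure (sector d' \<theta>')"
  unfolding closure_approachable
proof (intro allI impI)
  fix e :: real assume e: "e > 0"
  define q where "q = \<bar>y - d'\<bar> + 1"
  have q: "0 < q" "\<bar>y - d'\<bar> \<le> q" by (simp_all add: q_def add_nonneg_pos)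
  \<comment> \<open>Pulling the height towards \<open>d'\<close> by the factor \<open>1 - t\<close>
    reaches the open sector and moves the point by at most \<open>e / 2\<close>.\<close>
  define t where "t = min (1/2) (e / (2 * q))"
  have "0 < e / (2 * q)" using e q(1) by simp
  hence t: "0 < t" "t < 1" by (auto simp: t_def min_less_iff_disj)
  define z where "z = Complex x (y - t * (y - d'))"
  have "\<bar>y - t * (y - d') - d'\<bar> = (1 - t) * \<bar>y - d'\<bar>"
  proof -
    have "y - t * (y - d') - d' = (1 - t) * (y - d')" by (simp add: algebra_simps)
    thus ?thesis using t by (simp add: abs_mult)
  qed
  also have "\<dots> < \<theta>' / 2"
  proof -
    have "(1 - t) * \<bar>y - d'\<bar> \<le> (1 - t) * (\<theta>' / 2)" using t assms by (intro mult_left_mono) auto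
    also have "\<dots> < 1 * (\<theta>' / 2)" using t assms(1) by (intro mult_strict_right_mono) auto
    finally show ?thesis by simp
  qed
  finally have "z \<in> sector d' \<theta>'" by (simp add: z_def sector_def)
  moreover have "dist z (Complex x y) < e"
  proof -
    have "z - Complex x y = Complex 0 (- (t * (y - d')))" by (simp add: z_def complex_eq_iff)
    hence "dist z (Complex x y) = t * \<bar>y - d'\<bar>" using t by (simp add: dist_norm cmod_def abs_mult)
    also have "\<dots> \<le> e / (2 * q) * q"
      using t e q by (intro mult_mono) (auto simp: t_def)
    also have "\<dots> = e / 2" using q(1) by simp
    finally show ?thesis using e by simp
  qed
  ultimately show "\<exists>z\<in>sector d' \<theta>'. dist z (Complex x y) < e" by blast
qed

text \<open>\<open>Q\<close> is the closure of \<open>G'\<close> together with the rays from its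
  points to the vertex, and \<open>sectorial_prec\<close> places it inside \<open>G\<close>. Each
  \<open>z + \<omega>\<close> is within \<open>2 * \<delta>\<close> of a point of \<open>Q\<close>,
  so the bounds near \<open>Q\<close> apply. The constants are fixed before \<delta>, which can then
  be chosen small.\<close>

lemma remainder_bound_prec:
  assumes M: "strongly_regular M" and u: "is_msum M d f \<theta> G u"
    and G': "sectorial_region d' \<theta>' G'" and prec: "sectorial_prec d' \<theta>' G' d \<theta> G"
  obtains r C A where "r > 0" "C > 0" "A \<ge> 1"
    "\<And>\<delta> z \<omega>. 0 < \<delta> \<Longrightarrow> 2 * \<delta> < r \<Longrightarrow> z \<in> G' \<Longrightarrow> \<omega> \<in> half_strip \<delta> \<Longrightarrow>
      z + \<omega> \<in> G \<and> (\<forall>n. norm (remainder f u n (z + \<omega>)) \<le> C * A ^ n * M n)"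
proof -
  define Q where "Q = {w - of_real s |w s. w \<in> closure G' \<and> (s::real) \<ge> 0}"
  have QG: "Q \<subseteq> G" using prec by (auto simp: Q_def sectorial_prec_def)
  obtain R' where R': "R' > 0" "G' \<subseteq> sector d' \<theta>' \<inter> rdisc R'" and "0 < \<theta>'"
    using G' unfolding sectorial_region_def by blast
  have cl: "closure G' \<subseteq> {w. \<bar>Im w - d'\<bar> \<le> \<theta>' / 2} \<inter> {w. Re w \<le> ln R'}"
  proof (rule closure_minimal)
    show "G' \<subseteq> {w. \<bar>Im w - d'\<bar> \<le> \<theta>' / 2} \<inter> {w. Re w \<le> ln R'}"
      using R'(2) unfolding rdisc_eq[OF R'(1)] by (auto simp: sector_def)
    show "closed ({w. \<bar>Im w - d'\<bar> \<le> \<theta>' / 2} \<inter> {w. Re w \<le> ln R'})"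
      by (intro closed_Int closed_Collect_le continuous_intros)
  qed
  \<comment> \<open>The border lines belong to the closed sector of \<open>G'\<close> and so lie in
    the open sector of \<open>G\<close>; this leaves room for an opening \<theta>1 below
    \<theta>.\<close>
  have "Complex 0 (d' + \<theta>' / 2) \<in> sector d \<theta>" "Complex 0 (d' - \<theta>' / 2) \<in> sector d \<theta>"
    using prec closure_sector_Im[OF \<open>0 < \<theta>'\<close>] \<open>0 < \<theta>'\<close> unfolding sectorial_prec_def by auto
  hence im: "max \<bar>d' + \<theta>' / 2 - d\<bar> \<bar>d' - \<theta>' / 2 - d\<bar> < \<theta> / 2" by (simp add: sector_def)
  then obtain h where h: "max \<bar>d' + \<theta>' / 2 - d\<bar> \<bar>d' - \<theta>' / 2 - d\<bar> < h" "h < \<theta> / 2" using dense by blast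
  define \<theta>1 where "\<theta>1 = 2 * h"
  have \<theta>1: "0 < \<theta>1" "\<theta>1 < \<theta>" using h by (auto simp: \<theta>1_def)
  have Qs: "Q \<subseteq> sector d \<theta>1"
  proof
    fix z assume "z \<in> Q"
    then obtain w s where "w \<in> closure G'" "z = w - of_real s" by (auto simp: Q_def)
    hence "\<bar>Im z - d'\<bar> \<le> \<theta>' / 2" using cl by auto
    hence "\<bar>Im z - d\<bar> < h" using h by linarith
    thus "z \<in> sector d \<theta>1" by (simp add: sector_def \<theta>1_def)
  qed
  have QK: "\<exists>K. compact K \<and> K \<subseteq> G \<and> Q \<inter> {w. - R \<le> Re w} \<subseteq> K" for R
  proof (intro exI conjI)
    define K0 where "K0 = closure G' \<inter> {w. - R \<le> Re w}"
    \<comment> \<open>Points of \<open>Q\<close> with real part at least \<open>- R\<close> arise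
      from points of \<open>K0\<close> by shifts of at most \<open>ln R' + R\<close>, so they lie in
      a continuous image of a compact set.\<close>
    define K where "K = (\<lambda>(w, s). w - complex_of_real s) ` (K0 \<times> {0..ln R' + R})"
    have "compact K0"
      unfolding compact_eq_bounded_closed
    proof
      have "K0 \<subseteq> cbox (Complex (- R) (d' - \<theta>' / 2)) (Complex (ln R') (d' + \<theta>' / 2))"
      proof
        fix w assume "w \<in> K0"
        hence "\<bar>Im w - d'\<bar> \<le> \<theta>' / 2" "Re w \<le> ln R'" "- R \<le> Re w" using cl by (auto simp: K0_def)
        moreover from this have "d' - \<theta>' / 2 \<le> Im w" "Im w \<le> d' + \<theta>' / 2" by linarith+
        ultimately show "w \<in> cbox (Complex (- R) (d' - \<theta>' / 2)) (Complex (ln R') (d' + \<theta>' / 2))"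
          by (simp add: in_cbox_complex_iff)
      qed
      thus "bounded K0" using bounded_cbox bounded_subset by blast
      show "closed K0" unfolding K0_def by (intro closed_Int closed_closure closed_halfspace_Re_ge)
    qed
    thus "compact K"
      unfolding K_def
      by (intro compact_continuous_image compact_Times compact_Icc)
        (auto simp: case_prod_unfold intro!: continuous_intros)
    show "K \<subseteq> G"
    proof
      fix z assume "z \<in> K"
      then obtain w s where "w \<in> closure G'" "s \<ge> 0" "z = w - complex_of_real s" by (auto simp: K_def K0_def)
      hence "z \<in> Q" unfolding Q_def by blast
      thus "z \<in> G" using QG by blast
    qed
    show "Q \<inter> {w. - R \<le> Re w} \<subseteq> K"
    proof
      fix z assume "z \<in> Q \<inter> {w. - R \<le> Re w}"
      then obtain w s where w: "w \<in> closure G'" "s \<ge> 0" "z = w - of_real s" "- R \<le> Re w - s" by (auto simp: Q_def)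
      have "Re w \<le> ln R'" using cl w(1) by auto
      hence "(w, s) \<in> K0 \<times> {0..ln R' + R}" using w by (auto simp: K0_def)
      thus "z \<in> K" unfolding K_def w(3) by (rule image_eqI[rotated]) simp
    qed
  qed
  obtain r C A where r: "r > 0" "C > 0" "A \<ge> 1" and b: "\<And>w0. w0 \<in> Q \<Longrightarrow> ball w0 r \<subseteq> G"
    "\<And>w0 w n. w0 \<in> Q \<Longrightarrow> w \<in> ball w0 r \<Longrightarrow> norm (remainder f u n w) \<le> C * A ^ n * M n"
    by (rule remainder_bound_near[OF M u Qs \<theta>1 QK], rule that)
  show ?thesis
  proof (rule that[OF r])
    fix \<delta> :: real and z \<omega> assume \<delta>: "0 < \<delta>" "2 * \<delta> < r" and z: "z \<in> G'" and \<omega>: "\<omega> \<in> half_strip \<delta>"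
    \<comment> \<open>The point of the ray below \<open>z\<close> that is level with
      \<open>z + \<omega>\<close> in real part, or \<open>z\<close> itself if \<omega> points to the
      right.\<close>
    define s where "s = max 0 (- Re \<omega>)"
    have "z - of_real s \<in> Q" using z closure_subset unfolding Q_def s_def by fastforce
    moreover have "z + \<omega> \<in> ball (z - of_real s) r"
    proof -
      have "z + \<omega> - (z - of_real s) = \<omega> + of_real s" by simp
      hence "dist (z - of_real s) (z + \<omega>) = cmod (\<omega> + of_real s)"
        by (metis dist_commute dist_norm)
      also have "\<dots> \<le> \<bar>Re \<omega> + s\<bar> + \<bar>Im \<omega>\<bar>" using cmod_le[of "\<omega> + of_real s"] by simp
      also have "\<dots> \<le> \<delta> + \<delta>" using \<omega> \<delta>(1) by (auto simp: half_strip_def s_def)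
      finally show ?thesis using \<delta>(2) by simp
    qed
    ultimately show "z + \<omega> \<in> G \<and> (\<forall>n. norm (remainder f u n (z + \<omega>)) \<le> C * A ^ n * M n)"
      using b by blast
  qed
qed

theorem proposition2:
  fixes uhat :: "'e::complex_banach fps"
    and m Mt :: "nat \<Rightarrow> real"
    and d \<theta> d' \<theta>' :: real
    and G G' :: "complex set"
    and u :: "complex \<Rightarrow> 'e"
  assumes "moment_sequence m"
    and "strongly_regular Mt"
    and "admits_nonzero_proximate_order Mt"
    and "msummable Mt d uhat"
    and "is_msum Mt d uhat \<theta> G u"
    and "sectorial_region d' \<theta>' G'"
    and "sectorial_prec d' \<theta>' G' d \<theta> G"
  shows "\<exists>C4>0. \<exists>C5>0. \<forall>n::nat.
           (\<exists>v. is_msum_over Mt d ((moment_diff m ^^ n) uhat) G' v) \<and>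
           (\<forall>v. is_msum_over Mt d ((moment_diff m ^^ n) uhat) G' v \<longrightarrow>
              (\<forall>z\<in>G'. norm (v z) \<le> C4 * C5 ^ n * m n * Mt n))"
proof -
  note M = assms(2) and prox = assms(3) and u = assms(5) and G' = assms(6) and prec = assms(7)
  have sr: "strongly_regular m" using assms(1) by (simp add: moment_sequence_def)
  note mpos = strongly_regular_pos[OF sr] and Mpos = strongly_regular_pos[OF M]
  obtain r C A where r: "r > 0" and CA: "C > 0" "A \<ge> 1" and near:
    "\<And>\<delta> z \<omega>. 0 < \<delta> \<Longrightarrow> 2 * \<delta> < r \<Longrightarrow> z \<in> G' \<Longrightarrow> \<omega> \<in> half_strip \<delta> \<Longrightarrow>
      z + \<omega> \<in> G \<and> (\<forall>n. norm (remainder uhat u n (z + \<omega>)) \<le> C * A ^ n * Mt n)"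
    by (rule remainder_bound_prec[OF M u G' prec], rule that)
  have \<theta>: "omega Mt * pi < \<theta>" "0 < \<theta>" using u by (auto simp: is_msum_def sectorial_region_def)
  \<comment> \<open>Small enough for the translated half strips to stay near the rays of
    \<open>G'\<close>, for the kernel weights to exist, and for the reduced opening
    \<open>\<theta> - 2 * \<delta>\<close> to exceed 0 and \<open>omega Mt * pi\<close>.\<close>
  define \<delta> where "\<delta> = min (min (r / 4) 1) (min (\<theta> / 4) ((\<theta> - omega Mt * pi) / 4))"
  have \<delta>: "0 < \<delta>" "2 * \<delta> < r" "\<delta> < pi" "2 * \<delta> < \<theta>" "omega Mt * pi < \<theta> - 2 * \<delta>"
    using r \<theta> pi_gt3 by (auto simp: \<delta>_def min_def field_simps)
  have sub: "G' \<subseteq> shrunk \<delta> G" using near[OF \<delta>(1,2)] by (auto simp: shrunk_def)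
  obtain \<gamma> K B where gKB: "\<gamma> > 0" "K > 0" "B \<ge> 1"
    "\<And>n. n \<ge> 1 \<Longrightarrow> \<exists>k1 k2 k3 :: real \<Rightarrow> complex.
       continuous_on {..\<delta>} k1 \<and> continuous_on {-\<delta>..\<delta>} k2 \<and> continuous_on {..\<delta>} k3 \<and>
       (\<forall>x\<le>\<delta>. cmod (k1 x) \<le> K * B ^ n * m n * exp (\<gamma> * x)) \<and>
       (\<forall>y\<in>{-\<delta>..\<delta>}. cmod (k2 y) \<le> K * B ^ n * m n) \<and>
       (\<forall>x\<le>\<delta>. cmod (k3 x) \<le> K * B ^ n * m n * exp (\<gamma> * x)) \<and>
       (\<forall>j. integral {..\<delta>} (\<lambda>x. k1 x * exp (of_nat j * Complex x (- \<delta>)))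
          + integral {-\<delta>..\<delta>} (\<lambda>y. k2 y * exp (of_nat j * Complex \<delta> y))
          + integral {..\<delta>} (\<lambda>x. k3 x * exp (of_nat j * Complex x \<delta>)) = of_real (m (j + n) / m j))"
    by (rule kernel_weights[OF assms(1) \<delta>(1,3)], rule that)
  define I where "I = 2 * integral {..\<delta>} (\<lambda>x. exp (\<gamma> * x)) + 2 * \<delta>"
  have I: "I \<ge> 0"
    unfolding I_def using \<delta>(1) integral_nonneg[OF integrable_exp_atMost[OF gKB(1), of \<delta>]] by simp
  \<comment> \<open>The summand 1 makes \<open>C4 \<ge> C\<close>, as \<open>n = 0\<close>
    requires.\<close>
  define C4 where "C4 = C * (K * I + 1)"
  define C5 where "C5 = A * B"
  have C45: "C4 > 0" "C5 > 0" using CA gKB I by (auto simp: C4_def C5_def intro!: mult_pos_pos add_nonneg_pos)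
  have main: "\<exists>\<theta>1 G1 v. is_msum Mt d ((moment_diff m ^^ n) uhat) \<theta>1 G1 v \<and> G' \<subseteq> G1 \<and>
      (\<forall>z\<in>G'. norm (v z) \<le> C4 * C5 ^ n * m n * Mt n)" for n
  proof (cases "n \<ge> 1")
    \<comment> \<open>The kernel weights are given for \<open>n \<ge> 1\<close>; for
      \<open>n = 0\<close> the sum is \<open>u\<close> itself.\<close>
    case False
    hence n: "n = 0" by simp
    have "norm (u z) \<le> C4 * C5 ^ n * m n * Mt n" if "z \<in> G'" for z
    proof -
      have "0 \<in> half_strip \<delta>" using \<delta>(1) by (simp add: half_strip_def)
      from near[OF \<delta>(1,2) that this] have "norm (u z) \<le> C"
        by (auto simp: remainder_0 strongly_regular_0[OF M] dest!: spec[of _ 0])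
      also have "C * 1 \<le> C4" unfolding C4_def using CA gKB I by (intro mult_left_mono) auto
      finally show ?thesis by (simp add: n strongly_regular_0[OF M] strongly_regular_0[OF sr])
    qed
    moreover have "G' \<subseteq> G" using sub sectorial_region_shrunk(2)[OF M u \<delta>(1,4)] by blast
    ultimately show ?thesis using u by (intro exI[of _ \<theta>] exI[of _ G] exI[of _ u]) (simp add: n)
  next
    case True
    obtain k1 k2 k3 :: "real \<Rightarrow> complex" where k:
      "continuous_on {..\<delta>} k1" "continuous_on {-\<delta>..\<delta>} k2" "continuous_on {..\<delta>} k3"
      "\<forall>x\<le>\<delta>. cmod (k1 x) \<le> K * B ^ n * m n * exp (\<gamma> * x)"
      "\<forall>y\<in>{-\<delta>..\<delta>}. cmod (k2 y) \<le> K * B ^ n * m n"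
      "\<forall>x\<le>\<delta>. cmod (k3 x) \<le> K * B ^ n * m n * exp (\<gamma> * x)"
      "\<forall>j. integral {..\<delta>} (\<lambda>x. k1 x * exp (of_nat j * Complex x (- \<delta>)))
          + integral {-\<delta>..\<delta>} (\<lambda>y. k2 y * exp (of_nat j * Complex \<delta> y))
          + integral {..\<delta>} (\<lambda>x. k3 x * exp (of_nat j * Complex x \<delta>)) = of_real (m (j + n) / m j)"
      using gKB(4)[OF True] by blast
    have W: "boundary_weights \<delta> \<gamma> (K * B ^ n * m n) k1 k2 k3"
      by unfold_locales (use k \<delta>(1) gKB(1) in auto)
    interpret boundary_weights \<delta> \<gamma> "K * B ^ n * m n" k1 k2 k3 by (rule W)
    define v where "v = (\<lambda>\<zeta>. bdry (\<lambda>\<omega>. remainder uhat u n (\<zeta> + \<omega>)))"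
    have v: "is_msum Mt d ((moment_diff m ^^ n) uhat) (\<theta> - 2 * \<delta>) (shrunk \<delta> G) v"
      unfolding v_def by (rule moment_derivative_msum[OF mpos M u W \<delta>(5,4) True k(7)[rule_format]])
    have "norm (v z) \<le> C4 * C5 ^ n * m n * Mt n" if z: "z \<in> G'" for z
    proof -
      have zw: "z + \<omega> \<in> G" "norm (remainder uhat u n (z + \<omega>)) \<le> C * A ^ n * Mt n" if "\<omega> \<in> half_strip \<delta>" for \<omega>
        using near[OF \<delta>(1,2) z that] by auto
      have "continuous_on (half_strip \<delta>) (\<lambda>\<omega>. remainder uhat u n (z + \<omega>))"
        by (rule continuous_on_compose2[OF holo_on_continuous_on[OF remainder_holo[OF is_msum_holo[OF u]]]])
          (use zw(1) in \<open>auto intro!: continuous_intros\<close>)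
      hence "admissible (\<lambda>\<omega>. remainder uhat u n (z + \<omega>))"
        using zw(2) unfolding admissible_def bounded_iff by blast
      \<comment> \<open>Here the two growth rates multiply: \<open>Mt n\<close> from the remainder
        and \<open>m n\<close> from the weights, while \<open>mass\<close> is free of
        \<open>n\<close>.\<close>
      hence "norm (v z) \<le> (C * A ^ n * Mt n) * (K * B ^ n * m n) * mass"
        unfolding v_def by (rule bdry_bound) (rule zw(2))
      also have "\<dots> = (C * (K * I)) * (C5 ^ n * m n * Mt n)"
        by (simp add: mass_def I_def C5_def power_mult_distrib mult_ac)
      also have "\<dots> \<le> C4 * (C5 ^ n * m n * Mt n)"
        using CA C45(2) mpos[of n] Mpos[of n] unfolding C4_def by (intro mult_right_mono) auto
      finally show ?thesis by (simp add: mult.assoc)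
    qed
    thus ?thesis using v sub by blast
  qed
  show ?thesis
  proof (rule exI[of _ C4], rule conjI[OF C45(1)], rule exI[of _ C5], rule conjI[OF C45(2)], intro allI conjI impI ballI)
    fix n
    obtain \<theta>1 G1 v1 where v1: "is_msum Mt d ((moment_diff m ^^ n) uhat) \<theta>1 G1 v1" "G' \<subseteq> G1"
      "\<And>z. z \<in> G' \<Longrightarrow> norm (v1 z) \<le> C4 * C5 ^ n * m n * Mt n"
      using main[of n] by blast
    show "\<exists>v. is_msum_over Mt d ((moment_diff m ^^ n) uhat) G' v"
      using v1 unfolding is_msum_over_def by blast
    fix v z assume v: "is_msum_over Mt d ((moment_diff m ^^ n) uhat) G' v" and z: "z \<in> G'"
    then obtain \<theta>2 G2 where v2: "is_msum Mt d ((moment_diff m ^^ n) uhat) \<theta>2 G2 v" "G' \<subseteq> G2"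
      unfolding is_msum_over_def by blast
    \<comment> \<open>Uniqueness transfers the bound from the representative constructed by the
      boundary integral to an arbitrary one.\<close>
    have "v z = v1 z" by (rule msum_unique[OF M prox v2(1) v1(1) G' v2(2) v1(2) z])
    thus "norm (v z) \<le> C4 * C5 ^ n * m n * Mt n" using v1(3)[OF z] by simp
  qed
qed

end
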